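(* Let $\Bbbk$ be a field of characteristic zero and $m\ge2$. Let $\Bbbk\langle x,z\rangle_m$ be the depth $m$ component of $\Bbbk\langle x,z\rangle$ and let $f_m:\Bbbk\langle x,z\rangle_m\to\Bbbk[x_1,\dots,x_m]$ be the linear map given by $f_m(x^{n_1}z\cdots x^{n_m}zx^{n_{m+1}})=\delta_{0,n_{m+1}}\,x_1^{n_1}\cdots x_m^{n_m}$ ($\delta_{a,b}$ the Kronecker delta). Then $f_m$ restricts to an isomorphism of weight-graded spaces $\bar f_m:\mathfrak{ls}_m\to\mathrm{Dsh}_m$, where $\mathfrak{ls}_m$ is the depth $m$ component of $\mathfrak{ls}$, and the following diagram of weight-graded isomorphisms commutes: the composite $$\mathrm{Dsh}_m^\vee\xrightarrow{\ \bar h_m\circ g_m^{-1}\ }W_m/(W_R)_m\xrightarrow{\ \varepsilon\circ\bar i\ }\mathfrak{ls}_m^\vee$$ equals $\bar f_m^\vee:\mathrm{Dsh}_m^\vee\to\mathfrak{ls}_m^\vee$. The maps $h_m,\bar h_m,g_m,\bar i,\varepsilon$ are defined in the context.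
   Context: $S(p,q)$ is the set of permutations $\sigma$ of $\{1,\dots,p+q\}$ increasing on $\{1,\dots,p\}$ and on $\{p+1,\dots,p+q\}$. ${}^\vee$ denotes the graded dual of a space or a map. The algebra $\Bbbk\langle x,z\rangle$ is the free associative algebra on $x,z$, bigraded by depth (degree in $z$) and weight (total degree); $\langle-,-\rangle$ is the pairing for which words form an orthonormal basis. The shuffle product $\mathrm{sh}$ is bilinear with unit $1$ and $a_1\cdots a_p\mathbin{\mathrm{sh}}a_{p+1}\cdots a_{p+q}=\sum_{\sigma\in S(p,q)}a_{\sigma^{-1}(1)}\cdots a_{\sigma^{-1}(p+q)}$ for letters $a_i$. The space $\mathfrak{ls}$. Let $Y=\{y_i\mid i\ge1\}$ and $\Bbbk\langle Y\rangle$ the free associative algebra. $\Delta$ (resp. $\Delta_Y$) is the algebra morphism $\Bbbk\langle x,z\rangle\to\Bbbk\langle x,z\rangle^{\otimes2}$ (resp. $\Bbbk\langle Y\rangle\to\Bbbk\langle Y\rangle^{\otimes2}$) with $a\mapsto1\otimes a+a\otimes1$ for each letter $a$. $\pi:\Bbbk\langle x,z\rangle\to\Bbbk\langle Y\rangle$ is linear with $\pi(\Bbbk\langle x,z\rangle x)=0$, $\pi(1)=1$, $\pi(x^{n_1-1}z\cdots x^{n_m-1}z)=y_{n_1}\cdots y_{n_m}$. $\mathfrak{ls}$ is the bigraded space of $\psi\in\Bbbk\langle x,z\rangle$ with $\Delta(\psi)=1\otimes\psi+\psi\otimes1$, $\Delta_Y(\pi(\psi))=1\otimes\pi(\psi)+\pi(\psi)\otimes1$,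 and such that the depth-$0$ component of $\psi$ is zero and its depth-$1$ component has only odd-weight components. Double shuffle space. For $m\ge2$, $S_m$ and $T_\sigma$ ($\sigma$ a permutation of $\{1,\dots,m\}$) are the algebra automorphisms of $\Bbbk[x_1,\dots,x_m]$ with $S_m(x_i)=x_i+\cdots+x_m$, $T_\sigma(x_i)=x_{\sigma^{-1}(i)}$. For $1\le l\le m-1$, $T_{m,*}^{(l)}=\sum_{\sigma\in S(l,m-l)}T_\sigma$ and $T_{m,\mathrm{sh}}^{(l)}=T_{m,*}^{(l)}\circ S_m$. $\mathrm{Dsh}_m=\bigcap_{l=1}^{m-1}(\ker T_{m,*}^{(l)}\cap\ker T_{m,\mathrm{sh}}^{(l)})$. The weight $k$ part ($k\ge m$) of $\Bbbk[x_1,\dots,x_m]$ and of $\mathrm{Dsh}_m$ consists of homogeneous polynomials of degree $k-m$. $\mathrm{Dsh}_m'\subset\Bbbk[x_1,\dots,x_m]^\vee$ is the space of forms vanishing on $\mathrm{Dsh}_m$. The spaces $W,W_R,U,V,F$. $W$ is the free vector space on symbols $I(n_1,\dots,n_m)$, $m\ge1$, $n_i\ge1$ (depth $m$, weight $n_1+\dots+n_m$). Set $$\{t_1:\cdots:t_m:t_{m+1}\}=\sum_{n_1,\dots,n_m\ge1}I(n_1,\dots,n_m)(t_1-t_{m+1})^{n_1-1}\cdots(t_m-t_{m+1})^{n_m-1},$$ $$\{t_1,\dots,t_m\}=\{t_1:t_1+t_2:\cdots:t_1+\cdots+t_m:0\}.$$ $W_\star$ is generated by the coefficients of $\sum_{\sigma\in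 S(p,q)}\{t_{\sigma^{-1}(1)}:\cdots:t_{\sigma^{-1}(p+q)}:t_{p+q+1}\}$ for all $p,q\ge1$; $W_{\mathrm{sh}}$ by the coefficients of $\sum_{\sigma\in S(p,q)}\{t_{\sigma^{-1}(1)},\dots,t_{\sigma^{-1}(p+q)}\}$ for all $p,q\ge1$; $W_{1,even}$ by the $I(2n)$, $n\ge1$. $W_R=W_\star+W_{\mathrm{sh}}+W_{1,even}$. $U$ is the free vector space on the symbols $I'(n_0,\dots,n_m)$, $m\ge0$, all $n_i\ge1$ (depth $m$, weight $n_0+\dots+n_m$), and $I'(0)$ (depth $0$, weight $0$). $V=W\oplus U$, $F=W_R\oplus U$. A subscript $m$ denotes the depth $m$ component. The maps. $\phi:V\to\Bbbk\langle x,z\rangle$ is the bigraded linear isomorphism with $\phi(I(n_1,\dots,n_m))=x^{n_m-1}z\cdots x^{n_1-1}z$, $\phi(I'(n_0,n_1,\dots,n_m))=(x^{n_m-1}z\cdots x^{n_1-1}zx^{n_0-1})\mathbin{\mathrm{sh}}x$ for $m\ge1$, $\phi(I'(n_0))=x^{n_0-1}\mathbin{\mathrm{sh}}x$ for $n_0\ge1$, $\phi(I'(0))=1$. $\bar i:W_m/(W_R)_m\to V_m/F_m$ is the isomorphism induced by the inclusion $W\subset V$. $\varepsilon:V_m/F_m\to\mathfrak{ls}_m^\vee$ is the isomorphism $\bar v\mapsto\langle\phi(v),-\rangle$ ($v$ any lift of $\bar v$). $h_m:\Bbbk[x_1,\dots,x_m]^\vee\to W_m$ is the graded isomorphism $h_m(\varphi)=\sum_{n_i\ge1}\varphi(x_1^{n_m-1}\cdots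 x_m^{n_1-1})I(n_1,\dots,n_m)$; it maps $\mathrm{Dsh}_m'$ onto $(W_R)_m$, and $\bar h_m:\Bbbk[x_1,\dots,x_m]^\vee/\mathrm{Dsh}_m'\to W_m/(W_R)_m$ is the induced map. $g_m:\Bbbk[x_1,\dots,x_m]^\vee/\mathrm{Dsh}_m'\to\mathrm{Dsh}_m^\vee$ is the isomorphism induced by restriction of forms. *)

theory Defs
  imports
    Complex_Main
    "HOL-Library.Poly_Mapping"
    "HOL-Library.Product_Plus"
    "HOL-Combinatorics.Permutations"
begin

alias lookup = Poly_Mapping.lookup
alias keys = Poly_Mapping.keys
alias single = Poly_Mapping.single

section \<open>Free vector spaces\<close>

text \<open>The type \<^typ>\<open>'a \<Rightarrow>\<^sub>0 'k\<close> is the free \<open>'k\<close>-vector space with basis \<open>single a 1\<close>.\<close>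

definition pscale :: "'k::field \<Rightarrow> ('a \<Rightarrow>\<^sub>0 'k) \<Rightarrow> ('a \<Rightarrow>\<^sub>0 'k)" where
  "pscale c v = Poly_Mapping.map ((*) c) v"

lemma lookup_pscale [simp]: "lookup (pscale c v) a = c * lookup v a"
  unfolding pscale_def by transfer (simp add: when_def)

interpretation free_vs: vector_space "pscale :: 'k::field \<Rightarrow> ('a \<Rightarrow>\<^sub>0 'k) \<Rightarrow> ('a \<Rightarrow>\<^sub>0 'k)"
  by unfold_locales (auto intro!: poly_mapping_eqI simp: lookup_add algebra_simps)

definition lin_ext :: "('a \<Rightarrow> ('b \<Rightarrow>\<^sub>0 'k)) \<Rightarrow> ('a \<Rightarrow>\<^sub>0 'k::field) \<Rightarrow> ('b \<Rightarrow>\<^sub>0 'k)" where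
  "lin_ext f v = (\<Sum>a\<in>keys v. pscale (lookup v a) (f a))"

text \<open>The part of a subspace supported on basis elements \<open>a\<close> with \<open>d a = n\<close>.\<close>

definition component :: "('a \<Rightarrow> nat) \<Rightarrow> nat \<Rightarrow> ('a \<Rightarrow>\<^sub>0 'k::field) set \<Rightarrow> ('a \<Rightarrow>\<^sub>0 'k) set" where
  "component d n S = {v \<in> S. \<forall>a\<in>keys v. d a = n}"


section \<open>Weight-graded vector spaces, graded duals and quotients\<close>

text \<open>The set \<open>gpart A k\<close> is the weight \<open>k\<close> component of \<open>A\<close>.\<close>

record ('k, 'v) gspace =
  gcarrier :: "'v set"
  gplus :: "'v \<Rightarrow> 'v \<Rightarrow> 'v"
  gscale :: "'k \<Rightarrow> 'v \<Rightarrow> 'v"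
  gpart :: "nat \<Rightarrow> 'v set"

definition graded_iso :: "('k, 'v) gspace \<Rightarrow> ('k, 'w) gspace \<Rightarrow> ('v \<Rightarrow> 'w) \<Rightarrow> bool" where
  "graded_iso A B f \<longleftrightarrow>
     bij_betw f (gcarrier A) (gcarrier B) \<and>
     (\<forall>u\<in>gcarrier A. \<forall>v\<in>gcarrier A. f (gplus A u v) = gplus B (f u) (f v)) \<and>
     (\<forall>c. \<forall>v\<in>gcarrier A. f (gscale A c v) = gscale B c (f v)) \<and>
     (\<forall>k. f ` gpart A k = gpart B k)"

definition subspace_graded :: "('a \<Rightarrow> nat) \<Rightarrow> ('a \<Rightarrow>\<^sub>0 'k::field) set \<Rightarrow> ('k, 'a \<Rightarrow>\<^sub>0 'k) gspace" where
  "subspace_graded wt S =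
     \<lparr>gcarrier = S, gplus = (+), gscale = pscale, gpart = (\<lambda>k. component wt k S)\<rparr>"

text \<open>
  A linear form on a space with carrier \<open>S\<close> is represented by the function that is \<open>0\<close> outside
  \<open>S\<close>, so that equality of forms is equality of functions and \<open>restr0 T\<close> restricts forms to a
  subspace \<open>T\<close>.  The graded dual \<open>\<Oplus>\<^sub>k (A\<^sub>k)\<^sup>*\<close> consists of the forms that are nonzero on only
  finitely many weight components.
\<close>

definition restr0 :: "'v set \<Rightarrow> ('v \<Rightarrow> 'k::zero) \<Rightarrow> 'v \<Rightarrow> 'k" where
  "restr0 S \<alpha> = (\<lambda>v. if v \<in> S then \<alpha> v else 0)"

definition graded_dual_carrier :: "('k::field, 'v) gspace \<Rightarrow> ('v \<Rightarrow> 'k) set" where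
  "graded_dual_carrier A = {\<alpha>.
     (\<forall>u\<in>gcarrier A. \<forall>v\<in>gcarrier A. \<alpha> (gplus A u v) = \<alpha> u + \<alpha> v) \<and>
     (\<forall>c. \<forall>v\<in>gcarrier A. \<alpha> (gscale A c v) = c * \<alpha> v) \<and>
     (\<forall>v. v \<notin> gcarrier A \<longrightarrow> \<alpha> v = 0) \<and>
     finite {k. \<exists>v\<in>gpart A k. \<alpha> v \<noteq> 0}}"

definition graded_dual :: "('k::field, 'v) gspace \<Rightarrow> ('k, 'v \<Rightarrow> 'k) gspace" where
  "graded_dual A =
     \<lparr>gcarrier = graded_dual_carrier A,
      gplus = (\<lambda>\<alpha> \<beta> v. \<alpha> v + \<beta> v),
      gscale = (\<lambda>c \<alpha> v. c * \<alpha> v),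
      gpart = (\<lambda>k. {\<alpha> \<in> graded_dual_carrier A. \<forall>j. j \<noteq> k \<longrightarrow> (\<forall>v\<in>gpart A j. \<alpha> v = 0)})\<rparr>"

definition dual_map :: "('k::field, 'v) gspace \<Rightarrow> ('v \<Rightarrow> 'w) \<Rightarrow> ('w \<Rightarrow> 'k) \<Rightarrow> ('v \<Rightarrow> 'k)" where
  "dual_map A f \<alpha> = restr0 (gcarrier A) (\<alpha> \<circ> f)"

text \<open>Elements of the quotient of \<open>A\<close> by a subspace \<open>U\<close> are the cosets \<open>v + U\<close>.\<close>

definition coset :: "('k, 'v) gspace \<Rightarrow> 'v set \<Rightarrow> 'v \<Rightarrow> 'v set" where
  "coset A U v = (\<lambda>u. gplus A v u) ` U"

definition quotient_graded :: "('k, 'v) gspace \<Rightarrow> 'v set \<Rightarrow> ('k, 'v set) gspace" where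
  "quotient_graded A U =
     \<lparr>gcarrier = coset A U ` gcarrier A,
      gplus = (\<lambda>C D. {gplus A v w |v w. v \<in> C \<and> w \<in> D}),
      gscale = (\<lambda>c C. {gplus A (gscale A c v) u |v u. v \<in> C \<and> u \<in> U}),
      gpart = (\<lambda>k. coset A U ` gpart A k)\<rparr>"

text \<open>
  \<^term>\<open>the_elem (F ` C)\<close> is the common value of \<open>F\<close> on the coset \<open>C\<close>, hence the map induced by
  \<open>F\<close> on the quotient; it is unspecified if \<open>F\<close> is not constant on \<open>C\<close>.
\<close>

definition descend :: "('v \<Rightarrow> 'w) \<Rightarrow> 'v set \<Rightarrow> 'w" where
  "descend F C = the_elem (F ` C)"

definition induced_map :: "('k, 'w) gspace \<Rightarrow> 'w set \<Rightarrow> ('v \<Rightarrow> 'w) \<Rightarrow> 'v set \<Rightarrow> 'w set" where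
  "induced_map B U' f = descend (\<lambda>v. coset B U' (f v))"


section \<open>Words, the shuffle product and the coproduct\<close>

text \<open>
  Lists form the free monoid under concatenation.  With this instance the library product on
  \<^typ>\<open>'l list \<Rightarrow>\<^sub>0 'k\<close> is that of the free associative algebra on the letters \<open>'l\<close>, and the one on
  \<^typ>\<open>('l list \<times> 'l list) \<Rightarrow>\<^sub>0 'k\<close> is that of its tensor square, the pair \<open>(u, v)\<close> being the
  basis element \<open>u \<otimes> v\<close>.
\<close>

instantiation list :: (type) monoid_add
begin
definition zero_list :: "'a list" where "zero_list = []"
definition plus_list :: "'a list \<Rightarrow> 'a list \<Rightarrow> 'a list" where "plus_list = (@)"
instance by standard (simp_all add: zero_list_def plus_list_def)
end

text \<open>The set \<open>S(p,q)\<close>.\<close>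

definition shuffle_perms :: "nat \<Rightarrow> nat \<Rightarrow> (nat \<Rightarrow> nat) set" where
  "shuffle_perms p q = {\<sigma>. \<sigma> permutes {1..p+q} \<and>
     strict_mono_on {1..p} \<sigma> \<and> strict_mono_on {p+1..p+q} \<sigma>}"

text \<open>Lists are indexed from \<open>0\<close>: the \<open>i\<close>-th letter of \<open>w\<close> is \<open>w ! (i - 1)\<close>.\<close>

definition shuffle_word :: "'l list \<Rightarrow> 'l list \<Rightarrow> ('l list \<Rightarrow>\<^sub>0 'k::field)" where
  "shuffle_word u v = (\<Sum>\<sigma>\<in>shuffle_perms (length u) (length v).
     single
       (map (\<lambda>i. (u @ v) ! (inv \<sigma> i - 1)) [1..<length u + length v + 1]) 1)"

definition shuffle :: "('l list \<Rightarrow>\<^sub>0 'k::field) \<Rightarrow> ('l list \<Rightarrow>\<^sub>0 'k) \<Rightarrow> ('l list \<Rightarrow>\<^sub>0 'k)" where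
  "shuffle p q = lin_ext (\<lambda>u. lin_ext (\<lambda>v. shuffle_word u v) q) p"

definition pairing :: "('a \<Rightarrow>\<^sub>0 'k::field) \<Rightarrow> ('a \<Rightarrow>\<^sub>0 'k) \<Rightarrow> 'k" where
  "pairing p q = (\<Sum>w\<in>keys p. lookup p w * lookup q w)"

definition tensor :: "('l list \<Rightarrow>\<^sub>0 'k::field) \<Rightarrow> ('l list \<Rightarrow>\<^sub>0 'k) \<Rightarrow> ('l list \<times> 'l list \<Rightarrow>\<^sub>0 'k)" where
  "tensor p q = lin_ext (\<lambda>u. lin_ext (\<lambda>v. single (u, v) 1) q) p"

definition coproduct :: "('l list \<Rightarrow>\<^sub>0 'k::field) \<Rightarrow> ('l list \<times> 'l list \<Rightarrow>\<^sub>0 'k)" where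
  "coproduct = lin_ext (\<lambda>w. \<Prod>a\<leftarrow>w.
     tensor 1 (single [a] 1) + tensor (single [a] 1) 1)"

definition primitive :: "('l list \<Rightarrow>\<^sub>0 'k::field) \<Rightarrow> bool" where
  "primitive p \<longleftrightarrow> coproduct p = tensor 1 p + tensor p 1"


section \<open>The space \<open>ls\<close>\<close>

datatype letter = x | z

hide_const (open) x z

type_synonym 'k xz_algebra = "letter list \<Rightarrow>\<^sub>0 'k"

definition depth :: "letter list \<Rightarrow> nat" where
  "depth w = count_list w letter.z"

text \<open>The word \<open>x\<^bsup>n\<^sub>1\<^esup> z \<cdots> x\<^bsup>n\<^sub>m\<^esup> z x\<^bsup>k\<^esup>\<close>, and the exponents \<open>([n\<^sub>1, \<dots>, n\<^sub>m], k)\<close> of a given word.\<close>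

definition block_word :: "nat list \<Rightarrow> nat \<Rightarrow> letter list" where
  "block_word ns k = concat (map (\<lambda>n. replicate n letter.x @ [letter.z]) ns) @ replicate k letter.x"

fun exponents :: "letter list \<Rightarrow> nat list \<times> nat" where
  "exponents [] = ([], 0)"
| "exponents (letter.z # w) = (case exponents w of (ns, k) \<Rightarrow> (0 # ns, k))"
| "exponents (letter.x # w) =
     (case exponents w of ([], k) \<Rightarrow> ([], Suc k) | (n # ns, k) \<Rightarrow> (Suc n # ns, k))"

lemma exponents_block_word: "exponents (block_word ns k) = (ns, k)"
proof (induction ns)
  case Nil
  then show ?case by (induction k) (auto simp: block_word_def)
next
  case (Cons n ns)
  then show ?case by (induction n) (auto simp: block_word_def)
qed

lemma block_word_exponents: "block_word (fst (exponents w)) (snd (exponents w)) = w"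
  by (induction w rule: exponents.induct) (auto simp: block_word_def split: prod.splits list.splits)

text \<open>
  The letter \<open>y\<^sub>n\<close> of \<open>Y\<close> is represented by the number \<open>n\<close>; the number \<open>0\<close>, which is not a letter of
  \<open>Y\<close>, does not occur in the values of \<open>\<pi>\<close>.
\<close>

definition proj_Y :: "'k::field xz_algebra \<Rightarrow> (nat list \<Rightarrow>\<^sub>0 'k)" where
  "proj_Y = lin_ext (\<lambda>w. case exponents w of (ns, k) \<Rightarrow>
     if k = 0 then single (map Suc ns) 1 else 0)"

definition ls :: "'k::field xz_algebra set" where
  "ls = {\<psi>. primitive \<psi> \<and> primitive (proj_Y \<psi>) \<and>
     (\<forall>w\<in>keys \<psi>. depth w \<noteq> 0) \<and> (\<forall>w\<in>keys \<psi>. depth w = 1 \<longrightarrow> odd (length w))}"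

definition ls_depth :: "nat \<Rightarrow> ('k::field, 'k xz_algebra) gspace" where
  "ls_depth m = subspace_graded length (component depth m ls)"


section \<open>The double shuffle space\<close>

type_synonym 'k mpoly = "(nat \<Rightarrow>\<^sub>0 nat) \<Rightarrow>\<^sub>0 'k"

definition var :: "nat \<Rightarrow> 'k::field mpoly" where
  "var i = single (single i 1) 1"

definition poly_subst :: "(nat \<Rightarrow> 'k::field mpoly) \<Rightarrow> 'k mpoly \<Rightarrow> 'k mpoly" where
  "poly_subst f = lin_ext (\<lambda>t. \<Prod>i\<in>keys t. f i ^ lookup t i)"

definition poly_weight :: "nat \<Rightarrow> (nat \<Rightarrow>\<^sub>0 nat) \<Rightarrow> nat" where
  "poly_weight m t = (\<Sum>i\<in>keys t. lookup t i) + m"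

definition poly_ring :: "nat \<Rightarrow> ('k::field, 'k mpoly) gspace" where
  "poly_ring m = subspace_graded (poly_weight m) {p. \<forall>t\<in>keys p. keys t \<subseteq> {1..m}}"

definition S_map :: "nat \<Rightarrow> 'k::field mpoly \<Rightarrow> 'k mpoly" where
  "S_map m = poly_subst (\<lambda>i. \<Sum>j=i..m. var j)"

definition T_perm :: "(nat \<Rightarrow> nat) \<Rightarrow> 'k::field mpoly \<Rightarrow> 'k mpoly" where
  "T_perm \<sigma> = poly_subst (\<lambda>i. var (inv \<sigma> i))"

definition T_star :: "nat \<Rightarrow> nat \<Rightarrow> 'k::field mpoly \<Rightarrow> 'k mpoly" where
  "T_star m l p = (\<Sum>\<sigma>\<in>shuffle_perms l (m - l). T_perm \<sigma> p)"

definition T_sh :: "nat \<Rightarrow> nat \<Rightarrow> 'k::field mpoly \<Rightarrow> 'k mpoly" where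
  "T_sh m l = T_star m l \<circ> S_map m"

definition Dsh :: "nat \<Rightarrow> ('k::field, 'k mpoly) gspace" where
  "Dsh m = subspace_graded (poly_weight m)
     {p \<in> gcarrier (poly_ring m). \<forall>l\<in>{1..m-1}. T_star m l p = 0 \<and> T_sh m l p = 0}"

definition Dsh_ann :: "nat \<Rightarrow> ('k::field mpoly \<Rightarrow> 'k) set" where
  "Dsh_ann m = {\<phi> \<in> gcarrier (graded_dual (poly_ring m)). \<forall>p\<in>gcarrier (Dsh m). \<phi> p = 0}"


section \<open>The spaces \<open>W\<close>, \<open>W\<^sub>R\<close>, \<open>U\<close>, \<open>V\<close>, \<open>F\<close>\<close>

datatype symb = SymI "nat list" | SymI' "nat list"

definition symbols_W :: "symb set" where
  "symbols_W = {SymI ns |ns. ns \<noteq> [] \<and> (\<forall>n\<in>set ns. n \<ge> 1)}"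

definition symbols_U :: "symb set" where
  "symbols_U = {SymI' ns |ns. ns \<noteq> [] \<and> (\<forall>n\<in>set ns. n \<ge> 1)} \<union> {SymI' [0]}"

fun symb_depth :: "symb \<Rightarrow> nat" where
  "symb_depth (SymI ns) = length ns"
| "symb_depth (SymI' ns) = length ns - 1"

fun symb_weight :: "symb \<Rightarrow> nat" where
  "symb_weight (SymI ns) = sum_list ns"
| "symb_weight (SymI' ns) = sum_list ns"

definition W_space :: "(symb \<Rightarrow>\<^sub>0 'k::field) set" where
  "W_space = {v. keys v \<subseteq> symbols_W}"

definition U_space :: "(symb \<Rightarrow>\<^sub>0 'k::field) set" where
  "U_space = {v. keys v \<subseteq> symbols_U}"

definition V_space :: "(symb \<Rightarrow>\<^sub>0 'k::field) set" where
  "V_space = {w + u |w u. w \<in> W_space \<and> u \<in> U_space}"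

text \<open>
  \<open>colon_series m t a\<close> is the coefficient of the monomial \<open>a\<close> in \<open>{t 1 : \<cdots> : t m : t (m+1)}\<close>, where
  the \<open>t i\<close> are homogeneous linear polynomials in the variables \<open>t\<^sub>1, t\<^sub>2, \<dots>\<close>.  Only the finitely
  many \<open>ns\<close> with \<open>n\<^sub>1 + \<cdots> + n\<^sub>m - m\<close> equal to the degree of \<open>a\<close> contribute to this coefficient, so
  \<^const>\<open>Sum_any\<close> has finite support.
\<close>

definition colon_series ::
    "nat \<Rightarrow> (nat \<Rightarrow> 'k::field mpoly) \<Rightarrow> (nat \<Rightarrow>\<^sub>0 nat) \<Rightarrow> (symb \<Rightarrow>\<^sub>0 'k)" where
  "colon_series m t a = (\<Sum>ns.
     single (SymI ns)
       (lookup (\<Prod>i=1..m. (t i - t (m + 1)) ^ (ns ! (i - 1) - 1)) a)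
     when length ns = m \<and> (\<forall>n\<in>set ns. n \<ge> 1))"

definition comma_series ::
    "nat \<Rightarrow> (nat \<Rightarrow> 'k::field mpoly) \<Rightarrow> (nat \<Rightarrow>\<^sub>0 nat) \<Rightarrow> (symb \<Rightarrow>\<^sub>0 'k)" where
  "comma_series m t = colon_series m (\<lambda>i. if i \<le> m then \<Sum>j=1..i. t j else 0)"

definition W_star :: "(symb \<Rightarrow>\<^sub>0 'k::field) set" where
  "W_star = module.span pscale
     {\<Sum>\<sigma>\<in>shuffle_perms p q. colon_series (p + q) (\<lambda>i. var (inv \<sigma> i)) a |p q a. p \<ge> 1 \<and> q \<ge> 1}"

definition W_sh :: "(symb \<Rightarrow>\<^sub>0 'k::field) set" where
  "W_sh = module.span pscale
     {\<Sum>\<sigma>\<in>shuffle_perms p q. comma_series (p + q) (\<lambda>i. var (inv \<sigma> i)) a |p q a. p \<ge> 1 \<and> q \<ge> 1}"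

definition W_1_even :: "(symb \<Rightarrow>\<^sub>0 'k::field) set" where
  "W_1_even = module.span pscale {single (SymI [2 * n]) 1 |n. n \<ge> 1}"

definition W_R :: "(symb \<Rightarrow>\<^sub>0 'k::field) set" where
  "W_R = {a + b + c |a b c. a \<in> W_star \<and> b \<in> W_sh \<and> c \<in> W_1_even}"

definition F_space :: "(symb \<Rightarrow>\<^sub>0 'k::field) set" where
  "F_space = {w + u |w u. w \<in> W_R \<and> u \<in> U_space}"

definition W_depth :: "nat \<Rightarrow> ('k::field, symb \<Rightarrow>\<^sub>0 'k) gspace" where
  "W_depth m = subspace_graded symb_weight (component symb_depth m W_space)"

definition V_depth :: "nat \<Rightarrow> ('k::field, symb \<Rightarrow>\<^sub>0 'k) gspace" where
  "V_depth m = subspace_graded symb_weight (component symb_depth m V_space)"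

definition W_mod_WR :: "nat \<Rightarrow> ('k::field, (symb \<Rightarrow>\<^sub>0 'k) set) gspace" where
  "W_mod_WR m = quotient_graded (W_depth m) (component symb_depth m W_R)"

definition V_mod_F :: "nat \<Rightarrow> ('k::field, (symb \<Rightarrow>\<^sub>0 'k) set) gspace" where
  "V_mod_F m = quotient_graded (V_depth m) (component symb_depth m F_space)"

definition poly_dual_mod_Dsh_ann :: "nat \<Rightarrow> ('k::field, ('k mpoly \<Rightarrow> 'k) set) gspace" where
  "poly_dual_mod_Dsh_ann m = quotient_graded (graded_dual (poly_ring m)) (Dsh_ann m)"


section \<open>The maps\<close>

text \<open>For \<open>I'(n\<^sub>0, \<dots>, n\<^sub>m)\<close> the list is \<open>n\<^sub>0 # [n\<^sub>1, \<dots>, n\<^sub>m]\<close>; the case \<open>m = 0\<close> is \<open>x\<^bsup>n\<^sub>0 - 1\<^esup> sh x\<close>.\<close>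

fun phi_symb :: "symb \<Rightarrow> 'k::field xz_algebra" where
  "phi_symb (SymI ns) = single (block_word (map (\<lambda>n. n - 1) (rev ns)) 0) 1"
| "phi_symb (SymI' ns) =
     (if ns = [0] then 1
      else shuffle
        (single (block_word (map (\<lambda>n. n - 1) (rev (tl ns))) (hd ns - 1)) 1)
        (single [letter.x] 1))"

definition phi :: "(symb \<Rightarrow>\<^sub>0 'k::field) \<Rightarrow> 'k xz_algebra" where
  "phi = lin_ext phi_symb"

definition i_bar :: "nat \<Rightarrow> (symb \<Rightarrow>\<^sub>0 'k::field) set \<Rightarrow> (symb \<Rightarrow>\<^sub>0 'k) set" where
  "i_bar m = induced_map (V_depth m) (component symb_depth m F_space) (\<lambda>v. v)"

definition eps :: "nat \<Rightarrow> (symb \<Rightarrow>\<^sub>0 'k::field) set \<Rightarrow> ('k xz_algebra \<Rightarrow> 'k)" where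
  "eps m = descend (\<lambda>v. restr0 (gcarrier (ls_depth m)) (pairing (phi v)))"

text \<open>
  In \<open>h_map\<close> the exponent of \<open>x\<^sub>i\<close> is \<open>n\<^bsub>m+1-i\<^esub> - 1\<close>; the sum is finite since \<open>\<phi>\<close> vanishes on all but
  finitely many weights.
\<close>

definition h_map :: "nat \<Rightarrow> ('k::field mpoly \<Rightarrow> 'k) \<Rightarrow> (symb \<Rightarrow>\<^sub>0 'k)" where
  "h_map m \<phi> = (\<Sum>ns.
     single (SymI ns) (\<phi> (\<Prod>i=1..m. var i ^ (ns ! (m - i) - 1)))
     when length ns = m \<and> (\<forall>n\<in>set ns. n \<ge> 1))"

definition h_bar :: "nat \<Rightarrow> ('k::field mpoly \<Rightarrow> 'k) set \<Rightarrow> (symb \<Rightarrow>\<^sub>0 'k) set" where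
  "h_bar m = induced_map (W_depth m) (component symb_depth m W_R) (h_map m)"

definition g_map :: "nat \<Rightarrow> ('k::field mpoly \<Rightarrow> 'k) set \<Rightarrow> ('k mpoly \<Rightarrow> 'k)" where
  "g_map m = descend (restr0 (gcarrier (Dsh m)))"

definition f_map :: "nat \<Rightarrow> 'k::field xz_algebra \<Rightarrow> 'k mpoly" where
  "f_map m = lin_ext (\<lambda>w. case exponents w of (ns, k) \<Rightarrow>
     if k = 0 then \<Prod>i=1..m. var i ^ (ns ! (i - 1)) else 0)"

end

(*
  A word x^{n_1} z ... x^{n_m} z x^{n_{m+1}} is encoded by the monomial t_1^{n_1} ...
  t_{m+1}^{n_{m+1}}, and an element psi of depth m by the polynomial G(t_1, ..., t_{m+1}) of
  its coefficients. Applying two such generating series to the coproduct of psi gives the sum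
  of G over the lattice paths with entries t_i + s_j. A series of depth 0 has only one path,
  so primitivity makes G invariant under translation: G(t_1, ..., t_{m+1}) = p(t_1 - t_{m+1},
  ..., t_m - t_{m+1}) with p = f_m(psi), and for t_{m+1} = s_{m'+1} = 0 the remaining
  equations are those of T_sh, as the entries along a path are the tail sums of a shuffle.
  Primitivity of pi(psi) is in the same way the system T_*. Hence f_m is bijective from ls_m
  onto Dsh_m.

  The coefficients of the series defining W_star and W_sh, paired with p, are the coefficients
  of the same two systems after reversing the order of the variables. So Dsh_m is the
  annihilator of (W_R)_m, and since all weight components are finite-dimensional, (W_R)_m is
  conversely the annihilator of Dsh_m. The diagram commutes because <phi(h_m(a)), psi> =
  a(f_m(psi)), and the remaining isomorphisms follow.
*)

theory Submission
  imports
    Defs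
    "HOL-Library.Function_Algebras"
    "HOL-Computational_Algebra.Polynomial"
begin

section \<open>Linear forms given by their values on basis elements\<close>

text \<open>Characteristic zero enters through the infinitude of the field: a polynomial, and
  likewise a combination of words, vanishes once all its values do. So identities between formal
  series are tested at lists of scalars. The test forms (\<open>letterwise\<close> on words over
  numbers, \<open>block_value\<close> on words in x and z) are chosen so that the coproduct turns a
  product of two of them into a finite sum of forms of the same kind. As they separate each tensor
  factor, they separate the tensor square, which makes the value equations equivalent to
  primitivity. Three order conventions meet: \<open>f_map\<close> reads exponents from left to
  right, \<open>phi\<close> and \<open>h_map\<close> both reverse them, and S(p,q) acts through
  inverses. \<open>sym_of\<close> and \<open>sym_pairing\<close> absorb the reversals once, and all
  systems are brought to the single form \<open>star_zero\<close>, which is stable under reversal.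
  Depth m >= 2 keeps the conditions of \<open>ls\<close> in depths zero and one, and dually the
  symbols I(2n), out of the picture. In positive depth U disappears because it is mapped to shuffle
  products, to which primitive elements are orthogonal.\<close>

definition lin_form :: "('a \<Rightarrow> 'k) \<Rightarrow> ('a \<Rightarrow>\<^sub>0 'k::field) \<Rightarrow> 'k" where
  "lin_form g v = (\<Sum>a\<in>keys v. lookup v a * g a)"

lemma lin_form_superset:
  assumes "finite A" "keys v \<subseteq> A"
  shows "lin_form g v = (\<Sum>a\<in>A. lookup v a * g a)"
  unfolding lin_form_def
  by (rule sum.mono_neutral_left) (use assms in \<open>auto simp: in_keys_iff\<close>)

lemma lin_form_cong: "(\<And>a. a \<in> keys v \<Longrightarrow> g a = h a) \<Longrightarrow> lin_form g v = lin_form h v"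
  unfolding lin_form_def by (rule sum.cong) auto

lemma lin_form_zero [simp]: "lin_form g 0 = 0"
  by (simp add: lin_form_def)

lemma lin_form_single [simp]: "lin_form g (single a c) = c * g a"
  by (simp add: lin_form_def)

lemma lin_form_one [simp]: "lin_form g 1 = g 0"
  by (subst single_one[symmetric]) (simp only: lin_form_single mult_1)

lemma lin_form_add [simp]: "lin_form g (v + w) = lin_form g v + lin_form g w"
proof -
  have "finite (keys v \<union> keys w)" by simp
  then show ?thesis
    using lin_form_superset[of "keys v \<union> keys w" v g] lin_form_superset[of "keys v \<union> keys w" w g]
      lin_form_superset[of "keys v \<union> keys w" "v + w" g] keys_add[of v w]
    by (simp add: lookup_add distrib_right sum.distrib)
qed

lemma keys_pscale: "keys (pscale c v) \<subseteq> keys v"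
  by (auto simp: in_keys_iff)

lemma lin_form_pscale [simp]: "lin_form g (pscale c v) = c * lin_form g v"
  using lin_form_superset[OF finite_keys keys_pscale[of c v], of g]
  by (simp add: lin_form_def sum_distrib_left mult.assoc)

lemma lin_form_diff [simp]: "lin_form g (v - w) = lin_form g v - lin_form g w"
  using lin_form_add[of g "v - w" w] by (simp del: lin_form_add)

lemma lin_form_sum [simp]: "lin_form g (sum f A) = (\<Sum>i\<in>A. lin_form g (f i))"
  by (induction A rule: infinite_finite_induct) auto

lemma lin_form_sum_list_coeff: "lin_form (\<lambda>a. \<Sum>i\<leftarrow>l. g i a) v = (\<Sum>i\<leftarrow>l. lin_form (g i) v)"
  by (induction l) (auto simp: lin_form_def distrib_left sum.distrib)

lemma lin_form_zero_coeff [simp]: "lin_form (\<lambda>a. 0) v = 0"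
  by (simp add: lin_form_def)

lemma lin_form_mult_coeff: "lin_form (\<lambda>a. c * g a) v = c * lin_form g v"
  unfolding lin_form_def by (simp add: sum_distrib_left mult.left_commute)

lemma lin_form_mult_coeff_right: "lin_form (\<lambda>a. g a * c) v = lin_form g v * c"
  unfolding lin_form_def by (simp add: sum_distrib_right mult.assoc)

lemma lookup_eq_lin_form: "lookup v a = lin_form (\<lambda>b. if b = a then 1 else 0) v"
  by (simp add: lin_form_def if_distrib sum.delta' in_keys_iff cong: if_cong)

lemma lin_form_lin_ext [simp]: "lin_form g (lin_ext f v) = lin_form (\<lambda>a. lin_form g (f a)) v"
  unfolding lin_ext_def by (simp add: lin_form_def[of _ v])

lemma lookup_lin_ext: "lookup (lin_ext f v) b = lin_form (\<lambda>a. lookup (f a) b) v"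
  by (simp add: lookup_eq_lin_form)

lemma lin_ext_add: "lin_ext f (v + w) = lin_ext f v + lin_ext f w"
  by (rule poly_mapping_eqI) (simp add: lookup_lin_ext lookup_add)

lemma lin_ext_pscale: "lin_ext f (pscale c v) = pscale c (lin_ext f v)"
  by (rule poly_mapping_eqI) (simp add: lookup_lin_ext)

lemma lin_ext_single: "lin_ext f (single a c) = pscale c (f a)"
  by (rule poly_mapping_eqI) (simp add: lookup_lin_ext)

lemma keys_lin_ext: "keys (lin_ext f v) \<subseteq> (\<Union>a\<in>keys v. keys (f a))"
proof
  fix b assume "b \<in> keys (lin_ext f v)"
  then have "lin_form (\<lambda>a. lookup (f a) b) v \<noteq> 0"
    by (simp add: in_keys_iff lookup_lin_ext)
  then obtain a where "a \<in> keys v" "lookup (f a) b \<noteq> 0"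
    unfolding lin_form_def by (metis (no_types, lifting) mult_zero_right sum.neutral)
  then show "b \<in> (\<Union>a\<in>keys v. keys (f a))" by (auto simp: in_keys_iff)
qed

lemma sum_single_lookup: "(\<Sum>a\<in>keys v. single a (lookup v a)) = v"
proof (rule poly_mapping_eqI)
  fix b
  have "lookup (\<Sum>a\<in>keys v. single a (lookup v a)) b = (\<Sum>a\<in>keys v. if b = a then lookup v a else 0)"
    by (auto simp: lookup_sum lookup_single when_def intro!: sum.cong)
  then show "lookup (\<Sum>a\<in>keys v. single a (lookup v a)) b = lookup v b"
    by (auto simp: sum.delta' sum.delta in_keys_iff)
qed

text \<open>Expand both factors in basis elements. For the monoid of monomials this yields
  multiplicativity of evaluation, for pairs of words the recursion of the coproduct.\<close>

lemma lin_form_mult: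
  "lin_form g (p * q) = lin_form (\<lambda>a. lin_form (\<lambda>b. g (a + b)) q) p"
proof -
  have "p * q = (\<Sum>a\<in>keys p. \<Sum>b\<in>keys q. single (a + b) (lookup p a * lookup q b))"
    by (subst (1 2) sum_single_lookup[symmetric])
       (simp add: sum_product mult_single)
  then show ?thesis
    by (simp add: lin_form_def[of _ p] lin_form_def[of _ q] sum_distrib_left mult.assoc)
qed

lemma pairing_eq_lin_form: "pairing p q = lin_form (lookup q) p"
  by (simp add: pairing_def lin_form_def)

lemma pairing_eq_lin_form2: "pairing p q = lin_form (lookup p) q"
proof -
  have "pairing p q = (\<Sum>w\<in>keys p \<union> keys q. lookup p w * lookup q w)"
    unfolding pairing_def by (rule sum.mono_neutral_left) (auto simp: in_keys_iff)
  also have "\<dots> = lin_form (lookup p) q"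
    using lin_form_superset[of "keys p \<union> keys q" q "lookup p"] by (simp add: mult.commute)
  finally show ?thesis .
qed

section \<open>Evaluation and substitution of polynomials\<close>

definition eval :: "(nat \<Rightarrow> 'k) \<Rightarrow> 'k::field mpoly \<Rightarrow> 'k" where
  "eval a = lin_form (\<lambda>t. \<Prod>i\<in>keys t. a i ^ lookup t i)"

lemma monomial_value_superset:
  fixes f :: "'i \<Rightarrow> 'a::comm_monoid_mult"
  assumes "finite A" "keys t \<subseteq> A"
  shows "(\<Prod>i\<in>keys t. f i ^ lookup t i) = (\<Prod>i\<in>A. f i ^ lookup t i)"
  by (rule prod.mono_neutral_left) (use assms in \<open>auto simp: in_keys_iff\<close>)

lemma eval_mult: "eval a (p * q) = eval a p * eval a q"
proof -
  have *: "(\<Prod>i\<in>keys (s + t). a i ^ lookup (s + t) i) =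
        (\<Prod>i\<in>keys s. a i ^ lookup s i) * (\<Prod>i\<in>keys t. a i ^ lookup t i)" for s t :: "nat \<Rightarrow>\<^sub>0 nat"
    using monomial_value_superset[of "keys s \<union> keys t" "s + t" a] keys_add[of s t]
      monomial_value_superset[of "keys s \<union> keys t" s a] monomial_value_superset[of "keys s \<union> keys t"
          t a]
    by (simp add: lookup_add power_add prod.distrib)
  show ?thesis
    by (simp add: eval_def lin_form_mult * lin_form_mult_coeff lin_form_mult_coeff_right)
qed

lemma eval_simps [simp]:
  "eval a 0 = 0" "eval a 1 = 1" "eval a (p + q) = eval a p + eval a q"
  "eval a (p - q) = eval a p - eval a q" "eval a (pscale c p) = c * eval a p"
  "eval a (var i) = a i"
  by (simp_all add: eval_def var_def)

lemma eval_sum: "eval a (sum f A) = (\<Sum>i\<in>A. eval a (f i))"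
  by (simp add: eval_def)

lemma eval_prod: "eval a (prod f A) = (\<Prod>i\<in>A. eval a (f i))"
  by (induction A rule: infinite_finite_induct) (auto simp: eval_mult)

lemma eval_power: "eval a (p ^ n) = eval a p ^ n"
  by (induction n) (auto simp: eval_mult)

lemma eval_poly_subst: "eval a (poly_subst f p) = eval (\<lambda>i. eval a (f i)) p"
proof -
  have "eval a (poly_subst f p) = lin_form (\<lambda>t. eval a (\<Prod>i\<in>keys t. f i ^ lookup t i)) p"
    unfolding poly_subst_def eval_def by (rule lin_form_lin_ext)
  then show ?thesis
    by (simp only: eval_prod eval_power) (simp only: eval_def)
qed

lemma eval_cong:
  assumes "\<And>t i. t \<in> keys p \<Longrightarrow> i \<in> keys t \<Longrightarrow> a i = b i"
  shows "eval a p = eval b p"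
  unfolding eval_def by (rule lin_form_cong) (use assms in \<open>auto intro!: prod.cong\<close>)

text \<open>A multiplicative form on words, zero on words of another length. For
  \<open>e = (^)\<close> it is the monomial with exponent list \<open>w\<close> evaluated at
  \<open>t\<close>; for the indicator of equality it is the coefficient of the word
  \<open>t\<close>.\<close>

fun letterwise :: "('a \<Rightarrow> 'l \<Rightarrow> 'k) \<Rightarrow> 'a list \<Rightarrow> 'l list \<Rightarrow> 'k::field" where
  "letterwise e [] [] = 1"
| "letterwise e (t # ts) (a # w) = e t a * letterwise e ts w"
| "letterwise e _ _ = 0"

lemma letterwise_length: "length t \<noteq> length w \<Longrightarrow> letterwise e t w = 0"
  by (induction e t w rule: letterwise.induct) auto

lemma letterwise_eq_prod:
  "length t = length w \<Longrightarrow> letterwise e t w = (\<Prod>i<length w. e (t ! i) (w ! i))"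
  by (induction e t w rule: letterwise.induct) (auto simp: prod.lessThan_Suc_shift simp del:
      prod.lessThan_Suc)

text \<open>Induction on the exponent list: with all values but the first fixed, the sum is a
  polynomial in the first value. It vanishes at every point of an infinite field, so its coefficient
  at the first exponent vanishes, and that coefficient is a sum of the same kind over shorter
  lists.\<close>

lemma monomials_separated_aux:
  fixes c :: "nat list \<Rightarrow> 'k::field_char_0"
  assumes "finite S" "w \<in> S"
    and "\<And>t. length t = length w \<Longrightarrow> (\<Sum>v\<in>S. c v * letterwise (^) t v) = 0"
  shows "c w = 0"
  using assms
proof (induction w arbitrary: S c)
  case Nil
  have "(\<Sum>v\<in>S. c v * letterwise (^) ([] :: 'k list) v) = (\<Sum>v\<in>S. if v = [] then c v else 0)"
    by (rule sum.cong) (auto simp: neq_Nil_conv)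
  also have "\<dots> = c []" using Nil by (simp add: sum.delta)
  finally show ?case using Nil.prems(3)[of "[]"] by simp
next
  case (Cons n w)
  define S' where "S' = {v. n # v \<in> S}"
  have fin: "finite S'"
    unfolding S'_def
        using Cons.prems(1) by (rule finite_vimageI[of S "(#) n", unfolded vimage_def]) simp
  have "(\<Sum>v\<in>S'. c (n # v) * letterwise (^) t v) = 0" if "length t = length w" for t :: "'k list"
  proof -
    \<comment> \<open>The empty list contributes zero at the nonempty point \<open>a # t\<close>;
      dropping it keeps \<open>hd\<close> and \<open>tl\<close> meaningful.\<close>
    define P where "P = (\<Sum>v\<in>S - {[]}. monom (c v * letterwise (^) t (tl v)) (hd v))"
    have "poly P a = 0" for a
    proof -
      have "poly P a = (\<Sum>v\<in>S - {[]}. c v * letterwise (^) (a # t) v)"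
        unfolding P_def poly_sum
        by (rule sum.cong) (auto simp: poly_monom neq_Nil_conv)
      also have "\<dots> = (\<Sum>v\<in>S. c v * letterwise (^) (a # t) v)"
        by (rule sum.mono_neutral_left) (use Cons.prems(1) in auto)
      finally show ?thesis using Cons.prems(3)[of "a # t"] that by simp
    qed
    then have "coeff P n = 0" using poly_all_0_iff_0[of P] by simp
    moreover have "coeff P n = (\<Sum>v\<in>S - {[]}. if hd v = n then c v * letterwise (^) t (tl v) else 0)"
      unfolding P_def coeff_sum by (rule sum.cong) auto
    moreover have "\<dots> = (\<Sum>v\<in>(#) n ` S'. c v * letterwise (^) t (tl v))"
    proof -
      have "(#) n ` S' = {v \<in> S - {[]}. hd v = n}"
        unfolding S'_def by (auto simp: image_iff) (metis list.collapse)
      then show ?thesis by (simp only:) (simp only: sum.inter_filter finite_Diff Cons.prems(1))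
    qed
    moreover have "\<dots> = (\<Sum>v\<in>S'. c (n # v) * letterwise (^) t v)"
      by (subst sum.reindex) auto
    ultimately show ?thesis by simp
  qed
  from Cons.IH[OF fin _ this] Cons.prems show ?case by (simp add: S'_def)
qed

text \<open>Any basis can be tested once it is encoded injectively by exponent lists. The set
  \<open>T\<close> of test points has to contain only the lists whose length occurs among the
  codes.\<close>

lemma monomials_separated:
  fixes v :: "'a \<Rightarrow>\<^sub>0 'k::field_char_0"
  assumes inj: "inj_on f (keys v)"
    and zero: "\<And>t. t \<in> T \<Longrightarrow> lin_form (\<lambda>a. letterwise (^) t (f a)) v = 0"
    and T: "\<And>a t. a \<in> keys v \<Longrightarrow> length t = length (f a) \<Longrightarrow> t \<in> T"
  shows "v = 0"
proof (rule ccontr)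
  assume "v \<noteq> 0"
  then obtain a where a: "a \<in> keys v" by (metis keys_eq_empty ex_in_conv)
  let ?c = "\<lambda>w. lookup v (inv_into (keys v) f w)"
  have "?c (f a) = 0"
  proof (rule monomials_separated_aux[of "f ` keys v"])
    fix t :: "'k list" assume "length t = length (f a)"
    then have "lin_form (\<lambda>a. letterwise (^) t (f a)) v = 0" using T zero a by blast
    then show "(\<Sum>w\<in>f ` keys v. ?c w * letterwise (^) t w) = 0"
      by (subst sum.reindex[OF inj]) (simp add: lin_form_def inv_into_f_f[OF inj])
  qed (use a in auto)
  with a inj show False by (simp add: in_keys_iff)
qed

text \<open>Finitely many variables occur, so the monomials are encoded by their exponent lists up
  to a common bound.\<close>

lemma eval_eq_zero_imp:
  fixes p :: "'k::field_char_0 mpoly"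
  assumes zero: "\<And>a. eval a p = 0"
  shows "p = 0"
proof -
  obtain n where n: "\<And>t i. t \<in> keys p \<Longrightarrow> i \<in> keys t \<Longrightarrow> i < n"
  proof -
    have "finite (\<Union>t\<in>keys p. keys t)" by simp
    then obtain n where "\<forall>i\<in>(\<Union>t\<in>keys p. keys t). i < n"
      by (metis finite_nat_set_iff_bounded)
    then show ?thesis using that by blast
  qed
  let ?f = "\<lambda>t. map (lookup t) [0..<n]"
  show ?thesis
  proof (rule monomials_separated[where f = ?f and T = "{t. length t = n}"])
    show "inj_on ?f (keys p)"
    proof (rule inj_onI, rule poly_mapping_eqI)
      fix s t i assume st: "s \<in> keys p" "t \<in> keys p" "?f s = ?f t"
      show "lookup s i = lookup t i"
      proof (cases "i < n")
        case True
        then show ?thesis using st(3) by (simp add: map_eq_conv)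
      next
        case False
        then show ?thesis using n st by (metis in_keys_iff)
      qed
    qed
    fix t :: "'k list" assume "t \<in> {t. length t = n}"
    then have t: "length t = n" by simp
    have "lin_form (\<lambda>s. letterwise (^) t (?f s)) p = eval ((!) t) p"
      unfolding eval_def
    proof (rule lin_form_cong)
      fix s assume "s \<in> keys p"
      then show "letterwise (^) t (?f s) = (\<Prod>i\<in>keys s. t ! i ^ lookup s i)"
        using monomial_value_superset[of "{..<n}" s "(!) t"] n t
        by (force simp: letterwise_eq_prod)
    qed
    then show "lin_form (\<lambda>s. letterwise (^) t (?f s)) p = 0" using zero by simp
  qed auto
qed

text \<open>Contract one factor at a time: applying \<open>\<theta> s\<close> in the second factor
  leaves an element of the first space killed by every \<open>\<chi> t\<close>, hence zero. So each
  slice of \<open>D\<close> over a fixed \<open>a\<close> is killed by every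
  \<open>\<theta> s\<close>.\<close>

lemma tensor_separated:
  fixes D :: "'a \<times> 'b \<Rightarrow>\<^sub>0 'k::field"
  assumes sep1: "\<And>v. (\<And>t. t \<in> T \<Longrightarrow> lin_form (\<chi> t) v = 0) \<Longrightarrow> v = 0"
    and sep2: "\<And>v. (\<And>s. s \<in> S \<Longrightarrow> lin_form (\<theta> s) v = 0) \<Longrightarrow> v = 0"
    and zero: "\<And>t s. t \<in> T \<Longrightarrow> s \<in> S \<Longrightarrow> lin_form (\<lambda>(a, b). \<chi> t a * \<theta> s b) D = 0"
  shows "D = 0"
proof (rule poly_mapping_eqI)
  fix ab :: "'a \<times> 'b"
  obtain a b where ab: "ab = (a, b)" by (cases ab)
  have 1: "lin_ext (\<lambda>(a, b). single a (\<theta> s b)) D = 0" if "s \<in> S" for s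
    using zero[OF _ that]
    by (intro sep1) (simp add: case_prod_unfold mult.commute)
  have 2: "lin_ext (\<lambda>(a', b). if a' = a then single b 1 else 0) D = 0"
  proof (rule sep2)
    fix s assume "s \<in> S"
    then have "lookup (lin_ext (\<lambda>(a, b). single a (\<theta> s b)) D) a = 0" using 1 by simp
    moreover have "lookup (lin_ext (\<lambda>(a, b). single a (\<theta> s b)) D) a =
       lin_form (\<theta> s) (lin_ext (\<lambda>(a', b). if a' = a then single b 1 else 0) D)"
      unfolding lookup_lin_ext lin_form_lin_ext
      by (rule lin_form_cong) (auto simp: lookup_single)
    ultimately show "lin_form (\<theta> s) (lin_ext (\<lambda>(a', b). if a' = a then single b 1 else 0) D) = 0"
      by simp
  qed
  have "lookup D ab = lookup (lin_ext (\<lambda>(a', b). if a' = a then single b 1 else 0) D) b"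
    unfolding lookup_lin_ext lookup_eq_lin_form[of D]
    by (rule lin_form_cong) (auto simp: ab lookup_single split: if_splits)
  then show "lookup D ab = lookup 0 ab" using 2 by simp
qed

text \<open>Keeps intervals such as \<open>[1..<m+1]\<close> folded, so that index lists on the two
  sides of an equation stay comparable.\<close>

declare upt_Suc [simp del]

section \<open>Shuffles with multiplicity\<close>

lemma sum_list_map_cong: "(\<And>c. c \<in> set l \<Longrightarrow> f c = g c) \<Longrightarrow> (\<Sum>c\<leftarrow>l. f c) = (\<Sum>c\<leftarrow>l. g c)"
  by (simp cong: map_cong)

text \<open>The library's \<open>shuffles\<close> is a set and forgets multiplicities, which matter
  as soon as letters coincide; the list has one entry for each interleaving.\<close>

fun shuffle_list :: "'a list \<Rightarrow> 'a list \<Rightarrow> 'a list list" where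
  "shuffle_list [] ys = [ys]"
| "shuffle_list xs [] = [xs]"
| "shuffle_list (x # xs) (y # ys) =
     map ((#) x) (shuffle_list xs (y # ys)) @ map ((#) y) (shuffle_list (x # xs) ys)"

lemma shuffle_list_Nil2 [simp]: "shuffle_list xs [] = [xs]"
  by (cases xs) auto

lemma set_shuffle_list: "set (shuffle_list xs ys) = shuffles xs ys"
  by (induction xs ys rule: shuffle_list.induct) auto

lemma shuffle_list_map: "shuffle_list (map f xs) (map f ys) = map (map f) (shuffle_list xs ys)"
  by (induction xs ys rule: shuffle_list.induct) auto

lemma distinct_shuffle_list: "set xs \<inter> set ys = {} \<Longrightarrow> distinct (shuffle_list xs ys)"
  by (induction xs ys rule: shuffle_list.induct) (auto simp: distinct_map)

lemma length_shuffle_list: "c \<in> set (shuffle_list xs ys) \<Longrightarrow> length c = length xs + length ys"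
  by (simp add: set_shuffle_list length_shuffles)

lemma sum_list_shuffle_list:
  fixes xs ys :: "'a::comm_monoid_add list"
  shows "c \<in> set (shuffle_list xs ys) \<Longrightarrow> sum_list c = sum_list xs + sum_list ys"
  by (induction xs ys arbitrary: c rule: shuffle_list.induct) (auto simp: ac_simps)

lemma prod_list_shuffle_list:
  fixes xs ys :: "'a::comm_monoid_mult list"
  shows "c \<in> set (shuffle_list xs ys) \<Longrightarrow> prod_list c = prod_list xs * prod_list ys"
  by (induction xs ys arbitrary: c rule: shuffle_list.induct) (auto simp: ac_simps)

text \<open>The mirror image of the defining recursion, splitting by the last letter; it drives the
  induction for reversed words.\<close>

lemma sum_shuffle_list_snoc:
  fixes F :: "'a list \<Rightarrow> 'b::comm_monoid_add"
  shows "(\<Sum>c\<leftarrow>shuffle_list (u @ [a]) (v @ [b]). F c) =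
    (\<Sum>c\<leftarrow>shuffle_list u (v @ [b]). F (c @ [a])) + (\<Sum>c\<leftarrow>shuffle_list (u @ [a]) v. F (c @ [b]))"
proof (induction u v arbitrary: F rule: shuffle_list.induct)
  case (1 v)
  show ?case
    by (induction v arbitrary: F) (auto simp: o_def ac_simps)
next
  case (2 x u)
  have "(\<Sum>c\<leftarrow>shuffle_list (u @ [a]) [b]. F c) =
      (\<Sum>c\<leftarrow>shuffle_list u [b]. F (c @ [a])) + (\<Sum>c\<leftarrow>[u @ [a]]. F (c @ [b]))"
    for u and F :: "'a list \<Rightarrow> 'b"
    by (induction u arbitrary: F) (auto simp: o_def ac_simps)
  from this[of F "x # u"] show ?case by simp
next
  case (3 x u y v)
  show ?case
    using "3.IH"(1)[of "\<lambda>c. F (x # c)"] "3.IH"(2)[of "\<lambda>c. F (y # c)"]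
    by (simp add: o_def ac_simps)
qed

text \<open>Needed because the relations of \<open>W_R\<close> list the variables in the order
  opposite to that of \<open>f_map\<close>.\<close>

lemma sum_shuffle_list_rev:
  fixes F :: "'a list \<Rightarrow> 'b::comm_monoid_add"
  shows "(\<Sum>c\<leftarrow>shuffle_list (rev u) (rev v). F c) = (\<Sum>c\<leftarrow>shuffle_list u v. F (rev c))"
  by (induction u v arbitrary: F rule: shuffle_list.induct)
    (auto simp: sum_shuffle_list_snoc o_def)

text \<open>The word of \<open>inv \<sigma>\<close> lists the arguments of \<sigma> by increasing
  value. So monotonicity of \<sigma> on a block says that the numbers of this block occur in
  increasing order.\<close>

lemma shuffle_perms_sorted:
  assumes "\<sigma> \<in> shuffle_perms p q"
  shows "filter (\<lambda>i. i \<le> p) (map (inv \<sigma>) [1..<p+q+1]) = [1..<p+1]"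
    "filter (\<lambda>i. \<not> i \<le> p) (map (inv \<sigma>) [1..<p+q+1]) = [p+1..<p+q+1]"
proof -
  let ?w = "map (inv \<sigma>) [1..<p+q+1]"
  have perm: "\<sigma> permutes {1..p+q}" and mono: "strict_mono_on {1..p} \<sigma>" "strict_mono_on {p+1..p+q} \<sigma>"
    using assms by (auto simp: shuffle_perms_def)
  have inv: "inv \<sigma> permutes {1..p+q}" using perm by (rule permutes_inv)
  have set_w: "set ?w = {1..p+q}"
    using permutes_image[OF inv] by (simp add: atLeastLessThanSuc_atLeastAtMost)
  have dist: "distinct ?w" using permutes_inj_on[OF inv] by (simp add: distinct_map)
  have sorted: "sorted (filter P ?w)" if "strict_mono_on {i. i \<in> {1..p+q} \<and> P i} \<sigma>" for P
  proof -
    have "sorted_wrt (\<lambda>a b. P (inv \<sigma> a) \<longrightarrow> P (inv \<sigma> b) \<longrightarrow> inv \<sigma> a \<le> inv \<sigma> b) [1..<p+q+1]"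
    proof (rule sorted_wrt_mono_rel[OF _ sorted_wrt_upt])
      fix a b assume ab: "a \<in> set [1..<p+q+1]" "b \<in> set [1..<p+q+1]" "a < b"
      show "P (inv \<sigma> a) \<longrightarrow> P (inv \<sigma> b) \<longrightarrow> inv \<sigma> a \<le> inv \<sigma> b"
      proof (intro impI, rule ccontr)
        assume P: "P (inv \<sigma> a)" "P (inv \<sigma> b)" and "\<not> inv \<sigma> a \<le> inv \<sigma> b"
        moreover have "inv \<sigma> a \<in> {1..p+q}" "inv \<sigma> b \<in> {1..p+q}"
          using ab(1,2) permutes_in_image[OF inv] by auto
        ultimately have "\<sigma> (inv \<sigma> b) < \<sigma> (inv \<sigma> a)"
          by (intro strict_mono_onD[OF that]) simp_all
        then show False using ab(3) by (simp add: permutes_inverses[OF perm])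
      qed
    qed
    moreover have "sorted_wrt (\<lambda>a b. P (f a) \<longrightarrow> P (f b) \<longrightarrow> f a \<le> f b) xs \<Longrightarrow>
        sorted (filter P (map f xs))"
      for f :: "nat \<Rightarrow> nat" and xs
      by (induction xs) auto
    ultimately show ?thesis by blast
  qed
  have "sorted (filter (\<lambda>i. i \<le> p) ?w)"
    by (rule sorted) (use mono(1) in \<open>auto simp: monotone_on_def\<close>)
  moreover have "set (filter (\<lambda>i. i \<le> p) ?w) = set [1..<p+1]"
    by (simp only: set_filter set_w) auto
  ultimately show "filter (\<lambda>i. i \<le> p) ?w = [1..<p+1]"
    by (intro sorted_distinct_set_unique) (use dist in auto)
  have "sorted (filter (\<lambda>i. \<not> i \<le> p) ?w)"
    by (rule sorted) (use mono(2) in \<open>auto simp: monotone_on_def\<close>)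
  moreover have "set (filter (\<lambda>i. \<not> i \<le> p) ?w) = set [p+1..<p+q+1]"
    by (simp only: set_filter set_w) auto
  ultimately show "filter (\<lambda>i. \<not> i \<le> p) ?w = [p+1..<p+q+1]"
    by (intro sorted_distinct_set_unique) (use dist in auto)
qed

text \<open>The inverse permutation, written as a word, is an interleaving of the two increasing
  blocks, and every such word arises from exactly one \<sigma>.\<close>

lemma bij_betw_shuffle_perms:
  "bij_betw (\<lambda>\<sigma>. map (inv \<sigma>) [1..<p+q+1]) (shuffle_perms p q) (shuffles [1..<p+1] [p+1..<p+q+1])"
  unfolding bij_betw_def
proof (intro conjI equalityI subsetI)
  show "inj_on (\<lambda>\<sigma>. map (inv \<sigma>) [1..<p+q+1]) (shuffle_perms p q)"
  proof (rule inj_onI)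
    fix \<sigma> \<tau> assume "\<sigma> \<in> shuffle_perms p q" "\<tau> \<in> shuffle_perms p q"
      and eq: "map (inv \<sigma>) [1..<p+q+1] = map (inv \<tau>) [1..<p+q+1]"
    then have perm: "\<sigma> permutes {1..p+q}" "\<tau> permutes {1..p+q}" by (auto simp: shuffle_perms_def)
    have "inv \<sigma> i = inv \<tau> i" for i
    proof (cases "i \<in> {1..p+q}")
      case True
      then show ?thesis using eq by (auto simp: map_eq_conv)
    next
      case False
      then show ?thesis
        using permutes_not_in[OF permutes_inv[OF perm(1)]] permutes_not_in[OF permutes_inv[OF
            perm(2)]]
        by presburger
    qed
    then have "inv \<sigma> = inv \<tau>" by (rule ext)
    then have "inv (inv \<sigma>) = inv (inv \<tau>)" by (rule arg_cong)
    then show "\<sigma> = \<tau>" unfolding permutes_inv_inv[OF perm(1)] permutes_inv_inv[OF perm(2)] .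
  qed
next
  fix w assume "w \<in> (\<lambda>\<sigma>. map (inv \<sigma>) [1..<p+q+1]) ` shuffle_perms p q"
  then obtain \<sigma> where \<sigma>: "\<sigma> \<in> shuffle_perms p q" and w: "w = map (inv \<sigma>) [1..<p+q+1]" by blast
  have "w \<in> shuffles (filter (\<lambda>i. i \<le> p) w) (filter (\<lambda>i. \<not> i \<le> p) w)"
    by (rule partition_in_shuffles)
  then show "w \<in> shuffles [1..<p+1] [p+1..<p+q+1]"
    unfolding w shuffle_perms_sorted[OF \<sigma>] .
next
  fix w assume w: "w \<in> shuffles [1..<p+1] [p+1..<p+q+1]"
  have len: "length w = p + q" using length_shuffles[OF w] by simp
  have set_w: "set w = {1..p+q}" unfolding set_shuffles[OF w] by auto
  have dist: "distinct w"
      by (rule distinct_disjoint_shuffles[OF distinct_upt distinct_upt _ w]) auto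
  have disj: "set [1..<p+1] \<inter> set [p+1..<p+q+1] = {}" by auto
  have sets: "set [1..<p+1] = {1..p}" "set [p+1..<p+q+1] = {p+1..p+q}" by auto
  have f1: "filter (\<lambda>i. i \<in> {1..p}) w = [1..<p+1]"
    using filter_shuffles_disjoint1(1)[OF disj w] unfolding sets .
  have f2: "filter (\<lambda>i. i \<in> {p+1..p+q}) w = [p+1..<p+q+1]"
    using filter_shuffles_disjoint2(1)[OF disj w] unfolding sets .
  \<comment> \<open>The word itself read as a permutation; the wanted element of S(p,q) is its
    inverse.\<close>
  define \<tau> where "\<tau> i = (if i \<in> {1..p+q} then w ! (i - 1) else i)" for i
  have perm: "\<tau> permutes {1..p+q}"
  proof (rule bij_imp_permutes)
    have "inj_on \<tau> {1..p+q}"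
    proof (rule inj_onI)
      fix i j assume "i \<in> {1..p+q}" "j \<in> {1..p+q}" "\<tau> i = \<tau> j"
      then have "i - 1 = j - 1"
        using nth_eq_iff_index_eq[OF dist, of "i - 1" "j - 1"] len by (auto simp: \<tau>_def)
      then show "i = j" using \<open>i \<in> _\<close> \<open>j \<in> _\<close> by auto
    qed
    moreover have "\<tau> ` {1..p+q} \<subseteq> {1..p+q}"
    proof -
      have "w ! (i - 1) \<in> set w" if "i \<in> {1..p+q}" for i using that len by (intro nth_mem) auto
      then show ?thesis by (auto simp: \<tau>_def set_w)
    qed
    ultimately show "bij_betw \<tau> {1..p+q} {1..p+q}"
      by (simp add: bij_betw_def endo_inj_surj)
  qed (simp only: \<tau>_def if_False)
  have mono: "strict_mono_on A (inv \<tau>)"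
    if A: "A \<subseteq> {1..p+q}" and f: "sorted (filter (\<lambda>i. i \<in> A) w)" for A
  proof (rule strict_mono_onI, rule ccontr)
    fix a b assume ab: "a \<in> A" "b \<in> A" "a < b" and "\<not> inv \<tau> a < inv \<tau> b"
    moreover have "inv \<tau> a \<noteq> inv \<tau> b"
        using ab(3) injD[OF permutes_inj[OF permutes_inv[OF perm]]] by blast
    ultimately have less: "inv \<tau> b < inv \<tau> a" by simp
    have in_range: "inv \<tau> a \<in> {1..p+q}" "inv \<tau> b \<in> {1..p+q}"
      using ab A permutes_in_image[OF permutes_inv[OF perm]] by auto
    have val: "w ! (inv \<tau> a - 1) = a" "w ! (inv \<tau> b - 1) = b"
      using permutes_inverses(1)[OF perm, of a] permutes_inverses(1)[OF perm, of b] in_range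
      by (simp_all only: \<tau>_def if_True)
    have "sorted_wrt (\<lambda>a b. a \<in> A \<longrightarrow> b \<in> A \<longrightarrow> a \<le> b) w" 
      using f by (induction w) (auto split: if_splits)
    moreover have "inv \<tau> b - 1 < inv \<tau> a - 1" "inv \<tau> a - 1 < length w"
      using less in_range len by auto
    ultimately have "w ! (inv \<tau> b - 1) \<in> A \<longrightarrow> w ! (inv \<tau> a - 1) \<in> A \<longrightarrow>
        w ! (inv \<tau> b - 1) \<le> w ! (inv \<tau> a - 1)"
      by (rule sorted_wrt_nth_less)
    then have "b \<in> A \<longrightarrow> a \<in> A \<longrightarrow> b \<le> a" unfolding val .
    with ab show False by simp
  qed
  have mem: "inv \<tau> \<in> shuffle_perms p q"
    unfolding shuffle_perms_def
    using permutes_inv[OF perm] mono[of "{1..p}"] mono[of "{p+1..p+q}"] unfolding f1 f2 by simp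
  have "map \<tau> [1..<p+q+1] = w"
    using len by (intro nth_equalityI) (simp_all add: \<tau>_def)
  then have "w = map (inv (inv \<tau>)) [1..<p+q+1]" unfolding permutes_inv_inv[OF perm] by (rule sym)
  then show "w \<in> (\<lambda>\<sigma>. map (inv \<sigma>) [1..<p+q+1]) ` shuffle_perms p q" using mem by (rule image_eqI)
qed

text \<open>The numbers from 1 to p+q are distinct, so their shuffles occur without multiplicity and
  the set may be replaced by the list; repetitions arise only on applying \<open>a\<close>.\<close>

lemma sum_shuffle_perms:
  fixes F :: "'a list \<Rightarrow> 'b::comm_monoid_add"
  shows "(\<Sum>\<sigma>\<in>shuffle_perms p q. F (map (\<lambda>i. a (inv \<sigma> i)) [1..<p+q+1])) =
    (\<Sum>c\<leftarrow>shuffle_list (map a [1..<p+1]) (map a [p+1..<p+q+1]). F c)"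
proof -
  have "(\<Sum>\<sigma>\<in>shuffle_perms p q. F (map (\<lambda>i. a (inv \<sigma> i)) [1..<p+q+1])) =
      (\<Sum>\<sigma>\<in>shuffle_perms p q. F (map a (map (inv \<sigma>) [1..<p+q+1])))"
    by (simp add: o_def)
  also have "\<dots> = (\<Sum>c\<in>shuffles [1..<p+1] [p+1..<p+q+1]. F (map a c))"
    by (rule sum.reindex_bij_betw[OF bij_betw_shuffle_perms])
  also have "\<dots> = (\<Sum>c\<leftarrow>shuffle_list [1..<p+1] [p+1..<p+q+1]. F (map a c))"
    unfolding set_shuffle_list[symmetric]
        by (rule sum.distinct_set_conv_list) (rule distinct_shuffle_list, auto)
  finally show ?thesis by (simp add: shuffle_list_map o_def)
qed

text \<open>For a list \<open>c\<close> of length m the first m entries are the values of S_m(x_1),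
  ..., S_m(x_m) at \<open>c\<close>. The final 0 is the argument of the trailing power of x.\<close>

fun tail_sums :: "'a::monoid_add list \<Rightarrow> 'a list" where
  "tail_sums [] = [0]"
| "tail_sums (a # c) = sum_list (a # c) # tail_sums c"

lemma tail_sums_neq_Nil [simp]: "tail_sums c \<noteq> []"
  by (cases c) auto

lemma length_tail_sums [simp]: "length (tail_sums c) = Suc (length c)"
  by (induction c) auto

lemma last_tail_sums [simp]: "last (tail_sums c) = 0"
  by (induction c) auto

lemma nth_tail_sums: "i \<le> length c \<Longrightarrow> tail_sums c ! i = sum_list (drop i c)"
  by (induction c arbitrary: i) (auto simp: nth_Cons split: nat.splits)

text \<open>Successive differences recover \<open>c\<close>. Thus arguments of a series, once
  translated to end in 0, become arguments of the system \<open>T_sh\<close>.\<close>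

lemma ex_tail_sums:
  fixes t :: "'a::ab_group_add list"
  assumes "t \<noteq> []" "last t = 0"
  shows "\<exists>c. t = tail_sums c"
  using assms
proof (induction t)
  case (Cons a t)
  show ?case
  proof (cases "t = []")
    case True
    then show ?thesis using Cons.prems by (intro exI[of _ "[]"]) simp
  next
    case False
    then obtain c where "t = tail_sums c" using Cons by auto
    then show ?thesis by (intro exI[of _ "(a - sum_list c) # c"]) simp
  qed
qed simp

text \<open>
  The sums \<open>t\<^sub>i + s\<^sub>j\<close> along the lattice paths from \<open>(1, 1)\<close> to \<open>(length ts, length ss)\<close>;
  these are the arguments of the blocks in the shuffle product of two generating series of words.
\<close>

fun path_sums :: "'a::plus list \<Rightarrow> 'a list \<Rightarrow> 'a list list" where
  "path_sums (t # ts) (s # ss) =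
     (if ts = [] \<and> ss = [] then [[t + s]]
      else map ((#) (t + s)) (path_sums ts (s # ss) @ path_sums (t # ts) ss))"
| "path_sums _ _ = []"

lemma path_sums_Nil2 [simp]: "path_sums ts [] = []"
  by (cases ts) auto

lemma path_sums_singleton:
  "path_sums ts [s] = (if ts = [] then [] else [map (\<lambda>t. t + s) ts])"
  "path_sums [t] ss = (if ss = [] then [] else [map (\<lambda>s. t + s) ss])"
proof -
  show "path_sums ts [s] = (if ts = [] then [] else [map (\<lambda>t. t + s) ts])"
    by (induction ts) simp_all
  show "path_sums [t] ss = (if ss = [] then [] else [map (\<lambda>s. t + s) ss])"
    by (induction ss) simp_all
qed

lemma path_sums_last_length:
  "c \<in> set (path_sums ts ss) \<Longrightarrow> last c = last ts + last ss \<and> Suc (length c) = length ts + length ss"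
proof (induction ts ss arbitrary: c rule: path_sums.induct)
  case (1 t ts s ss)
  show ?case
  proof (cases "ts = [] \<and> ss = []")
    case False
    from 1(3) consider c' where "c = (t + s) # c'" "c' \<in> set (path_sums ts (s # ss))"
      | c' where "c = (t + s) # c'" "c' \<in> set (path_sums (t # ts) ss)"
      using False by auto
    then show ?thesis
    proof cases
      case 1
      moreover have "ts \<noteq> []" using 1 by auto
      ultimately show ?thesis using "1.IH"(1)[OF False 1(2)] by (cases c') auto
    next
      case 2
      moreover have "ss \<noteq> []" using 2 by auto
      ultimately show ?thesis using "1.IH"(2)[OF False 2(2)] by (cases c') auto
    qed
  qed (use 1(3) in auto)
qed auto

text \<open>Allows the last entries of both lists to be normalised to 0.\<close>

lemma path_sums_diff:
  fixes a b :: "'a::ab_group_add"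
  shows "path_sums (map (\<lambda>t. t - a) ts) (map (\<lambda>s. s - b) ss) =
      map (map (\<lambda>t. t - (a + b))) (path_sums ts ss)"
  by (induction ts ss rule: path_sums.induct) (auto simp: diff_add_eq diff_diff_eq add_diff_eq
      add.commute[of b a])

text \<open>A lattice path is an order of removing letters from \<open>u\<close> and
  \<open>v\<close>, that is, a shuffle; the sum at a lattice point is the total of the letters not
  yet removed.\<close>

lemma path_sums_tail_sums:
  fixes u v :: "'a::comm_monoid_add list"
  shows "path_sums (tail_sums u) (tail_sums v) = map tail_sums (shuffle_list u v)"
proof (induction u v rule: shuffle_list.induct)
  case (1 v)
  then show ?case by (cases v) (auto simp: path_sums_singleton map_idI)
next
  case (2 x u)
  then show ?case by (auto simp: path_sums_singleton map_idI)
next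
  case (3 x u y v)
  have "map tail_sums (map ((#) x) (shuffle_list u (y # v))) =
      map ((#) (sum_list (x # u) + sum_list (y # v))) (map tail_sums (shuffle_list u (y # v)))"
    using sum_list_shuffle_list[of _ u "y # v"] by (auto simp: ac_simps)
  moreover have "map tail_sums (map ((#) y) (shuffle_list (x # u) v)) =
      map ((#) (sum_list (x # u) + sum_list (y # v))) (map tail_sums (shuffle_list (x # u) v))"
    using sum_list_shuffle_list[of _ "x # u" v] by (auto simp: ac_simps)
  ultimately show ?case using 3 by simp
qed

section \<open>Primitive elements\<close>

definition word_coproduct :: "'l list \<Rightarrow> ('l list \<times> 'l list \<Rightarrow>\<^sub>0 'k::field)" where
  "word_coproduct w = (\<Prod>a\<leftarrow>w. tensor 1 (single [a] 1) + tensor (single [a] 1) 1)"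

lemma coproduct_eq: "coproduct = lin_ext word_coproduct"
  by (simp add: coproduct_def word_coproduct_def[abs_def])

lemma one_list: "(1 :: 'l list \<Rightarrow>\<^sub>0 'k::field) = single [] 1"
  by (simp flip: single_one zero_list_def)

lemma lin_form_tensor: "lin_form (\<lambda>(u, v). g u * h v) (tensor p q) = lin_form g p * lin_form h q"
  unfolding tensor_def by (simp add: lin_form_mult_coeff lin_form_mult_coeff_right)

lemma tensor_single: "tensor (single u 1) (single v 1) = (single (u, v) 1 :: _ \<Rightarrow>\<^sub>0 'k::field)"
  by (simp add: tensor_def lin_ext_single)

lemma lin_form_word_coproduct_Nil [simp]: "lin_form G (word_coproduct []) = G ([], [])"
  by (simp add: word_coproduct_def zero_prod_def zero_list_def)

lemma lin_form_word_coproduct_Cons [simp]: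
  fixes G :: "'l list \<times> 'l list \<Rightarrow> 'k::field"
  shows "lin_form G (word_coproduct (a # w)) =
     lin_form (\<lambda>(u, v). G (u, a # v)) (word_coproduct w) +
     lin_form (\<lambda>(u, v). G (a # u, v)) (word_coproduct w)"
proof -
  have "word_coproduct (a # w) =
      (single ([], [a]) 1 + single ([a], []) 1) * (word_coproduct w :: 'l list \<times> 'l list \<Rightarrow>\<^sub>0 'k)"
    by (simp add: word_coproduct_def one_list tensor_single)
  then show ?thesis
    by (simp add: distrib_right lin_form_mult plus_prod_def plus_list_def case_prod_unfold)
qed

text \<open>Each letter of \<open>w\<close> goes to the left or to the right tensor factor, just as
  the first letter of a shuffle comes from one list or the other.\<close>

lemma lin_form_letterwise_word_coproduct:
  "lin_form (\<lambda>(u, v). letterwise e t u * letterwise e s v) (word_coproduct w) =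
     (\<Sum>c\<leftarrow>shuffle_list t s. letterwise e c w)"
proof (induction w arbitrary: t s)
  case Nil
  have "(\<Sum>c\<leftarrow>shuffle_list t s. letterwise e c []) = letterwise e t [] * letterwise e s []"
    by (cases "(t, s)" rule: shuffle_list.cases) (auto simp: o_def)
  then show ?case by simp
next
  case (Cons a w)
  have IH: "lin_form (\<lambda>p. letterwise e t (fst p) * letterwise e s (snd p)) (word_coproduct w) =
      (\<Sum>c\<leftarrow>shuffle_list t s. letterwise e c w)" for t s
    using Cons[of t s] by (simp only: case_prod_unfold)
  have scale: "letterwise e t u * (e b a * c) = e b a * (letterwise e t u * c)" for t u b c
    by (rule mult.left_commute)
  show ?case
    by (cases t; cases s)
       (simp_all add: o_def mult.assoc scale case_prod_unfold lin_form_mult_coeff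
           sum_list_const_mult IH)
qed

lemma lin_form_coproduct:
  assumes "\<And>w. lin_form G (word_coproduct w) = (\<Sum>c\<leftarrow>cs. \<chi> c w)"
  shows "lin_form G (coproduct p) = (\<Sum>c\<leftarrow>cs. lin_form (\<chi> c) p)"
  by (simp add: coproduct_eq assms lin_form_sum_list_coeff)

lemma lin_form_primitive:
  assumes "primitive p"
  shows "lin_form (\<lambda>(u, v). g u * h v) (coproduct p) = g [] * lin_form h p + lin_form g p * h []"
  using assms by (simp add: primitive_def lin_form_tensor zero_list_def)

text \<open>Each summand on the right of the primitivity equation has a factor evaluated at the
  empty word, where forms at nonempty lists vanish.\<close>

lemma sum_shuffle_list_primitive:
  assumes "primitive p" "u \<noteq> []" "v \<noteq> []"
  shows "(\<Sum>c\<leftarrow>shuffle_list u v. lin_form (letterwise e c) p) = 0"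
  using lin_form_primitive[OF assms(1), of "letterwise e u" "letterwise e v"] assms(2,3)
  by (simp add: lin_form_coproduct[OF lin_form_letterwise_word_coproduct] letterwise_length)

lemma lin_form_shuffle_word:
  "lin_form g (shuffle_word u v) = (\<Sum>c\<leftarrow>shuffle_list u v. g c)"
proof -
  let ?w = "u @ v"
  have "map (\<lambda>i. ?w ! (i - 1)) [1..<length u + 1] = u"
    by (rule nth_equalityI) (auto simp: nth_append)
  moreover have "map (\<lambda>i. ?w ! (i - 1)) [length u + 1..<length u + length v + 1] = v"
    by (rule nth_equalityI) (auto simp: nth_append)
  ultimately show ?thesis
    unfolding shuffle_word_def
    using sum_shuffle_perms[of g "\<lambda>i. ?w ! (i - 1)" "length u" "length v"] by simp
qed

lemma letterwise_indicator: "letterwise (\<lambda>a b. if a = b then 1 else 0) t w =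
    (if t = w then 1 else 0)"
proof (induction t arbitrary: w)
  case Nil
  show ?case by (cases w) auto
next
  case (Cons a t)
  then show ?case by (cases w) auto
qed

text \<open>For the indicator form the shuffle equation speaks of coefficients: primitive elements
  are orthogonal to proper shuffle products. This is what kills the image of U.\<close>

lemma pairing_shuffle_primitive:
  assumes "primitive \<psi>" "u \<noteq> []" "v \<noteq> []"
  shows "pairing (shuffle (single u 1) (single v 1)) \<psi> = 0"
proof -
  have "pairing (shuffle (single u 1) (single v 1)) \<psi> = (\<Sum>c\<leftarrow>shuffle_list u v. lookup \<psi> c)"
    by (simp add: pairing_eq_lin_form shuffle_def lin_form_shuffle_word)
  also have "\<dots> = (\<Sum>c\<leftarrow>shuffle_list u v. lin_form (letterwise (\<lambda>a b. if a = b then 1 else 0) c) \<psi>)"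
    by (simp add: letterwise_indicator[abs_def] lookup_eq_lin_form eq_commute)
  also have "\<dots> = 0" using assms by (rule sum_shuffle_list_primitive)
  finally show ?thesis .
qed

text \<open>A converse of \<open>sum_shuffle_list_primitive\<close>: products of two test forms
  separate the tensor square. If one of the lists is empty, the only shuffle is the other list, and
  the equation reduces to the vanishing of the constant term.\<close>

lemma primitiveI_letterwise:
  fixes p :: "nat list \<Rightarrow>\<^sub>0 'k::field_char_0"
  assumes Nil: "lookup p [] = 0"
    and shuffle: "\<And>u v. u \<noteq> [] \<Longrightarrow> v \<noteq> [] \<Longrightarrow>
      (\<Sum>c\<leftarrow>shuffle_list u v. lin_form (letterwise (^) (c :: 'k list)) p) = 0"
  shows "primitive p"
proof -
  let ?\<chi> = "letterwise (^) :: 'k list \<Rightarrow> _"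
  have sep: "v = 0" if "\<And>t. t \<in> UNIV \<Longrightarrow> lin_form (?\<chi> t) v = 0" for v
    by (rule monomials_separated[where f = "\<lambda>w. w" and T = UNIV]) (use that in auto)
  have Nil': "lin_form (?\<chi> []) p = 0"
  proof -
    have "?\<chi> [] = (\<lambda>w. if w = [] then 1 else 0)" by (auto simp: fun_eq_iff neq_Nil_conv)
    then show ?thesis using Nil by (simp flip: lookup_eq_lin_form)
  qed
  have "coproduct p - (tensor 1 p + tensor p 1) = 0"
  proof (rule tensor_separated[where T = UNIV and S = UNIV and \<chi> = ?\<chi> and \<theta> = ?\<chi>])
    fix t s :: "'k list"
    have "(\<Sum>c\<leftarrow>shuffle_list t s. lin_form (?\<chi> c) p) =
        ?\<chi> t [] * lin_form (?\<chi> s) p + lin_form (?\<chi> t) p * ?\<chi> s []"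
    proof (cases "t = [] \<or> s = []")
      case True
      then show ?thesis using Nil' by (cases t; cases s) auto
    next
      case False
      then show ?thesis using shuffle[of t s] by (simp add: letterwise_length)
    qed
    then show "lin_form (\<lambda>(u, v). ?\<chi> t u * ?\<chi> s v) (coproduct p - (tensor 1 p + tensor p 1)) = 0"
      by (simp add: lin_form_coproduct[OF lin_form_letterwise_word_coproduct] lin_form_tensor
          zero_list_def)
  qed (use sep in auto)
  then show ?thesis by (simp add: primitive_def)
qed

section \<open>Generating series of words in \<open>x\<close> and \<open>z\<close>\<close>

text \<open>The trailing power of x counts as a last block, so the value is nonzero only if
  \<open>t\<close> has one entry more than the word has letters z.\<close>

definition block_value :: "'k list \<Rightarrow> letter list \<Rightarrow> 'k::field" where
  "block_value t w = (case exponents w of (ns, k) \<Rightarrow> letterwise (^) t (ns @ [k]))"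

text \<open>Replaces \<open>exponents\<close> by a recursion on letters, the form that inductions
  over the coproduct need.\<close>

lemma block_value_simps [simp]:
  "block_value [] w = 0"
  "block_value (a # t) [] = (if t = [] then 1 else 0)"
  "block_value (a # t) (letter.x # w) = a * block_value (a # t) w"
  "block_value (a # t) (letter.z # w) = block_value t w"
  by (cases t; auto simp: block_value_def letterwise_length split: prod.splits list.splits)+

lemma length_exponents: "length (fst (exponents w)) = depth w"
  by (induction w rule: exponents.induct) (auto simp: depth_def split: prod.splits list.splits)

lemma block_value_eq_0: "length t \<noteq> Suc (depth w) \<Longrightarrow> block_value t w = 0"
  by (simp add: block_value_def letterwise_length length_exponents split: prod.split)
     (metis length_exponents fst_conv letterwise_length length_append_singleton)

text \<open>A letter x, sent to either tensor factor, contributes the current entry of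
  \<open>t\<close> or of \<open>s\<close>, hence in total the sum at the current lattice point. A
  letter z passes to the next entry in one of the lists, hence along one edge of the path.\<close>

lemma block_value_word_coproduct:
  "lin_form (\<lambda>(u, v). block_value t u * block_value s v) (word_coproduct w) =
     (\<Sum>c\<leftarrow>path_sums t s. block_value c w)"
proof (induction w arbitrary: t s)
  case Nil
  show ?case
  proof (cases "length t = 1 \<and> length s = 1")
    case True
    then show ?thesis by (auto simp: length_Suc_conv)
  next
    case False
    have "block_value c [] = 0" if "c \<in> set (path_sums t s)" for c
    proof (rule block_value_eq_0)
      have "t \<noteq> []" "s \<noteq> []" using that by auto
      then have "length t \<ge> 1" "length s \<ge> 1" by (auto simp: Suc_le_eq)
      then show "length c \<noteq> Suc (depth [])"
        using path_sums_last_length[OF that] False by (simp add: depth_def) linarith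
    qed
    then have "(\<Sum>c\<leftarrow>path_sums t s. block_value c []) = 0" by (simp cong: map_cong)
    moreover have "block_value t [] * block_value s [] = 0"
      using False by (cases t; cases s) auto
    ultimately show ?thesis by simp
  qed
next
  case (Cons a w)
  show ?case
  proof (cases "(t, s)" rule: path_sums.cases)
    case (1 t1 ts s1 ss)
    \<comment> \<open>All paths have the same starting point, so the factor coming from x can be
      pulled out of the sum.\<close>
    have *: "c \<noteq> [] \<and> hd c = t1 + s1" if "c \<in> set (path_sums t s)" for c
      using that 1 by (auto split: if_splits)
    show ?thesis
    proof (cases a)
      case x
      have "(\<Sum>c\<leftarrow>path_sums t s. block_value c (a # w)) =
          (\<Sum>c\<leftarrow>path_sums t s. (t1 + s1) * block_value c w)"
      proof (rule sum_list_map_cong)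
        fix c assume "c \<in> set (path_sums t s)"
        with * obtain c' where "c = (t1 + s1) # c'" by (metis list.collapse)
        then show "block_value c (a # w) = (t1 + s1) * block_value c w" using x by simp
      qed
      also have "\<dots> =
          (t1 + s1) * lin_form (\<lambda>(u, v). block_value t u * block_value s v) (word_coproduct w)"
        by (simp only: Cons sum_list_const_mult)
      also have "\<dots> = lin_form (\<lambda>(u, v). block_value t u * block_value s v) (word_coproduct (a # w))"
        using 1 x
            by (simp add: case_prod_unfold mult.left_commute[of _ s1] mult.assoc lin_form_mult_coeff
                algebra_simps)
      finally show ?thesis by simp
    next
      case z
      have "lin_form (\<lambda>(u, v). block_value t u * block_value s v) (word_coproduct (a # w)) =
          (\<Sum>c\<leftarrow>path_sums t ss. block_value c w) + (\<Sum>c\<leftarrow>path_sums ts s. block_value c w)"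
        using 1 z by (simp add: case_prod_unfold flip: Cons)
      also have "\<dots> = (\<Sum>c\<leftarrow>path_sums t s. block_value c (a # w))"
        using 1 z by (auto simp: o_def path_sums_singleton)
      finally show ?thesis .
    qed
  qed (auto simp: case_prod_unfold lin_form_zero_coeff)
qed

text \<open>A word is recovered from its exponents, and the list of exponents with the trailing
  power appended is never empty.\<close>

lemma block_values_separated:
  fixes v :: "'k::field_char_0 xz_algebra"
  assumes "\<And>t. t \<noteq> [] \<Longrightarrow> lin_form (block_value t) v = 0"
  shows "v = 0"
proof (rule monomials_separated[where f = "\<lambda>w. fst (exponents w) @ [snd (exponents w)]" and T =
    "- {[]}"])
  show "inj_on (\<lambda>w. fst (exponents w) @ [snd (exponents w)]) (keys v)"
    by (rule inj_onI) (metis append1_eq_conv block_word_exponents)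
  show "lin_form (\<lambda>w. letterwise (^) t (fst (exponents w) @ [snd (exponents w)])) v = 0"
    if "t \<in> - {[]}" for t :: "'k list"
    using assms[of t] that by (simp add: block_value_def[abs_def] case_prod_unfold)
qed auto

lemma primitiveI_block_value:
  fixes p :: "'k::field_char_0 xz_algebra"
  assumes "\<And>t s. t \<noteq> [] \<Longrightarrow> s \<noteq> [] \<Longrightarrow>
      (\<Sum>c\<leftarrow>path_sums t s. lin_form (block_value c) p) =
        block_value t [] * lin_form (block_value s) p +
            lin_form (block_value t) p * block_value s []"
  shows "primitive p"
proof -
  have "coproduct p - (tensor 1 p + tensor p 1) = 0"
  proof (rule tensor_separated[where T = "- {[]}" and S = "- {[]}" and \<chi> = block_value and \<theta> =
      block_value])
    fix t s :: "'k list" assume "t \<in> - {[]}" "s \<in> - {[]}"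
    then show "lin_form (\<lambda>(u,
        v). block_value t u * block_value s v) (coproduct p - (tensor 1 p + tensor p 1)) = 0"
      using assms[of t s]
      by (simp add: lin_form_coproduct[OF block_value_word_coproduct] lin_form_tensor zero_list_def)
  qed (use block_values_separated in auto)
  then show ?thesis by (simp add: primitive_def)
qed

lemma block_value_primitive:
  assumes "primitive p"
  shows "(\<Sum>c\<leftarrow>path_sums t s. lin_form (block_value c) p) =
      block_value t [] * lin_form (block_value s) p + lin_form (block_value t) p * block_value s []"
  using lin_form_primitive[OF assms, of "block_value t" "block_value s"]
  by (simp add: lin_form_coproduct[OF block_value_word_coproduct])

section \<open>Polynomials in \<open>x\<^sub>1, \<dots>, x\<^sub>m\<close> and exponent lists\<close>

definition polys :: "nat \<Rightarrow> 'k::field mpoly set" where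
  "polys m = {p. \<forall>t\<in>keys p. keys t \<subseteq> {1..m}}"

definition exponent :: "nat list \<Rightarrow> nat \<Rightarrow>\<^sub>0 nat" where
  "exponent ns = (\<Sum>i=1..length ns. single i (ns ! (i - 1)))"

lemma lookup_exponent: "lookup (exponent ns) i = (if i \<in> {1..length ns} then ns ! (i - 1) else 0)"
  by (simp add: exponent_def lookup_sum lookup_single when_def sum.delta')

lemma keys_exponent: "keys (exponent ns) \<subseteq> {1..length ns}"
  by (auto simp: in_keys_iff lookup_exponent split: if_splits)

lemma exponent_lookup: "keys t \<subseteq> {1..m} \<Longrightarrow> exponent (map (lookup t) [1..<m+1]) = t"
  by (rule poly_mapping_eqI) (auto simp: lookup_exponent in_keys_iff)

lemma var_power: "var i ^ n = single (single i n) 1"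
proof (induction n)
  case (Suc n)
  then show ?case using single_add[of i 1 n] by (simp add: var_def mult_single)
qed simp

lemma prod_single: "(\<Prod>i\<in>A. single (f i) (1 :: 'k::field)) = single (\<Sum>i\<in>A. f i) 1"
  by (induction A rule: infinite_finite_induct) (auto simp: mult_single)

lemma prod_var_power: "length ns = m \<Longrightarrow> (\<Prod>i=1..m. var i ^ (ns ! (i - 1))) = single (exponent ns) 1"
  by (simp only: var_power prod_single exponent_def)

lemma poly_weight_superset:
  "finite A \<Longrightarrow> keys t \<subseteq> A \<Longrightarrow> poly_weight m t = (\<Sum>i\<in>A. lookup t i) + m"
  unfolding poly_weight_def
  by (rule arg_cong[where f = "\<lambda>n. n + m"], rule sum.mono_neutral_left) (auto simp: in_keys_iff)

lemma poly_weight_exponent: "poly_weight m (exponent ns) = sum_list ns + m"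
proof -
  have "(\<Sum>i=1..length ns. lookup (exponent ns) i) = (\<Sum>i<length ns. ns ! i)"
    by (rule sum.reindex_bij_witness[of _ Suc "\<lambda>i. i - 1"]) (auto simp: lookup_exponent)
  then show ?thesis
    using poly_weight_superset[OF _ keys_exponent, of ns m]
        by (simp add: sum_list_sum_nth atLeast0LessThan)
qed

text \<open>The list may be longer than the number of variables: elements of \<open>polys m\<close>
  ignore the surplus, such as the final 0 of \<open>tail_sums\<close>.\<close>

definition list_eval :: "'k::field mpoly \<Rightarrow> 'k list \<Rightarrow> 'k" where
  "list_eval p c = eval (\<lambda>i. c ! (i - 1)) p"

lemma eval_eq_list_eval:
  assumes "p \<in> polys m" "\<And>i. i \<in> {1..m} \<Longrightarrow> a i = c ! (i - 1)"
  shows "eval a p = list_eval p c"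
  unfolding list_eval_def by (rule eval_cong) (use assms in \<open>auto simp: polys_def subset_iff\<close>)

lemma list_eval_cong:
  assumes "p \<in> polys m" "\<And>i. i < m \<Longrightarrow> c ! i = d ! i"
  shows "list_eval p c = list_eval p d"
  unfolding list_eval_def[of p c] by (rule eval_eq_list_eval[OF assms(1)]) (use assms(2) in auto)

lemma list_eval_eqI:
  fixes p q :: "'k::field_char_0 mpoly"
  assumes "p \<in> polys m" "q \<in> polys m" "\<And>c. length c = m \<Longrightarrow> list_eval p c = list_eval q c"
  shows "p = q"
proof -
  have "eval a (p - q) = 0" for a
  proof -
    have nth: "a i = map a [1..<m+1] ! (i - 1)" if "i \<in> {1..m}" for i using that by auto
    show ?thesis
      using eval_eq_list_eval[OF assms(1) nth] eval_eq_list_eval[OF assms(2) nth]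
        assms(3)[of "map a [1..<m+1]"] by simp
  qed
  then show ?thesis using eval_eq_zero_imp[of "p - q"] by simp
qed

section \<open>The double shuffle equations in terms of values\<close>

text \<open>The common shape of all double shuffle equations: \<open>F\<close> evaluates a
  polynomial at the list itself for \<open>T_star\<close> and at its tail sums for
  \<open>T_sh\<close>.\<close>

definition star_zero :: "nat \<Rightarrow> nat \<Rightarrow> ('k list \<Rightarrow> 'k::field) \<Rightarrow> bool" where
  "star_zero m l F \<longleftrightarrow>
     (\<forall>u v. length u = l \<longrightarrow> length v = m - l \<longrightarrow> (\<Sum>c\<leftarrow>shuffle_list u v. F c) = 0)"

lemma sum_perms_zero_iff:
  fixes F :: "'k list \<Rightarrow> 'k::field"
  assumes "l \<le> m"
  shows "(\<forall>a. (\<Sum>\<sigma>\<in>shuffle_perms l (m - l). F (map (\<lambda>i. a (inv \<sigma> i)) [1..<m+1])) = 0) \<longleftrightarrow>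
      star_zero m l F"
proof -
  have eq: "(\<Sum>\<sigma>\<in>shuffle_perms l (m - l). F (map (\<lambda>i. a (inv \<sigma> i)) [1..<m+1])) =
      (\<Sum>c\<leftarrow>shuffle_list (map a [1..<l+1]) (map a [l+1..<m+1]). F c)" for a
    using sum_shuffle_perms[of F a l "m - l"] assms by simp
  show ?thesis unfolding eq star_zero_def
  proof (intro iffI allI impI)
    fix u v :: "'k list"
    assume zero: "\<forall>a. (\<Sum>c\<leftarrow>shuffle_list (map a [1..<l+1]) (map a [l+1..<m+1]). F c) = 0"
      and len: "length u = l" "length v = m - l"
    have "map (\<lambda>i. (u @ v) ! (i - 1)) [1..<l+1] = u" "map (\<lambda>i. (u @ v) ! (i - 1)) [l+1..<m+1] = v"
      using len assms by (auto intro!: nth_equalityI simp: nth_append)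
    then show "(\<Sum>c\<leftarrow>shuffle_list u v. F c) = 0"
      using zero[rule_format, of "\<lambda>i. (u @ v) ! (i - 1)"] by simp
  qed simp
qed

lemma eval_T_perm: "eval a (T_perm \<sigma> p) = eval (\<lambda>i. a (inv \<sigma> i)) p"
  by (simp add: T_perm_def eval_poly_subst)

lemma nth_tail_sums_map:
  assumes "i \<in> {1..m}"
  shows "tail_sums (map b [1..<m+1]) ! (i - 1) = (\<Sum>j=i..m. b j)"
proof -
  have "tail_sums (map b [1..<m+1]) ! (i - 1) = (\<Sum>j\<leftarrow>[i..<m+1]. b j)"
    using assms by (subst nth_tail_sums) (auto simp: drop_map)
  also have "\<dots> = (\<Sum>j=i..m. b j)"
    by (simp add: interv_sum_list_conv_sum_set_nat atLeastLessThanSuc_atLeastAtMost)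
  finally show ?thesis .
qed

text \<open>A polynomial vanishes when its values do, and \<open>T_perm \<sigma> p\<close> takes at
  a point the value of \<open>p\<close> at the permuted point.\<close>

lemma T_star_eq_0_iff:
  fixes p :: "'k::field_char_0 mpoly"
  assumes p: "p \<in> polys m" and "l \<le> m"
  shows "T_star m l p = 0 \<longleftrightarrow> star_zero m l (list_eval p)"
proof -
  have eq: "eval (\<lambda>i. a (inv \<sigma> i)) p = list_eval p (map (\<lambda>i. a (inv \<sigma> i)) [1..<m+1])" for a \<sigma>
    by (rule eval_eq_list_eval[OF p]) auto
  then have "eval a (T_star m l p) =
      (\<Sum>\<sigma>\<in>shuffle_perms l (m - l). list_eval p (map (\<lambda>i. a (inv \<sigma> i)) [1..<m+1]))" for a
    unfolding T_star_def eval_sum eval_T_perm by (intro sum.cong refl eq)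
  then show ?thesis
    unfolding sum_perms_zero_iff[OF assms(2), symmetric] by (metis eval_eq_zero_imp eval_simps(1))
qed

text \<open>The substitution S_m is applied first, so at the point permuted by \<sigma> the variable
  x_i takes the i-th tail sum of the permuted list.\<close>

lemma T_sh_eq_0_iff:
  fixes p :: "'k::field_char_0 mpoly"
  assumes p: "p \<in> polys m" and "l \<le> m"
  shows "T_sh m l p = 0 \<longleftrightarrow> star_zero m l (\<lambda>c. list_eval p (tail_sums c))"
proof -
  have eq: "eval (\<lambda>i. \<Sum>j=i..m. a (inv \<sigma> j)) p =
      list_eval p (tail_sums (map (\<lambda>i. a (inv \<sigma> i)) [1..<m+1]))" for a \<sigma>
    by (rule eval_eq_list_eval[OF p]) (rule nth_tail_sums_map[symmetric])
  then have "eval a (T_sh m l p) =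
      (\<Sum>\<sigma>\<in>shuffle_perms l (m - l). list_eval p (tail_sums (map (\<lambda>i. a (inv \<sigma> i)) [1..<m+1])))" for a
    unfolding T_sh_def o_apply T_star_def S_map_def eval_sum eval_T_perm eval_poly_subst eval_simps
    by (intro sum.cong refl eq)
  then show ?thesis
    unfolding sum_perms_zero_iff[OF assms(2), symmetric] by (metis eval_eq_zero_imp eval_simps(1))
qed

definition dsh_polys :: "nat \<Rightarrow> 'k::field_char_0 mpoly set" where
  "dsh_polys m = {p \<in> polys m. \<forall>l\<in>{1..m-1}.
     star_zero m l (list_eval p) \<and> star_zero m l (\<lambda>c. list_eval p (tail_sums c))}"

lemma poly_ring_eq: "poly_ring m = subspace_graded (poly_weight m) (polys m)"
  by (simp add: poly_ring_def polys_def)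

lemma Dsh_eq: "Dsh m = subspace_graded (poly_weight m) (dsh_polys m)"
proof -
  have "l \<le> m" if "l \<in> {1..m-1}" for l using that by auto
  then have "{p \<in> polys m. \<forall>l\<in>{1..m-1}. T_star m l p = 0 \<and> T_sh m l p = 0} =
      (dsh_polys m :: 'a mpoly set)"
    unfolding dsh_polys_def by (auto simp: T_star_eq_0_iff T_sh_eq_0_iff)
  then show ?thesis by (simp add: Dsh_def poly_ring_eq subspace_graded_def)
qed

section \<open>Homogeneous polynomials\<close>

text \<open>\<open>poly_weight 0\<close> is the ordinary degree, without the shift by m.\<close>

definition homogeneous :: "nat \<Rightarrow> 'k::field mpoly \<Rightarrow> bool" where
  "homogeneous d p \<longleftrightarrow> (\<forall>t\<in>keys p. poly_weight 0 t = d)"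

lemma poly_weight_add: "poly_weight 0 (s + t) = poly_weight 0 s + poly_weight 0 t"
  using poly_weight_superset[of "keys s \<union> keys t" "s +
      t" 0] poly_weight_superset[of "keys s \<union> keys t" s 0]
    poly_weight_superset[of "keys s \<union> keys t" t 0] keys_add[of s t]
  by (simp add: lookup_add sum.distrib)

lemma homogeneous_mult: "homogeneous d p \<Longrightarrow> homogeneous e q \<Longrightarrow> homogeneous (d + e) (p * q)"
  unfolding homogeneous_def using keys_mult[of p q] by (force simp: poly_weight_add)

lemma homogeneous_one: "homogeneous 0 1"
  by (simp add: homogeneous_def poly_weight_def)

lemma homogeneous_power: "homogeneous d p \<Longrightarrow> homogeneous (d * n) (p ^ n)"
  by (induction n) (auto simp: homogeneous_one intro: homogeneous_mult)

lemma homogeneous_prod: "(\<And>i. i \<in> A \<Longrightarrow> homogeneous (d i) (f i)) \<Longrightarrow>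
    homogeneous (\<Sum>i\<in>A. d i) (\<Prod>i\<in>A. f i)"
  by (induction A rule: infinite_finite_induct) (auto simp: homogeneous_one intro: homogeneous_mult)

lemma homogeneous_diff: "homogeneous d p \<Longrightarrow> homogeneous d q \<Longrightarrow> homogeneous d (p - q)"
  unfolding homogeneous_def using keys_diff[of p q] by blast

lemma homogeneous_zero: "homogeneous d 0"
  by (simp add: homogeneous_def)

lemma homogeneous_sum: "(\<And>i. i \<in> A \<Longrightarrow> homogeneous d (f i)) \<Longrightarrow> homogeneous d (\<Sum>i\<in>A. f i)"
  unfolding homogeneous_def using keys_sum[of f A] by blast

lemma homogeneous_var: "homogeneous 1 (var i)"
  by (simp add: homogeneous_def var_def poly_weight_def)

lemma homogeneous_poly_subst:
  assumes "\<And>i. homogeneous 1 (f i)" "homogeneous d p"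
  shows "homogeneous d (poly_subst f p)"
  unfolding homogeneous_def
proof
  fix t assume "t \<in> keys (poly_subst f p)"
  then obtain s where s: "s \<in> keys p" "t \<in> keys (\<Prod>i\<in>keys s. f i ^ lookup s i)"
    unfolding poly_subst_def using keys_lin_ext by fast
  have "homogeneous (\<Sum>i\<in>keys s. 1 * lookup s i) (\<Prod>i\<in>keys s. f i ^ lookup s i)"
    by (intro homogeneous_prod homogeneous_power assms)
  then have "poly_weight 0 t = poly_weight 0 s"
    using s(2) by (simp add: homogeneous_def poly_weight_def)
  then show "poly_weight 0 t = d" using assms(2) s(1) by (simp add: homogeneous_def)
qed

lemma keys_poly_subst:
  fixes f :: "nat \<Rightarrow> 'k::field mpoly"
  assumes f: "\<And>i t. i \<in> I \<Longrightarrow> t \<in> keys (f i) \<Longrightarrow> keys t \<subseteq> B" and p: "\<And>s. s \<in> keys p \<Longrightarrow> keys s \<subseteq> I"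
    and t: "t \<in> keys (poly_subst f p)"
  shows "keys t \<subseteq> B"
proof -
  define G :: "'k mpoly set" where "G = {q. \<forall>t\<in>keys q. keys t \<subseteq> B}"
  have mult: "q * r \<in> G" if "q \<in> G" "r \<in> G" for q r
    using that keys_mult[of q r] keys_add unfolding G_def by (fastforce dest!: subsetD)
  have one: "1 \<in> G" by (simp add: G_def)
  have power: "q ^ n \<in> G" if "q \<in> G" for q n using that by (induction n) (auto simp: one mult)
  have prod: "prod g A \<in> G" if "\<And>i. i \<in> A \<Longrightarrow> g i \<in> G" for g :: "nat \<Rightarrow> _" and A
    using that by (induction A rule: infinite_finite_induct) (auto simp: one mult)
  obtain s where s: "s \<in> keys p" "t \<in> keys (\<Prod>i\<in>keys s. f i ^ lookup s i)"
    using t unfolding poly_subst_def using keys_lin_ext by fast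
  have "(\<Prod>i\<in>keys s. f i ^ lookup s i) \<in> G"
    using f p[OF s(1)] by (intro prod power) (auto simp: G_def)
  with s(2) show ?thesis by (simp add: G_def)
qed

section \<open>The isomorphism between \<open>ls\<close> and the double shuffle space\<close>

lemma exponents_length: "exponents w = (ns, k) \<Longrightarrow> length w = sum_list ns + length ns + k"
  by (induction w arbitrary: ns k rule: exponents.induct) (auto split: prod.splits list.splits)

lemma length_block_word: "length (block_word ns k) = sum_list ns + length ns + k"
  using exponents_length[OF exponents_block_word] .

lemma depth_block_word: "depth (block_word ns k) = length ns"
  using length_exponents[of "block_word ns k"] by (simp add: exponents_block_word)

lemma block_value_block_word: "block_value t (block_word ns k) = letterwise (^) t (ns @ [k])"
  by (simp add: block_value_def exponents_block_word)

lemma letterwise_snoc: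
  "letterwise e (t @ [a]) (w @ [b]) = letterwise e t w * e a b"
  by (induction e t w rule: letterwise.induct) (auto simp: mult.assoc letterwise_length)

lemma prod_nth_power:
  "length c = m \<Longrightarrow> length ns = m \<Longrightarrow> (\<Prod>i=1..m. c ! (i - 1) ^ (ns ! (i - 1))) = letterwise (^) c ns"
  by (simp add: letterwise_eq_prod)
     (rule prod.reindex_bij_witness[of _ Suc "\<lambda>i. i - 1"]; auto)

lemma keys_f_map:
  assumes "\<psi> \<in> component depth m S" "t \<in> keys (f_map m \<psi>)"
  obtains ns where "t = exponent ns" "length ns = m" "block_word ns 0 \<in> keys \<psi>"
proof -
  obtain w where w: "w \<in> keys \<psi>"
    and t: "t \<in> keys ((case exponents w of (ns, k) \<Rightarrow>
      if k = 0 then \<Prod>i=1..m. var i ^ (ns ! (i - 1)) else 0) :: 'a mpoly)"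
    using assms(2) keys_lin_ext unfolding f_map_def by fast
  obtain ns k where e: "exponents w = (ns, k)" by (cases "exponents w")
  have len: "length ns = m" using assms(1) w length_exponents[of w] by (simp add: component_def e)
  moreover have "k = 0" using t by (auto simp: e split: if_splits)
  moreover have "t = exponent ns"
      using t \<open>k = 0\<close> unfolding e by (simp add: prod_var_power[OF len, simplified])
  moreover have "block_word ns k = w" using block_word_exponents[of w] by (simp add: e)
  ultimately show ?thesis using that w by blast
qed

lemma f_map_in_polys: "\<psi> \<in> component depth m S \<Longrightarrow> f_map m \<psi> \<in> polys m"
  unfolding polys_def using keys_exponent by (blast elim: keys_f_map)

text \<open>Setting the last argument to 0 kills the words that end in x, as
  \<open>0 ^ k = 0\<close> for k > 0, and keeps the others, as \<open>0 ^ 0 = 1\<close>. This is the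
  Kronecker delta of \<open>f_map\<close>.\<close>

lemma list_eval_f_map:
  assumes \<psi>: "\<psi> \<in> component depth m S" and c: "length c = m"
  shows "list_eval (f_map m \<psi>) c = lin_form (block_value (c @ [0])) \<psi>"
proof -
  have "list_eval (f_map m \<psi>) c = lin_form (\<lambda>w. list_eval (case exponents w of (ns, k) \<Rightarrow>
      if k = 0 then \<Prod>i=1..m. var i ^ (ns ! (i - 1)) else 0) c) \<psi>"
    unfolding list_eval_def eval_def f_map_def by (rule lin_form_lin_ext)
  also have "\<dots> = lin_form (block_value (c @ [0])) \<psi>"
  proof (rule lin_form_cong)
    fix w assume w: "w \<in> keys \<psi>"
    obtain ns k where e: "exponents w = (ns, k)" by (cases "exponents w")
    have "length ns = m" using \<psi> w length_exponents[of w] by (simp add: component_def e)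
    then show "list_eval (case exponents w of (ns, k) \<Rightarrow>
        if k = 0 then \<Prod>i=1..m. var i ^ (ns ! (i - 1)) else 0) c = block_value (c @ [0]) w"
      using prod_nth_power[of c m ns] c
      by (simp add: list_eval_def block_value_def e letterwise_snoc eval_prod eval_power)
  qed
  finally show ?thesis .
qed

lemma list_eval_f_map_last:
  assumes \<psi>: "\<psi> \<in> component depth m S" and t: "length t = Suc m" "last t = 0"
  shows "list_eval (f_map m \<psi>) t = lin_form (block_value t) \<psi>"
proof -
  have "t = butlast t @ [0]"
      using t by (metis append_butlast_last_id length_greater_0_conv zero_less_Suc)
  moreover have "list_eval (f_map m \<psi>) t = list_eval (f_map m \<psi>) (butlast t)"
    by (rule list_eval_cong[OF f_map_in_polys[OF \<psi>]]) (use t in \<open>auto simp: nth_butlast\<close>)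
  ultimately show ?thesis using list_eval_f_map[OF \<psi>, of "butlast t"] t(1) by simp
qed

text \<open>The letter \<open>Suc n\<close> stands for a block with exponent n. Two shapes of
  \<open>e\<close> occur: the exponent lowered by one, with \<open>\<mu> a = 1\<close>, to read off
  the equations of \<open>T_star\<close>; and the plain power, with \<open>\<mu> a = a\<close>, for
  which the test forms are known to separate.\<close>

lemma lin_form_proj_Y:
  assumes \<psi>: "\<psi> \<in> component depth m S" and e: "\<And>a n. e a (Suc n) =
      \<mu> a * a ^ n" and c: "length c = m"
  shows "lin_form (letterwise e c) (proj_Y \<psi>) = prod_list (map \<mu> c) * list_eval (f_map m \<psi>) c"
proof -
  have eq: "letterwise e c (map Suc ns) = prod_list (map \<mu> c) * letterwise (^) c ns" for c ns
    by (induction "(^) :: 'a \<Rightarrow> nat \<Rightarrow> 'a" c ns rule: letterwise.induct) (auto simp: e mult_ac)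
  have "lin_form (letterwise e c) (proj_Y \<psi>) = lin_form (\<lambda>w. lin_form (letterwise e c)
      (case exponents w of (ns, k) \<Rightarrow> if k = 0 then single (map Suc ns) 1 else 0)) \<psi>"
    unfolding proj_Y_def by (rule lin_form_lin_ext)
  also have "\<dots> = lin_form (\<lambda>w. prod_list (map \<mu> c) * block_value (c @ [0]) w) \<psi>"
    by (rule lin_form_cong) (auto simp: block_value_def letterwise_snoc eq split: prod.split)
  finally show ?thesis using list_eval_f_map[OF \<psi> c] by (simp add: lin_form_mult_coeff)
qed

lemma f_map_in_dsh_polys:
  fixes \<psi> :: "'k::field_char_0 xz_algebra"
  assumes \<psi>: "\<psi> \<in> component depth m ls" and m: "m \<ge> 1"
  shows "f_map m \<psi> \<in> dsh_polys m"
proof -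
  have prim: "primitive \<psi>" "primitive (proj_Y \<psi>)" using \<psi> by (auto simp: component_def ls_def)
  have "star_zero m l (list_eval (f_map m \<psi>))" if l: "l \<in> {1..m-1}" for l
    unfolding star_zero_def
  proof (intro allI impI)
    fix u v :: "'k list" assume len: "length u = l" "length v = m - l"
    \<comment> \<open>Lowering the exponent leaves no product of the entries as a factor, so entries
      equal to zero cause no loss.\<close>
    let ?e = "\<lambda>a n. a ^ (n - 1)"
    have "(\<Sum>c\<leftarrow>shuffle_list u v. list_eval (f_map m \<psi>) c) =
        (\<Sum>c\<leftarrow>shuffle_list u v. lin_form (letterwise ?e c) (proj_Y \<psi>))"
    proof (rule sum_list_map_cong)
      fix c assume "c \<in> set (shuffle_list u v)"
      then have "length c = m" using length_shuffle_list len l by fastforce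
      then show "list_eval (f_map m \<psi>) c = lin_form (letterwise ?e c) (proj_Y \<psi>)"
        using lin_form_proj_Y[OF \<psi>, of ?e "\<lambda>_. 1"] by (simp add: map_replicate_const)
    qed
    also have "\<dots> = 0" using len l by (intro sum_shuffle_list_primitive prim) auto
    finally show "(\<Sum>c\<leftarrow>shuffle_list u v. list_eval (f_map m \<psi>) c) = 0" .
  qed
  moreover have "star_zero m l (\<lambda>c. list_eval (f_map m \<psi>) (tail_sums c))" if l: "l \<in> {1..m-1}" for l
    unfolding star_zero_def
  proof (intro allI impI)
    fix u v :: "'k list" assume len: "length u = l" "length v = m - l"
    have "(\<Sum>c\<leftarrow>shuffle_list u v. list_eval (f_map m \<psi>) (tail_sums c)) =
        (\<Sum>c\<leftarrow>shuffle_list u v. lin_form (block_value (tail_sums c)) \<psi>)"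
    proof (rule sum_list_map_cong)
      fix c assume "c \<in> set (shuffle_list u v)"
      then have "length c = m" using length_shuffle_list len l by fastforce
      then show "list_eval (f_map m \<psi>) (tail_sums c) = lin_form (block_value (tail_sums c)) \<psi>"
        by (intro list_eval_f_map_last[OF \<psi>]) auto
    qed
    also have "\<dots> = (\<Sum>c\<leftarrow>path_sums (tail_sums u) (tail_sums v). lin_form (block_value c) \<psi>)"
      by (simp add: path_sums_tail_sums o_def)
    also have "\<dots> = block_value (tail_sums u) [] * lin_form (block_value (tail_sums v)) \<psi> +
        lin_form (block_value (tail_sums u)) \<psi> * block_value (tail_sums v) []"
      by (rule block_value_primitive[OF prim(1)])
    \<comment> \<open>Both \<open>u\<close> and \<open>v\<close> are nonempty, so their tail sums
      have at least two entries and vanish on the empty word.\<close>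
    also have "\<dots> = 0"
    proof -
      have "block_value (tail_sums u) [] = 0" "block_value (tail_sums v) [] = 0"
        using len l by (auto intro!: block_value_eq_0 simp: depth_def)
      then show ?thesis by simp
    qed
    finally show "(\<Sum>c\<leftarrow>shuffle_list u v. list_eval (f_map m \<psi>) (tail_sums c)) = 0" .
  qed
  ultimately show ?thesis using f_map_in_polys[OF \<psi>] by (simp add: dsh_polys_def)
qed

lemma block_value_depth_eq_0:
  assumes "\<psi> \<in> component depth m S" "length t \<noteq> Suc m"
  shows "lin_form (block_value t) \<psi> = 0"
proof -
  have "lin_form (block_value t) \<psi> = lin_form (\<lambda>_. 0) \<psi>"
    by (rule lin_form_cong) (use assms in \<open>auto simp: component_def block_value_eq_0\<close>)
  then show ?thesis by simp
qed

text \<open>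
  Shuffling with a power of \<open>x\<close> translates all arguments of the generating series, so that the
  values on words ending in \<open>x\<close> are determined by those on words ending in \<open>z\<close>.
\<close>

lemma block_value_ls:
  fixes \<psi> :: "'k::field_char_0 xz_algebra"
  assumes \<psi>: "\<psi> \<in> component depth m ls" and m: "m \<ge> 1" and t: "length t = Suc m"
  shows "lin_form (block_value t) \<psi> = list_eval (f_map m \<psi>) (map (\<lambda>b. b - last t) t)"
proof -
  have prim: "primitive \<psi>" using \<psi> by (auto simp: component_def ls_def)
  have ne: "t \<noteq> []" using t by auto
  \<comment> \<open>A series in words without z has a single argument; with \<open>- last t\<close>
    the only lattice path is the translate of \<open>t\<close> that ends in 0.\<close>
  have "(\<Sum>c\<leftarrow>path_sums t [- last t]. lin_form (block_value c) \<psi>) =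
      block_value t [] * lin_form (block_value [- last t]) \<psi> +
      lin_form (block_value t) \<psi> * block_value [- last t] []"
    by (rule block_value_primitive[OF prim])
  moreover have "block_value t [] = 0" using t m by (intro block_value_eq_0) (simp add: depth_def)
  ultimately have "lin_form (block_value t) \<psi> = lin_form (block_value (map (\<lambda>b. b - last t) t)) \<psi>"
    using ne by (simp add: path_sums_singleton)
  also have "\<dots> = list_eval (f_map m \<psi>) (map (\<lambda>b. b - last t) t)"
    using list_eval_f_map_last[OF \<psi>, of "map (\<lambda>b. b - last t) t"] t ne by (simp add: last_map)
  finally show ?thesis .
qed

text \<open>By \<open>block_value_ls\<close> every test value of an element of \<open>ls\<close> is
  determined by its image.\<close>

lemma inj_on_f_map:
  assumes "m \<ge> 1"
  shows "inj_on (f_map m) (component depth m (ls :: 'k::field_char_0 xz_algebra set))"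
proof (rule inj_onI)
  fix \<psi> \<psi>' :: "'k xz_algebra"
  assume *: "\<psi> \<in> component depth m ls" "\<psi>' \<in> component depth m ls" "f_map m \<psi> = f_map m \<psi>'"
  have "lin_form (block_value t) (\<psi> - \<psi>') = 0" for t
    using block_value_ls[OF *(1) assms, of t] block_value_ls[OF *(2) assms, of t]
      block_value_depth_eq_0[OF *(1), of t] block_value_depth_eq_0[OF *(2), of t] *(3)
    by (cases "length t = Suc m") auto
  then have "\<psi> - \<psi>' = 0" by (intro block_values_separated) simp
  then show "\<psi> = \<psi>'" by simp
qed

text \<open>The inverse of \<open>f_map\<close> on \<open>ls\<close>, forced by
  \<open>block_value_ls\<close>; the variable numbered m+1 records the trailing power of x.\<close>

definition ls_of_poly :: "nat \<Rightarrow> 'k::field mpoly \<Rightarrow> 'k xz_algebra" where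
  "ls_of_poly m p = lin_ext (\<lambda>t. single (block_word (map (lookup t) [1..<m+1]) (lookup t (m+1))) 1)
     (poly_subst (\<lambda>i. var i - var (m+1)) p)"

context
  fixes m :: nat and p :: "'k::field_char_0 mpoly"
  assumes p: "p \<in> polys m"
begin

lemma keys_ls_of_poly_subst:
  assumes "t \<in> keys (poly_subst (\<lambda>i. var i - var (m+1)) p)"
  shows "keys t \<subseteq> {1..m+1}"
proof (rule keys_poly_subst[OF _ _ assms])
  show "keys s \<subseteq> {1..m}" if "s \<in> keys p" for s using p that by (auto simp: polys_def)
  fix i t assume "i \<in> {1..m}" "t \<in> keys (var i - var (m+1) :: 'k mpoly)"
  moreover have "keys (var i - var (m+1) :: 'k mpoly) \<subseteq> {single i 1, single (m+1) 1}"
    using keys_diff[of "var i" "var (m+1) :: 'k mpoly"] by (auto simp: var_def)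
  ultimately have "i \<in> {1..m}" "t = single i 1 \<or> t = single (m+1) 1" by auto
  then show "keys t \<subseteq> {1..m+1}" by auto
qed

lemma keys_ls_of_polyE:
  assumes "w \<in> keys (ls_of_poly m p)"
  obtains t where "t \<in> keys (poly_subst (\<lambda>i. var i - var (m+1)) p)"
    "w = block_word (map (lookup t) [1..<m+1]) (lookup t (m+1))"
  using assms keys_lin_ext unfolding ls_of_poly_def by (fastforce split: if_splits)

lemma depth_ls_of_poly: "ls_of_poly m p \<in> component depth m UNIV"
  by (auto simp: component_def depth_block_word elim: keys_ls_of_polyE)

lemma block_value_ls_of_poly:
  assumes t: "length t = Suc m"
  shows "lin_form (block_value t) (ls_of_poly m p) = list_eval p (map (\<lambda>b. b - last t) t)"
proof -
  let ?q = "poly_subst (\<lambda>i. var i - var (m+1)) p"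
  have "lin_form (block_value t) (ls_of_poly m p) =
      lin_form (\<lambda>s. letterwise (^) t (map (lookup s) [1..<m+1] @ [lookup s (m+1)])) ?q"
    by (simp add: ls_of_poly_def block_value_block_word)
  also have "\<dots> = lin_form (\<lambda>s. \<Prod>i\<in>keys s. t ! (i - 1) ^ lookup s i) ?q"
  proof (rule lin_form_cong)
    fix s assume s: "s \<in> keys ?q"
    have "map (lookup s) [1..<m+1] @ [lookup s (m+1)] = map (lookup s) [1..<m+2]"
      by (simp add: upt_Suc_append)
    moreover have "letterwise (^) t (map (lookup s) [1..<m+2]) =
        (\<Prod>i=1..m+1. t ! (i - 1) ^ lookup s i)"
    proof -
      have "letterwise (^) t (map (lookup s) [1..<m+2]) = (\<Prod>i<m+1. t ! i ^ lookup s (Suc i))"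
        using t by (simp add: letterwise_eq_prod)
      also have "\<dots> = (\<Prod>i=1..m+1. t ! (i - 1) ^ lookup s i)"
        by (rule prod.reindex_bij_witness[of _ "\<lambda>i. i - 1" Suc]) auto
      finally show ?thesis .
    qed
    ultimately show "letterwise (^) t (map (lookup s) [1..<m+1] @ [lookup s (m+1)]) =
        (\<Prod>i\<in>keys s. t ! (i - 1) ^ lookup s i)"
      using monomial_value_superset[OF _ keys_ls_of_poly_subst[OF s], of "\<lambda>i. t ! (i - 1)"]
      by (simp only: finite_atLeastAtMost)
  qed
  also have "\<dots> = eval (\<lambda>i. t ! (i - 1)) ?q" by (simp add: eval_def)
  also have "\<dots> = eval (\<lambda>i. t ! (i - 1) - t ! m) p" by (simp add: eval_poly_subst)
  also have "\<dots> = list_eval p (map (\<lambda>b. b - last t) t)"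
  proof (rule eval_eq_list_eval[OF p])
    have "last t = t ! m" by (subst last_conv_nth) (use t in auto)
    then show "t ! (i - 1) - t ! m = map (\<lambda>b. b - last t) t ! (i - 1)" if "i \<in> {1..m}" for i
      using t that by auto
  qed
  finally show ?thesis .
qed

lemma f_map_ls_of_poly: "f_map m (ls_of_poly m p) = p"
proof (rule list_eval_eqI[OF f_map_in_polys[OF depth_ls_of_poly] p])
  fix c :: "'k list" assume c: "length c = m"
  have "list_eval (f_map m (ls_of_poly m p)) c = list_eval p (map (\<lambda>b. b - 0) (c @ [0]))"
    using list_eval_f_map[OF depth_ls_of_poly c] block_value_ls_of_poly[of "c @ [0]"] c by simp
  also have "\<dots> = list_eval p c" using c by (intro list_eval_cong[OF p]) (auto simp: nth_append)
  finally show "list_eval (f_map m (ls_of_poly m p)) c = list_eval p c" .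
qed

text \<open>The substitution preserves the degree, and a word has m letters z in addition to the
  total of its exponents.\<close>

lemma length_ls_of_poly:
  assumes "\<And>t. t \<in> keys p \<Longrightarrow> poly_weight m t = k" "w \<in> keys (ls_of_poly m p)"
  shows "length w = k"
proof -
  obtain t where t: "t \<in> keys (poly_subst (\<lambda>i. var i - var (m+1)) p)"
    "w = block_word (map (lookup t) [1..<m+1]) (lookup t (m+1))"
        using keys_ls_of_polyE[OF assms(2)] .
  have "homogeneous (k - m) p"
    unfolding homogeneous_def using assms(1) by (force simp: poly_weight_def)
  then have "homogeneous (k - m) (poly_subst (\<lambda>i. var i - var (m+1)) p)"
    by (intro homogeneous_poly_subst homogeneous_diff homogeneous_var)
  then have "poly_weight 0 t = k - m" using t(1) by (simp add: homogeneous_def)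
  moreover have "poly_weight 0 t = (\<Sum>i=1..m+1. lookup t i)"
    using poly_weight_superset[OF _ keys_ls_of_poly_subst[OF t(1)], of 0] by simp
  moreover have "\<dots> = (\<Sum>i\<leftarrow>[1..<m+1]. lookup t i) + lookup t (m+1)"
    by (simp add: interv_sum_list_conv_sum_set_nat atLeastLessThanSuc_atLeastAtMost)
  \<comment> \<open>Rules out truncation in \<open>k - m\<close>: a word in the image forces
    \<open>p\<close> to have a monomial, whose weight is at least m.\<close>
  moreover have "k \<ge> m"
  proof -
    have "p \<noteq> 0" using t(1) by (auto simp: poly_subst_def lin_ext_def)
    then obtain s where "s \<in> keys p" by (metis keys_eq_empty ex_in_conv)
    then show ?thesis using assms(1)[of s] by (simp add: poly_weight_def)
  qed
  ultimately show ?thesis using t(2) by (simp add: length_block_word)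
qed

end

text \<open>Only test lists with m + 2 entries in total see words of depth m. If one of them has a
  single entry, the equation is translation invariance, built into \<open>ls_of_poly\<close>;
  otherwise it is an equation of \<open>T_sh\<close>.\<close>

lemma ls_of_poly_in_ls:
  fixes p :: "'k::field_char_0 mpoly"
  assumes p: "p \<in> dsh_polys m" and m: "m \<ge> 2"
  shows "ls_of_poly m p \<in> component depth m ls"
proof -
  have p': "p \<in> polys m" using p by (simp add: dsh_polys_def)
  let ?\<psi> = "ls_of_poly m p"
  note depth = depth_ls_of_poly[OF p'] and val = block_value_ls_of_poly[OF p']
  have "primitive ?\<psi>"
  proof (rule primitiveI_block_value)
    fix t s :: "'k list" assume ne: "t \<noteq> []" "s \<noteq> []"
    \<comment> \<open>The test value at a list depends only on its translate ending in 0, and this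
      normalisation is compatible with path sums.\<close>
    define N where "N a = map (\<lambda>b. b - last a) a" for a :: "'k list"
    show "(\<Sum>c\<leftarrow>path_sums t s. lin_form (block_value c) ?\<psi>) =
        block_value t [] * lin_form (block_value s) ?\<psi> +
            lin_form (block_value t) ?\<psi> * block_value s []"
    proof (cases "length t + length s = m + 2")
      case False
      have "(\<Sum>c\<leftarrow>path_sums t s. lin_form (block_value c) ?\<psi>) = (\<Sum>c\<leftarrow>path_sums t s. 0)"
      proof (rule sum_list_map_cong)
        fix c assume "c \<in> set (path_sums t s)"
        then show "lin_form (block_value c) ?\<psi> = 0"
          using path_sums_last_length False by (intro block_value_depth_eq_0[OF depth]) fastforce
      qed
      moreover have "block_value t [] * lin_form (block_value s) ?\<psi> = 0"
        using False block_value_depth_eq_0[OF depth, of s] block_value_eq_0[of t "[]"]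
        by (cases "length t = 1") (auto simp: depth_def)
      moreover have "lin_form (block_value t) ?\<psi> * block_value s [] = 0"
        using False block_value_depth_eq_0[OF depth, of t] block_value_eq_0[of s "[]"]
        by (cases "length s = 1") (auto simp: depth_def)
      ultimately show ?thesis by (simp only: sum_list_0 add_0_left)
    next
      case True
      have "(\<Sum>c\<leftarrow>path_sums t s. lin_form (block_value c) ?\<psi>) =
          (\<Sum>c\<leftarrow>path_sums t s. list_eval p (map (\<lambda>b. b - (last t + last s)) c))"
      proof (rule sum_list_map_cong)
        fix c assume "c \<in> set (path_sums t s)"
        then have "length c = Suc m" "last c = last t + last s"
          using path_sums_last_length True by fastforce+
        then show "lin_form (block_value c) ?\<psi> = list_eval p (map (\<lambda>b. b - (last t + last s)) c)"
          using val by simp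
      qed
      also have "\<dots> = (\<Sum>c\<leftarrow>path_sums (N t) (N s). list_eval p c)"
        by (simp add: N_def path_sums_diff o_def)
      finally have eq: "(\<Sum>c\<leftarrow>path_sums t s. lin_form (block_value c) ?\<psi>) = \<dots>" .
      consider "length t = 1" | "length s = 1" | "length t \<ge> 2" "length s \<ge> 2"
        using ne by (metis One_nat_def Suc_leI length_greater_0_conv le_neq_implies_less one_add_one
            plus_1_eq_Suc)
      then show ?thesis
      proof cases
        case 1
        then obtain a where a: "t = [a]" by (auto simp: length_Suc_conv)
        then have "length s = Suc m" using True by simp
        then show ?thesis
          using eq val[of s] ne m block_value_depth_eq_0[OF depth, of t] a
          by (simp add: N_def o_def path_sums_singleton block_value_eq_0)
      next
        case 2
        then obtain a where a: "s = [a]" by (auto simp: length_Suc_conv)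
        then have "length t = Suc m" using True by simp
        then show ?thesis
          using eq val[of t] ne m block_value_depth_eq_0[OF depth, of s] a
          by (simp add: N_def path_sums_singleton block_value_eq_0)
      next
        case 3
        \<comment> \<open>Lists ending in 0 are tail sums, so the lattice paths become
          shuffles.\<close>
        obtain u where u: "N t = tail_sums u"
          using ex_tail_sums[of "N t"] ne by (auto simp: N_def last_map)
        obtain v where v: "N s = tail_sums v"
          using ex_tail_sums[of "N s"] ne by (auto simp: N_def last_map)
        have "length t = Suc (length u)" "length s = Suc (length v)"
          using u v by (metis N_def length_map length_tail_sums)+
        then have len: "length u \<in> {1..m-1}" "length v = m - length u" using True 3 by auto
        then have "star_zero m (length u) (\<lambda>c. list_eval p (tail_sums c))"
          using p by (simp add: dsh_polys_def)
        then have "(\<Sum>c\<leftarrow>path_sums (N t) (N s). list_eval p c) = 0"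
          using len unfolding u v path_sums_tail_sums star_zero_def by (simp add: o_def)
        then show ?thesis using eq 3 by (simp add: block_value_eq_0 depth_def)
      qed
    qed
  qed
  moreover have "primitive (proj_Y ?\<psi>)"
  proof (rule primitiveI_letterwise)
    have len: "length y = m" if y: "y \<in> keys (proj_Y ?\<psi>)" for y
    proof -
      obtain w where w: "w \<in> keys ?\<psi>" and "y \<in> keys ((case exponents w of (ns, k) \<Rightarrow>
          if k = 0 then single (map Suc ns) 1 else 0) :: nat list \<Rightarrow>\<^sub>0 'k)"
        using y keys_lin_ext unfolding proj_Y_def by fast
      then have "length y = length (fst (exponents w))" by (auto split: prod.splits if_splits)
      then show ?thesis using depth w by (simp add: length_exponents component_def)
    qed
    show "lookup (proj_Y ?\<psi>) [] = 0" using len[of "[]"] m by (auto simp: in_keys_iff)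
    fix u v :: "'k list" assume ne: "u \<noteq> []" "v \<noteq> []"
    show "(\<Sum>c\<leftarrow>shuffle_list u v. lin_form (letterwise (^) c) (proj_Y ?\<psi>)) = 0"
    proof (cases "length u + length v = m")
      case True
      \<comment> \<open>The plain power brings in the product of all entries, which is the same for
        every shuffle and can be pulled out.\<close>
      have "(\<Sum>c\<leftarrow>shuffle_list u v. lin_form (letterwise (^) c) (proj_Y ?\<psi>)) =
          (\<Sum>c\<leftarrow>shuffle_list u v. (prod_list u * prod_list v) * list_eval p c)"
      proof (rule sum_list_map_cong)
        fix c assume c: "c \<in> set (shuffle_list u v)"
        then have "length c = m" using length_shuffle_list True by fastforce
        then show "lin_form (letterwise (^) c) (proj_Y ?\<psi>) =
            (prod_list u * prod_list v) * list_eval p c"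
          using lin_form_proj_Y[OF depth, of "(^)" "\<lambda>a. a" c] prod_list_shuffle_list[OF c]
          by (simp add: f_map_ls_of_poly[OF p'])
      qed
      also have "\<dots> = (prod_list u * prod_list v) * (\<Sum>c\<leftarrow>shuffle_list u v. list_eval p c)"
        by (rule sum_list_const_mult)
      also have "(\<Sum>c\<leftarrow>shuffle_list u v. list_eval p c) = 0"
      proof -
        have "length u \<in> {1..m-1}" "length v = m - length u"
            using True ne by (cases u; cases v; auto)+
        then show ?thesis using p by (simp add: dsh_polys_def star_zero_def)
      qed
      finally show ?thesis by simp
    next
      case False
      have "lin_form (letterwise (^) c) (proj_Y ?\<psi>) = 0" if "c \<in> set (shuffle_list u v)" for c
      proof -
        have "lin_form (letterwise (^) c) (proj_Y ?\<psi>) = lin_form (\<lambda>_. 0) (proj_Y ?\<psi>)"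
          using len length_shuffle_list[OF that] False
              by (intro lin_form_cong letterwise_length) auto
        then show ?thesis by simp
      qed
      then show ?thesis by (simp cong: map_cong)
    qed
  qed
  \<comment> \<open>All words have depth m >= 2, which settles the conditions of \<open>ls\<close>
    in depths zero and one.\<close>
  ultimately show ?thesis using depth m by (auto simp: component_def ls_def)
qed

theorem graded_iso_f_map:
  assumes m: "m \<ge> 2"
  shows "graded_iso (ls_depth m :: ('k::field_char_0, 'k xz_algebra) gspace) (Dsh m) (f_map m)"
proof -
  have m1: "m \<ge> 1" using m by simp
  have into: "f_map m ` component depth m ls \<subseteq> (dsh_polys m :: 'k mpoly set)"
    using f_map_in_dsh_polys m1 by blast
  have onto: "p \<in> f_map m ` component depth m ls" if "p \<in> dsh_polys m" for p :: "'k mpoly"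
    using f_map_ls_of_poly[of p m] ls_of_poly_in_ls[OF that m] that
    by (metis (no_types, lifting) dsh_polys_def image_eqI mem_Collect_eq)
  have "f_map m ` component length k (component depth m ls) =
      component (poly_weight m) k (dsh_polys m :: 'k mpoly set)" for k
  proof (intro equalityI subsetI)
    fix p :: "'k mpoly" assume "p \<in> f_map m ` component length k (component depth m ls)"
    then obtain \<psi> where \<psi>: "\<psi> \<in> component depth m ls" "\<forall>w\<in>keys \<psi>. length w = k" "p = f_map m \<psi>"
      by (auto simp: component_def)
    have "poly_weight m t = k" if "t \<in> keys p" for t
      using keys_f_map[OF \<psi>(1)] that \<psi>(2,3)
          by (metis poly_weight_exponent length_block_word add.right_neutral)
    then show "p \<in> component (poly_weight m) k (dsh_polys m)"
      using into \<psi> by (auto simp: component_def)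
  next
    fix p :: "'k mpoly" assume "p \<in> component (poly_weight m) k (dsh_polys m)"
    then have p: "p \<in> dsh_polys m" "\<And>t. t \<in> keys p \<Longrightarrow>
        poly_weight m t = k" by (auto simp: component_def)
    then have p': "p \<in> polys m" by (simp add: dsh_polys_def)
    have "ls_of_poly m p \<in> component length k (component depth m ls)"
      using ls_of_poly_in_ls[OF p(1) m] length_ls_of_poly[OF p' p(2)] by (auto simp: component_def)
    then show "p \<in> f_map m ` component length k (component depth m ls)"
      using f_map_ls_of_poly[OF p'] by (metis image_eqI)
  qed
  moreover have "bij_betw (f_map m) (component depth m ls) (dsh_polys m :: 'k mpoly set)"
    using inj_on_f_map[OF m1] into onto by (auto simp: bij_betw_def)
  ultimately show ?thesis
    by (simp add: graded_iso_def ls_depth_def Dsh_eq subspace_graded_def f_map_def lin_ext_add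
        lin_ext_pscale)
qed

section \<open>Graded subspaces\<close>

definition restrict_keys :: "('a \<Rightarrow> bool) \<Rightarrow> ('a \<Rightarrow>\<^sub>0 'k::field) \<Rightarrow> ('a \<Rightarrow>\<^sub>0 'k)" where
  "restrict_keys P = lin_ext (\<lambda>a. if P a then single a 1 else 0)"

lemma lookup_restrict_keys [simp]: "lookup (restrict_keys P v) a = (if P a then lookup v a else 0)"
proof -
  have "lookup (restrict_keys P v) a =
      lin_form (\<lambda>b. (if P a then 1 else 0) * (if b = a then 1 else 0)) v"
    unfolding restrict_keys_def lookup_lin_ext
    by (rule lin_form_cong) (auto simp: lookup_single)
  then show ?thesis by (simp only: lin_form_mult_coeff flip: lookup_eq_lin_form) simp
qed

lemma keys_restrict_keys: "keys (restrict_keys P v) = {a \<in> keys v. P a}"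
  by (auto simp: in_keys_iff split: if_splits)

lemma restrict_keys_add: "restrict_keys P (v + w) = restrict_keys P v + restrict_keys P w"
  by (simp add: restrict_keys_def lin_ext_add)

lemma restrict_keys_pscale: "restrict_keys P (pscale c v) = pscale c (restrict_keys P v)"
  by (simp add: restrict_keys_def lin_ext_pscale)

text \<open>A generator concentrated in one degree is either kept or killed by the
  projection.\<close>

lemma restrict_keys_in_span:
  assumes hom: "\<And>g. g \<in> G \<Longrightarrow> \<exists>n. \<forall>a\<in>keys g. d a = n"
    and v: "v \<in> free_vs.span G"
  shows "restrict_keys (\<lambda>a. d a = k) v \<in> free_vs.span G"
  using v
proof (induction rule: free_vs.span_induct_alt)
  case base
  show ?case by (simp add: restrict_keys_def lin_ext_def free_vs.span_zero)
next
  case (step c g v)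
  have "restrict_keys (\<lambda>a. d a = k) g = g \<or> restrict_keys (\<lambda>a. d a = k) g = 0"
  proof -
    obtain n where n: "\<forall>a\<in>keys g. d a = n" using hom step by blast
    then have *: "lookup g a = 0" if "d a \<noteq> n" for a using that by (auto simp: in_keys_iff)
    show ?thesis
    proof (cases "n = k")
      case True
      then show ?thesis using * by (intro disjI1 poly_mapping_eqI) simp
    next
      case False
      then show ?thesis using * by (intro disjI2 poly_mapping_eqI) auto
    qed
  qed
  then have "restrict_keys (\<lambda>a. d a = k) g \<in> free_vs.span G"
    using step by (auto intro: free_vs.span_base free_vs.span_zero)
  then show ?case
    unfolding restrict_keys_add restrict_keys_pscale using step
    by (intro free_vs.span_add free_vs.span_scale)
qed

lemma sum_restrict_keys:
  assumes "finite K" "d ` keys v \<subseteq> K"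
  shows "(\<Sum>k\<in>K. restrict_keys (\<lambda>a. d a = k) v) = v"
proof (rule poly_mapping_eqI)
  fix a
  show "lookup (\<Sum>k\<in>K. restrict_keys (\<lambda>a. d a = k) v) a = lookup v a"
    using assms by (cases "a \<in> keys v") (auto simp: lookup_sum sum.delta in_keys_iff)
qed

lemma subspace_keys: "free_vs.subspace {v. keys v \<subseteq> K}"
proof (rule free_vs.subspaceI)
  show "u + v \<in> {v. keys v \<subseteq> K}" if "u \<in> {v. keys v \<subseteq> K}" "v \<in> {v. keys v \<subseteq> K}" for u v
    using that keys_add[of u v] by auto
  show "pscale c v \<in> {v. keys v \<subseteq> K}" if "v \<in> {v. keys v \<subseteq> K}" for c v
    using that keys_pscale[of c v] by auto
qed simp

lemma component_subspace:
  assumes "free_vs.subspace S"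
  shows "free_vs.subspace (component d n S)"
proof (rule free_vs.subspaceI)
  show "u + v \<in> component d n S" if "u \<in> component d n S" "v \<in> component d n S" for u v
    using that keys_add[of u v] assms by (auto simp: component_def free_vs.subspace_add)
  show "pscale c v \<in> component d n S" if "v \<in> component d n S" for c v
    using that keys_pscale[of c v] assms by (auto simp: component_def free_vs.subspace_scale)
qed (use assms in \<open>simp add: component_def free_vs.subspace_0\<close>)

definition graded_subspace :: "('a \<Rightarrow> nat) \<Rightarrow> ('a \<Rightarrow>\<^sub>0 'k::field) set \<Rightarrow> bool" where
  "graded_subspace d S \<longleftrightarrow> free_vs.subspace S \<and> (\<forall>k. \<forall>v\<in>S. restrict_keys (\<lambda>a. d a = k) v \<in> S)"

section \<open>Extension of linear forms and separation from subspaces\<close>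

lemma ex_linear_form:
  fixes f :: "('a \<Rightarrow>\<^sub>0 'k::field) \<Rightarrow> 'k"
  assumes "free_vs.independent B"
  obtains \<beta> where "\<And>u v. \<beta> (u + v) = \<beta> u + \<beta> v" "\<And>c v. \<beta> (pscale c v) = c * \<beta> v"
    "\<And>v. v \<in> B \<Longrightarrow> \<beta> v = f v"
proof -
  interpret vector_space_pair "pscale :: 'k \<Rightarrow> ('a \<Rightarrow>\<^sub>0 'k) \<Rightarrow> _" "(*) :: 'k \<Rightarrow> 'k \<Rightarrow> 'k"
    by unfold_locales (auto simp: algebra_simps)
  obtain \<beta> where \<beta>: "Vector_Spaces.linear pscale (*) \<beta>" "\<forall>v\<in>B. \<beta> v = f v"
    using linear_independent_extend[OF assms] by blast
  interpret \<beta>: Vector_Spaces.linear pscale "(*)" \<beta> by (rule \<beta>(1))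
  show ?thesis using that[of \<beta>] \<beta>.add \<beta>.scale \<beta>(2) by blast
qed

lemma extend_linear_form:
  fixes \<alpha> :: "('a \<Rightarrow>\<^sub>0 'k::field) \<Rightarrow> 'k"
  assumes S: "free_vs.subspace S"
    and add: "\<And>u v. u \<in> S \<Longrightarrow> v \<in> S \<Longrightarrow> \<alpha> (u + v) = \<alpha> u + \<alpha> v"
    and scale: "\<And>c v. v \<in> S \<Longrightarrow> \<alpha> (pscale c v) = c * \<alpha> v"
  obtains \<beta> where "\<And>u v. \<beta> (u + v) = \<beta> u + \<beta> v" "\<And>c v. \<beta> (pscale c v) = c * \<beta> v"
    "\<And>v. v \<in> S \<Longrightarrow> \<beta> v = \<alpha> v"
proof -
  obtain B where B: "B \<subseteq> S" "free_vs.independent B" "S \<subseteq> free_vs.span B"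
    by (rule free_vs.maximal_independent_subset)
  obtain \<beta> where \<beta>: "\<And>u v. \<beta> (u + v) = \<beta> u + \<beta> v" "\<And>c v. \<beta> (pscale c v) = c * \<beta> v"
    "\<And>v. v \<in> B \<Longrightarrow> \<beta> v = \<alpha> v"
    by (rule ex_linear_form[OF B(2), of \<alpha>]) (rule that)
  have zero: "\<alpha> 0 = 0" "\<beta> 0 = 0"
      using scale[of 0 0] free_vs.subspace_0[OF S] \<beta>(2)[of 0 0] by simp_all
  have "v \<in> S \<and> \<beta> v = \<alpha> v" if "v \<in> free_vs.span B" for v
    using that
  proof (induction rule: free_vs.span_induct_alt)
    case (step c b v)
    then show ?case
      using B(1) S
      by (auto simp: \<beta> add scale subset_iff free_vs.subspace_add free_vs.subspace_scale)
  qed (simp add: zero free_vs.subspace_0[OF S])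
  then have "\<beta> v = \<alpha> v" if "v \<in> S" for v using that B(3) by blast
  then show ?thesis by (rule that[OF \<beta>(1,2)])
qed

text \<open>Adjoin \<open>v\<close> to a basis of \<open>S\<close> and prescribe 0 on that basis and
  1 at \<open>v\<close>.\<close>

lemma separating_form:
  fixes v :: "'a \<Rightarrow>\<^sub>0 'k::field"
  assumes S: "free_vs.subspace S" and v: "v \<notin> S"
  obtains \<beta> where "\<And>u v. \<beta> (u + v) = \<beta> u + \<beta> v" "\<And>c v. \<beta> (pscale c v) = c * \<beta> v"
    "\<And>u. u \<in> S \<Longrightarrow> \<beta> u = 0" "\<beta> v = (1 :: 'k)"
proof -
  obtain B where B: "B \<subseteq> S" "free_vs.independent B" "S \<subseteq> free_vs.span B"
    by (rule free_vs.maximal_independent_subset)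
  have "free_vs.span B \<subseteq> S" using B(1) S by (rule free_vs.span_minimal)
  then have "v \<notin> free_vs.span B" using v by blast
  then have "free_vs.independent (insert v B)" using B(2) by (rule free_vs.independent_insertI)
  then obtain \<beta> where \<beta>: "\<And>u v. \<beta> (u + v) = \<beta> u + \<beta> v" "\<And>c v. \<beta> (pscale c v) = c * \<beta> v"
    "\<And>u. u \<in> insert v B \<Longrightarrow> \<beta> u = (if u = v then 1 else 0)"
    by (rule ex_linear_form[where f = "\<lambda>u. if u = v then 1 else 0"]) (rule that)
  have "\<beta> u = 0" if "u \<in> free_vs.span B" for u
    using that
  proof (induction rule: free_vs.span_induct_alt)
    case base
    then show ?case using \<beta>(2)[of 0 0] by simp
  next
    case (step c b u)
    then have "\<beta> b = 0" using \<beta>(3)[of b] v B(1) by auto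
    then show ?case using step by (simp add: \<beta>(1,2))
  qed
  then have "\<beta> u = 0" if "u \<in> S" for u using that B(3) by blast
  moreover have "\<beta> v = 1" using \<beta>(3) by simp
  ultimately show ?thesis by (rule that[OF \<beta>(1,2)])
qed

section \<open>The pairing of symbols and polynomials\<close>

text \<open>The symbol dual to the monomial \<open>t\<close> under \<open>h_map\<close>: exponents
  are reversed and raised by one, matching the reversal in \<open>phi_symb\<close>.\<close>

definition sym_of :: "nat \<Rightarrow> (nat \<Rightarrow>\<^sub>0 nat) \<Rightarrow> symb" where
  "sym_of m t = SymI (map Suc (rev (map (lookup t) [1..<m+1])))"

definition monomials :: "nat \<Rightarrow> (nat \<Rightarrow>\<^sub>0 nat) set" where
  "monomials m = {t. keys t \<subseteq> {1..m}}"

lemma polys_iff: "p \<in> polys m \<longleftrightarrow> keys p \<subseteq> monomials m"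
  by (auto simp: polys_def monomials_def)

lemma inj_on_sym_of: "inj_on (sym_of m) (monomials m)"
proof (rule inj_onI)
  fix s t assume st: "s \<in> monomials m" "t \<in> monomials m" "sym_of m s = sym_of m t"
  have "map (lookup s) [1..<m+1] = map (lookup t) [1..<m+1]"
    using st(3) by (simp only: sym_of_def symb.inject inj_map_eq_map[OF inj_Suc] rev_is_rev_conv)
  then have "exponent (map (lookup s) [1..<m+1]) = exponent (map (lookup t) [1..<m+1])"
    by (rule arg_cong)
  moreover have "keys s \<subseteq> {1..m}" "keys t \<subseteq> {1..m}" using st(1,2) by (auto simp: monomials_def)
  ultimately show "s = t" by (simp only: exponent_lookup)
qed

lemma exponent_in_monomials: "length ns = m \<Longrightarrow> exponent ns \<in> monomials m"
  using keys_exponent by (auto simp: monomials_def)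

lemma map_lookup_exponent: "length ns = m \<Longrightarrow> map (lookup (exponent ns)) [1..<m+1] = ns"
  by (rule nth_equalityI) (auto simp: lookup_exponent)

lemma sym_of_exponent: "length ns = m \<Longrightarrow> sym_of m (exponent ns) = SymI (map Suc (rev ns))"
  by (simp only: sym_of_def map_lookup_exponent)

lemma monomials_eq: "monomials m = exponent ` {ns. length ns = m}"
proof
  show "monomials m \<subseteq> exponent ` {ns. length ns = m}"
  proof
    fix t assume "t \<in> monomials m"
    then have "t = exponent (map (lookup t) [1..<m+1])"
      by (intro exponent_lookup[symmetric]) (simp add: monomials_def)
    then show "t \<in> exponent ` {ns. length ns = m}" by (rule image_eqI) simp
  qed
qed (use exponent_in_monomials in blast)

lemma map_Suc_pred: "\<forall>n\<in>set ns. n \<ge> 1 \<Longrightarrow> map Suc (map (\<lambda>n. n - 1) ns) = ns"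
  by (induction ns) auto

lemma range_sym_of: "sym_of m ` monomials m = {SymI ns |ns. length ns = m \<and> (\<forall>n\<in>set ns. n \<ge> 1)}"
proof (intro equalityI subsetI)
  fix s assume "s \<in> {SymI ns |ns. length ns = m \<and> (\<forall>n\<in>set ns. n \<ge> 1)}"
  then obtain ns where ns: "s = SymI ns" "length ns = m" "\<forall>n\<in>set ns. n \<ge> 1" by blast
  let ?ks = "rev (map (\<lambda>n. n - 1) ns)"
  have "sym_of m (exponent ?ks) = s"
    using ns map_Suc_pred[OF ns(3)] by (subst sym_of_exponent) auto
  then show "s \<in> sym_of m ` monomials m"
    using exponent_in_monomials[of ?ks m] ns(2) by (metis image_eqI length_map length_rev)
qed (auto simp: sym_of_def)

lemma symb_weight_sym_of: "t \<in> monomials m \<Longrightarrow> symb_weight (sym_of m t) = poly_weight m t"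
proof -
  have "sum_list (map Suc ns) = sum_list ns + length ns" for ns by (induction ns) auto
  moreover assume "t \<in> monomials m"
  ultimately show ?thesis
    by (auto simp: monomials_eq sym_of_exponent poly_weight_exponent rev_map[symmetric])
qed

lemma symb_depth_sym_of [simp]: "symb_depth (sym_of m t) = m"
  by (simp add: sym_of_def)

text \<open>The finite-dimensionality of the weight components, on which the double annihilator
  argument rests.\<close>

lemma finite_monomials_weight: "finite {t \<in> monomials m. poly_weight m t = k}"
proof -
  have "{t \<in> monomials m. poly_weight m t = k} \<subseteq> exponent ` {ns. set ns \<subseteq> {..k} \<and> length ns = m}"
    unfolding monomials_eq by (auto simp: poly_weight_exponent dest!: member_le_sum_list)
  then show ?thesis
      by (rule finite_subset) (intro finite_imageI finite_lists_length_eq finite_atMost)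
qed

text \<open>The pairing in which \<open>sym_of m t\<close> is dual to the monomial \<open>t\<close>;
  all other symbols pair to zero. It serves \<open>h_map\<close>, the relations of
  \<open>W_R\<close> and the pairing of \<open>phi\<close> with \<open>ls\<close> alike.\<close>

definition sym_pairing :: "nat \<Rightarrow> (symb \<Rightarrow>\<^sub>0 'k) \<Rightarrow> 'k::field mpoly \<Rightarrow> 'k" where
  "sym_pairing m v = lin_form (\<lambda>t. lookup v (sym_of m t))"

lemma sym_pairing_add_left: "sym_pairing m (v + w) p = sym_pairing m v p + sym_pairing m w p"
  by (simp add: sym_pairing_def lookup_add lin_form_def distrib_left sum.distrib)

lemma sym_pairing_pscale_left: "sym_pairing m (pscale c v) p = c * sym_pairing m v p"
  by (simp add: sym_pairing_def lin_form_mult_coeff)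

lemma sym_pairing_zero_left: "sym_pairing m 0 p = 0"
  by (simp add: sym_pairing_def)

lemma sym_pairing_sum_left: "sym_pairing m (sum f A) p = (\<Sum>i\<in>A. sym_pairing m (f i) p)"
  by (induction A rule: infinite_finite_induct) (auto simp: sym_pairing_add_left
      sym_pairing_zero_left)

lemma sym_pairing_simps [simp]:
  "sym_pairing m v (p + q) = sym_pairing m v p + sym_pairing m v q"
  "sym_pairing m v (pscale c p) = c * sym_pairing m v p"
  by (simp_all add: sym_pairing_def)

text \<open>Weights of symbols and monomials correspond under \<open>sym_of\<close>, so the weight
  projections are adjoint.\<close>

lemma sym_pairing_restrict:
  assumes "p \<in> polys m"
  shows "sym_pairing m v (restrict_keys (\<lambda>t. poly_weight m t = k) p) =
    sym_pairing m (restrict_keys (\<lambda>s. symb_weight s = k) v) p"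
proof -
  have "sym_pairing m v (restrict_keys (\<lambda>t. poly_weight m t = k) p) =
      lin_form (\<lambda>t. if poly_weight m t = k then lookup v (sym_of m t) else 0) p"
    unfolding restrict_keys_def sym_pairing_def lin_form_lin_ext by (rule lin_form_cong) auto
  also have "\<dots> = sym_pairing m (restrict_keys (\<lambda>s. symb_weight s = k) v) p"
    unfolding sym_pairing_def
    by (rule lin_form_cong) (use assms in \<open>auto simp: polys_iff symb_weight_sym_of subset_iff\<close>)
  finally show ?thesis .
qed

section \<open>The defining relations of \<open>W\<^sub>R\<close>\<close>

text \<open>\<open>Sum_any\<close> has its intended value only for finitely many nonzero terms,
  hence the hypothesis.\<close>

lemma lookup_Sum_any_SymI:
  assumes "finite {ns. P ns \<and> c ns \<noteq> 0}"
  shows "lookup (\<Sum>ns. single (SymI ns) (c ns) when P ns) s =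
    (case s of SymI ns \<Rightarrow> c ns when P ns | SymI' _ \<Rightarrow> (0 :: 'k::field))"
proof -
  let ?A = "{ns. P ns \<and> c ns \<noteq> 0}"
  have "(\<Sum>ns. single (SymI ns) (c ns) when P ns) = (\<Sum>ns\<in>?A. single (SymI ns) (c ns))"
  proof -
    have "(\<Sum>ns. single (SymI ns) (c ns) when P ns) = (\<Sum>ns\<in>?A. single (SymI ns) (c ns) when P ns)"
      by (rule Sum_any.expand_superset[OF assms]) auto
    also have "\<dots> = (\<Sum>ns\<in>?A. single (SymI ns) (c ns))" by (rule sum.cong) auto
    finally show ?thesis .
  qed
  then show ?thesis
    using assms by (cases s) (auto simp: lookup_sum lookup_single when_def sum.delta)
qed

context
  fixes m :: nat and t :: "nat \<Rightarrow> 'k::field mpoly" and a :: "nat \<Rightarrow>\<^sub>0 nat"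
  assumes hom: "\<And>i. homogeneous 1 (t i)"
begin

text \<open>The product is homogeneous of degree \<open>sum_list ns - m\<close>, so the coefficient
  at \<open>a\<close> sees only lists \<open>ns\<close> of one weight.\<close>

lemma colon_series_weight:
  assumes "length ns = m" "\<forall>n\<in>set ns. n \<ge> 1"
    and "lookup (\<Prod>i=1..m. (t i - t (m + 1)) ^ (ns ! (i - 1) - 1)) a \<noteq> 0"
  shows "sum_list ns = poly_weight 0 a + m"
proof -
  have "homogeneous (\<Sum>i=1..m. 1 * (ns ! (i - 1) - 1)) (\<Prod>i=1..m. (t i - t (m +
      1)) ^ (ns ! (i - 1) - 1))"
    by (intro homogeneous_prod homogeneous_power homogeneous_diff hom)
  then have "poly_weight 0 a = (\<Sum>i=1..m. ns ! (i - 1) - 1)"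
    using assms(3) by (simp add: homogeneous_def in_keys_iff)
  also have "\<dots> = (\<Sum>i<m. ns ! i - 1)"
    by (rule sum.reindex_bij_witness[of _ Suc "\<lambda>i. i - 1"]) auto
  finally have "poly_weight 0 a + m = (\<Sum>i<m. (ns ! i - 1) + 1)" by (simp only: sum.distrib) simp
  also have "\<dots> = (\<Sum>i<m. ns ! i)"
  proof (rule sum.cong)
    fix i assume "i \<in> {..<m}"
    then have "ns ! i \<ge> 1" using assms(1,2) by simp
    then show "ns ! i - 1 + 1 = ns ! i" by simp
  qed simp
  finally show ?thesis using assms(1) by (simp add: sum_list_sum_nth atLeast0LessThan)
qed

lemma lookup_colon_series:
  "lookup (colon_series m t a) s = (case s of
     SymI ns \<Rightarrow> lookup (\<Prod>i=1..m. (t i - t (m + 1)) ^ (ns ! (i - 1) - 1)) a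
       when length ns = m \<and> (\<forall>n\<in>set ns. n \<ge> 1)
   | SymI' _ \<Rightarrow> 0)"
  unfolding colon_series_def
proof (rule lookup_Sum_any_SymI)
  have "{ns. (length ns = m \<and> (\<forall>n\<in>set ns. n \<ge> 1)) \<and>
      lookup (\<Prod>i=1..m. (t i - t (m + 1)) ^ (ns ! (i - 1) - 1)) a \<noteq> 0} \<subseteq>
      {ns. set ns \<subseteq> {..poly_weight 0 a + m} \<and> length ns = m}" (is "?A \<subseteq> _")
  proof
    fix ns assume "ns \<in> ?A"
    then have ns: "length ns = m" "\<forall>n\<in>set ns. n \<ge> 1"
      "lookup (\<Prod>i=1..m. (t i - t (m + 1)) ^ (ns ! (i - 1) - 1)) a \<noteq> 0" by blast+
    have "n \<le> poly_weight 0 a + m" if "n \<in> set ns" for n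
      using member_le_sum_list[OF that] colon_series_weight[OF ns] by simp
    then show "ns \<in> {ns. set ns \<subseteq> {..poly_weight 0 a + m} \<and> length ns = m}" using ns(1) by auto
  qed
  then show "finite {ns. (length ns = m \<and> (\<forall>n\<in>set ns. n \<ge> 1)) \<and>
      lookup (\<Prod>i=1..m. (t i - t (m + 1)) ^ (ns ! (i - 1) - 1)) a \<noteq> 0}"
    by (rule finite_subset) (intro finite_lists_length_eq finite_atMost)
qed

lemma keys_colon_series:
  assumes "s \<in> keys (colon_series m t a)"
  obtains ns where "s = SymI ns" "length ns = m" "\<forall>n\<in>set ns. n \<ge> 1" "sum_list ns =
      poly_weight 0 a + m"
  using assms colon_series_weight
  by (cases s) (auto simp: in_keys_iff lookup_colon_series when_def split: if_splits)

text \<open>Pairing a generating series with \<open>p\<close> substitutes the arguments of the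
  series into \<open>p\<close>; the index \<open>m + 1 - i\<close> is the reversal hidden in
  \<open>sym_of\<close>.\<close>

lemma sym_pairing_colon_series:
  assumes "p \<in> polys m"
  shows "sym_pairing m (colon_series m t a) p =
      lookup (poly_subst (\<lambda>i. t (m + 1 - i) - t (m + 1)) p) a"
  unfolding sym_pairing_def poly_subst_def lookup_lin_ext
proof (rule lin_form_cong)
  fix s assume "s \<in> keys p"
  then have "s \<in> monomials m" using assms by (auto simp: polys_iff)
  then obtain ks where ks: "s = exponent ks" "length ks = m" by (auto simp: monomials_eq)
  have "(\<Prod>i\<in>keys s. (t (m + 1 - i) - t (m + 1)) ^ lookup s i) =
      (\<Prod>i=1..m. (t (m + 1 - i) - t (m + 1)) ^ (ks ! (i - 1)))"
    using monomial_value_superset[OF _ keys_exponent, of ks "\<lambda>i. t (m + 1 - i) - t (m + 1)"]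
    by (simp add: ks lookup_exponent)
  also have "\<dots> = (\<Prod>i=1..m. (t i - t (m + 1)) ^ (map Suc (rev ks) ! (i - 1) - 1))"
  proof (rule prod.reindex_bij_witness[of _ "\<lambda>i. m + 1 - i" "\<lambda>i. m + 1 - i"])
    fix i assume "i \<in> {1..m}"
    then show "(t (m + 1 - i) - t (m + 1)) ^ (map Suc (rev ks) ! (m + 1 - i - 1) - 1) =
        (t (m + 1 - i) - t (m + 1)) ^ (ks ! (i - 1))"
      using ks(2) by (auto simp: rev_nth intro!: arg_cong[where f = "\<lambda>n. _ ^ (ks ! n)"])
  qed auto
  finally show "lookup (colon_series m t a) (sym_of m s) =
      lookup (\<Prod>i\<in>keys s. (t (m + 1 - i) - t (m + 1)) ^ lookup s i) a"
    using ks by (simp add: sym_of_exponent lookup_colon_series)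
qed

end

definition star_gen :: "nat \<Rightarrow> nat \<Rightarrow> (nat \<Rightarrow>\<^sub>0 nat) \<Rightarrow> (symb \<Rightarrow>\<^sub>0 'k::field)" where
  "star_gen p q a = (\<Sum>\<sigma>\<in>shuffle_perms p q. colon_series (p + q) (\<lambda>i. var (inv \<sigma> i)) a)"

definition sh_gen :: "nat \<Rightarrow> nat \<Rightarrow> (nat \<Rightarrow>\<^sub>0 nat) \<Rightarrow> (symb \<Rightarrow>\<^sub>0 'k::field)" where
  "sh_gen p q a = (\<Sum>\<sigma>\<in>shuffle_perms p q. comma_series (p + q) (\<lambda>i. var (inv \<sigma> i)) a)"

definition W_R_gens :: "(symb \<Rightarrow>\<^sub>0 'k::field) set" where
  "W_R_gens = {star_gen p q a |p q a. p \<ge> 1 \<and> q \<ge> 1} \<union> {sh_gen p q a |p q a. p \<ge> 1 \<and> q \<ge> 1} \<union>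
     {single (SymI [2 * n]) 1 |n. n \<ge> 1}"

lemma W_R_eq_span: "W_R = free_vs.span W_R_gens"
proof -
  have "W_R = {ab + c |ab c. ab \<in> {a + b |a b. a \<in> W_star \<and> b \<in> W_sh} \<and> c \<in> W_1_even}"
    unfolding W_R_def by blast
  then show ?thesis
    unfolding W_R_gens_def free_vs.span_Un W_star_def W_sh_def W_1_even_def star_gen_def sh_gen_def
    by auto
qed

lemma homogeneous_comma: "homogeneous 1 (if i \<le> m then \<Sum>j=1..i. var (\<sigma> j) else 0)"
  by (cases "i \<le> m") (simp_all only: if_True if_False homogeneous_zero homogeneous_sum
      homogeneous_var)

lemma keys_sum_seriesE:
  assumes "s \<in> keys (\<Sum>\<sigma>\<in>A. colon_series m (t \<sigma>) a)" "\<And>\<sigma> i. homogeneous 1 (t \<sigma> i)"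
  obtains ns where "s = SymI ns" "length ns = m" "\<forall>n\<in>set ns. n \<ge> 1" "sum_list ns =
      poly_weight 0 a + m"
proof -
  obtain \<sigma> where "s \<in> keys (colon_series m (t \<sigma>) a)" using assms(1) keys_sum by fast
  then show ?thesis using keys_colon_series[of "t \<sigma>"] assms(2) that by blast
qed

lemma keys_star_genE:
  assumes "s \<in> keys (star_gen p q a)"
  obtains ns where "s = SymI ns" "length ns = p + q" "\<forall>n\<in>set ns. n \<ge> 1" "sum_list ns =
      poly_weight 0 a + (p + q)"
  using keys_sum_seriesE[OF assms[unfolded star_gen_def]] homogeneous_var by blast

lemma keys_sh_genE:
  assumes "s \<in> keys (sh_gen p q a)"
  obtains ns where "s = SymI ns" "length ns = p + q" "\<forall>n\<in>set ns. n \<ge> 1" "sum_list ns =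
      poly_weight 0 a + (p + q)"
  using keys_sum_seriesE[OF assms[unfolded sh_gen_def comma_series_def]] homogeneous_comma by blast

text \<open>A generator is either a single symbol or a coefficient at one monomial \<open>a\<close>,
  whose degree fixes the weight.\<close>

lemma W_R_gens_homogeneous:
  assumes "g \<in> W_R_gens"
  shows "\<exists>n. \<forall>s\<in>keys g. symb_weight s = n"
proof -
  consider p q a where "g = star_gen p q a" | p q a where "g = sh_gen p q a" | n where "g =
      single (SymI [2 * n]) 1"
    using assms unfolding W_R_gens_def by blast
  then show ?thesis
  proof cases
    case 1
    then show ?thesis by (metis keys_star_genE symb_weight.simps(1))
  next
    case 2
    then show ?thesis by (metis keys_sh_genE symb_weight.simps(1))
  qed auto
qed

lemma W_R_subset_W_space: "W_R \<subseteq> W_space"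
proof -
  have "W_R_gens \<subseteq> W_space"
    by (fastforce simp: W_R_gens_def W_space_def symbols_W_def elim: keys_star_genE keys_sh_genE)
  moreover have "free_vs.subspace (W_space :: (symb \<Rightarrow>\<^sub>0 'a) set)"
    unfolding W_space_def by (rule subspace_keys)
  ultimately show ?thesis unfolding W_R_eq_span by (rule free_vs.span_minimal)
qed

abbreviation W_R_depth :: "nat \<Rightarrow> (symb \<Rightarrow>\<^sub>0 'k::field) set" where
  "W_R_depth m \<equiv> component symb_depth m W_R"

lemma subspace_W_R_depth: "free_vs.subspace (W_R_depth m)"
  unfolding W_R_eq_span by (intro component_subspace free_vs.subspace_span)

lemma restrict_W_R_depth: "v \<in> W_R_depth m \<Longrightarrow> restrict_keys (\<lambda>s. symb_weight s = k) v \<in> W_R_depth m"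
  using restrict_keys_in_span[OF W_R_gens_homogeneous]
  by (auto simp: component_def W_R_eq_span keys_restrict_keys)

text \<open>Since \<open>u\<close> and \<open>v\<close> range over all lists of their lengths, they
  may be reversed too.\<close>

lemma star_zero_rev: "star_zero m l (\<lambda>c. F (rev c)) \<longleftrightarrow> star_zero m l F"
  unfolding star_zero_def by (metis length_rev rev_rev_ident sum_shuffle_list_rev)

lemma shuffle_perms_fixes:
  assumes "\<sigma> \<in> shuffle_perms p q" "p + q < i"
  shows "inv \<sigma> i = i"
  using assms permutes_not_in[OF permutes_inv, of \<sigma> "{1..p+q}" i] by (auto simp: shuffle_perms_def)

lemma shuffle_perms_range:
  assumes "\<sigma> \<in> shuffle_perms p q" "i \<in> {1..p+q}"
  shows "inv \<sigma> i \<in> {1..p+q}"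
  using assms permutes_in_image[OF permutes_inv, of \<sigma> "{1..p+q}" i]
      by (auto simp: shuffle_perms_def)

text \<open>The pairings for all \<open>a\<close> together are the coefficients of one polynomial,
  which is tested by its values at the points \<open>b\<close>.\<close>

lemma sym_pairing_sum_series:
  fixes p :: "'k::field_char_0 mpoly"
  assumes p: "p \<in> polys m" and t: "\<And>\<sigma> i. homogeneous 1 (t \<sigma> i)"
  shows "(\<forall>a. sym_pairing m (\<Sum>\<sigma>\<in>A. colon_series m (t \<sigma>) a) p = 0) \<longleftrightarrow>
    (\<forall>b. (\<Sum>\<sigma>\<in>A. eval (\<lambda>i. eval b (t \<sigma> (m + 1 - i)) - eval b (t \<sigma> (m + 1))) p) = 0)"
proof -
  define f where "f = (\<Sum>\<sigma>\<in>A. poly_subst (\<lambda>i. t \<sigma> (m + 1 - i) - t \<sigma> (m + 1)) p)"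
  have "sym_pairing m (\<Sum>\<sigma>\<in>A. colon_series m (t \<sigma>) a) p = lookup f a" for a
    unfolding f_def sym_pairing_sum_left lookup_sum
        by (intro sum.cong refl sym_pairing_colon_series p t)
  then have "(\<forall>a. sym_pairing m (\<Sum>\<sigma>\<in>A. colon_series m (t \<sigma>) a) p = 0) \<longleftrightarrow> f = 0"
    by (simp only: poly_mapping_eq_iff fun_eq_iff lookup_zero)
  also have "\<dots> \<longleftrightarrow> (\<forall>b. eval b f = 0)"
    using eval_eq_zero_imp[of f] by auto
  finally show ?thesis unfolding f_def eval_sum eval_poly_subst eval_simps .
qed

text \<open>Only differences with the last variable enter, and \<sigma> fixes the index m+1; so the
  points \<open>b\<close> amount to arbitrary lists of m values. Reversal then gives the equations
  of \<open>T_star\<close>.\<close>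

lemma sym_pairing_star_gen:
  fixes p :: "'k::field_char_0 mpoly"
  assumes p: "p \<in> polys m" and l: "l \<le> m"
  shows "(\<forall>a. sym_pairing m (star_gen l (m - l) a) p = 0) \<longleftrightarrow> star_zero m l (list_eval p)"
proof -
  let ?S = "shuffle_perms l (m - l)"
  let ?F = "\<lambda>c. list_eval p (rev c)"
  let ?e = "\<lambda>b \<sigma>. eval (\<lambda>i. eval b (var (inv \<sigma> (m + 1 - i))) - eval b (var (inv \<sigma> (m + 1)))) p"
  have lm: "l + (m - l) = m" using l by simp
  have eq: "(\<Sum>\<sigma>\<in>?S. ?e b \<sigma>) = (\<Sum>\<sigma>\<in>?S. ?F (map (\<lambda>i. a (inv \<sigma> i)) [1..<m+1]))"
    if ab: "\<And>i. i \<in> {1..m} \<Longrightarrow> a i = b i - b (m + 1)" for a b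
  proof (rule sum.cong[OF refl])
    fix \<sigma> assume \<sigma>: "\<sigma> \<in> ?S"
    have "b (inv \<sigma> (m + 1 - i)) - b (inv \<sigma> (m + 1)) =
        rev (map (\<lambda>i. a (inv \<sigma> i)) [1..<m+1]) ! (i - 1)"
      if i: "i \<in> {1..m}" for i
    proof -
      have "rev (map (\<lambda>i. a (inv \<sigma> i)) [1..<m+1]) ! (i - 1) = a (inv \<sigma> (m + 1 - i))"
        using i by (auto simp: rev_nth Suc_diff_le)
      moreover have "inv \<sigma> (m + 1 - i) \<in> {1..m}"
        by (rule shuffle_perms_range[OF \<sigma>, unfolded lm]) (use i in auto)
      ultimately show ?thesis using ab shuffle_perms_fixes[OF \<sigma>, of "m + 1"] by (simp add: lm)
    qed
    then show "?e b \<sigma> = ?F (map (\<lambda>i. a (inv \<sigma> i)) [1..<m+1])"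
      unfolding eval_simps by (rule eval_eq_list_eval[OF p])
  qed
  have "(\<forall>a. sym_pairing m (star_gen l (m - l) a) p = 0) \<longleftrightarrow> (\<forall>b. (\<Sum>\<sigma>\<in>?S. ?e b \<sigma>) = 0)"
    unfolding star_gen_def lm
    by (rule sym_pairing_sum_series[OF p, where t = "\<lambda>\<sigma> i. var (inv \<sigma> i)"]) (rule homogeneous_var)
  also have "\<dots> \<longleftrightarrow> (\<forall>a. (\<Sum>\<sigma>\<in>?S. ?F (map (\<lambda>i. a (inv \<sigma> i)) [1..<m+1])) = 0)"
  proof (intro iffI allI)
    fix b assume all: "\<forall>a. (\<Sum>\<sigma>\<in>?S. ?F (map (\<lambda>i. a (inv \<sigma> i)) [1..<m+1])) = 0"
    show "(\<Sum>\<sigma>\<in>?S. ?e b \<sigma>) = 0"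
      using eq[of "\<lambda>i. b i - b (m + 1)" b] all[rule_format, of "\<lambda>i. b i - b (m + 1)"] by simp
  next
    fix a assume "\<forall>b. (\<Sum>\<sigma>\<in>?S. ?e b \<sigma>) = 0"
    \<comment> \<open>Setting the last variable to 0 realises \<open>a\<close> itself as the list of
      differences.\<close>
    then have "(\<Sum>\<sigma>\<in>?S. ?e (a(m + 1 := 0)) \<sigma>) = 0" by (rule spec)
    moreover have "(\<Sum>\<sigma>\<in>?S. ?e (a(m + 1 := 0)) \<sigma>) = (\<Sum>\<sigma>\<in>?S. ?F (map (\<lambda>i. a (inv \<sigma> i)) [1..<m+1]))"
      by (rule eq) simp
    ultimately show "(\<Sum>\<sigma>\<in>?S. ?F (map (\<lambda>i. a (inv \<sigma> i)) [1..<m+1])) = 0" by (simp only:)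
  qed
  also have "\<dots> \<longleftrightarrow> star_zero m l (list_eval p)"
    unfolding sum_perms_zero_iff[OF l, of ?F] by (rule star_zero_rev)
  finally show ?thesis .
qed

text \<open>Partial sums from the left, read backwards, are the tail sums of the reversed list; the
  last argument is 0 here, so nothing is subtracted.\<close>

lemma sym_pairing_sh_gen:
  fixes p :: "'k::field_char_0 mpoly"
  assumes p: "p \<in> polys m" and l: "l \<le> m"
  shows "(\<forall>a. sym_pairing m (sh_gen l (m - l) a) p = 0) \<longleftrightarrow>
      star_zero m l (\<lambda>c. list_eval p (tail_sums c))"
proof -
  let ?T = "\<lambda>\<sigma> i. if i \<le> m then \<Sum>j=1..i. var (inv \<sigma> j) else 0 :: 'k mpoly"
  let ?S = "shuffle_perms l (m - l)"
  let ?F = "\<lambda>c. list_eval p (tail_sums (rev c))"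
  let ?e = "\<lambda>b \<sigma>. eval (\<lambda>i. eval b (?T \<sigma> (m + 1 - i)) - eval b (?T \<sigma> (m + 1))) p"
  have lm: "l + (m - l) = m" using l by simp
  have eq: "?e b \<sigma> = ?F (map (\<lambda>i. b (inv \<sigma> i)) [1..<m+1])" for b \<sigma>
  proof (rule eval_eq_list_eval[OF p])
    fix i assume i: "i \<in> {1..m}"
    have "tail_sums (rev (map (\<lambda>i. b (inv \<sigma> i)) [1..<m+1])) ! (i - 1) =
        sum_list (map (\<lambda>i. b (inv \<sigma> i)) (take (m + 1 - i) [1..<m+1]))"
      using i by (subst nth_tail_sums) (auto simp: drop_rev sum_list_rev take_map Suc_diff_le)
    also have "take (m + 1 - i) [1..<m+1] = [1..<(m + 1 - i) + 1]"
      using i by (subst take_upt) auto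
    also have "sum_list (map (\<lambda>i. b (inv \<sigma> i)) \<dots>) = (\<Sum>j=1..m + 1 - i. b (inv \<sigma> j))"
      by (simp add: interv_sum_list_conv_sum_set_nat atLeastLessThanSuc_atLeastAtMost)
    finally show "eval b (?T \<sigma> (m + 1 - i)) - eval b (?T \<sigma> (m + 1)) =
        tail_sums (rev (map (\<lambda>i. b (inv \<sigma> i)) [1..<m+1])) ! (i - 1)"
      using i by (auto simp: eval_sum)
  qed
  have "(\<forall>a. sym_pairing m (sh_gen l (m - l) a) p = 0) \<longleftrightarrow> (\<forall>b. (\<Sum>\<sigma>\<in>?S. ?e b \<sigma>) = 0)"
    unfolding sh_gen_def comma_series_def lm
    by (rule sym_pairing_sum_series[OF p, where t = ?T]) (rule homogeneous_comma)
  also have "\<dots> \<longleftrightarrow> star_zero m l (\<lambda>c. list_eval p (tail_sums c))"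
    unfolding eq sum_perms_zero_iff[OF l, of ?F] by (rule star_zero_rev)
  finally show ?thesis .
qed

lemma sym_pairing_eq_0:
  assumes "\<And>s. s \<in> keys v \<Longrightarrow> symb_depth s \<noteq> m"
  shows "sym_pairing m v p = 0"
proof -
  have "lookup v (sym_of m t) = 0" for t
    using assms[of "sym_of m t"] by (auto simp: in_keys_iff)
  then show ?thesis by (simp add: sym_pairing_def)
qed

text \<open>Generators of another depth pair to zero with \<open>p\<close>, among them every I(2n)
  as m >= 2; those of depth m give exactly the two systems of equations.\<close>

lemma dsh_polys_iff_W_R:
  fixes p :: "'k::field_char_0 mpoly"
  assumes p: "p \<in> polys m" and m: "m \<ge> 2"
  shows "p \<in> dsh_polys m \<longleftrightarrow> (\<forall>v\<in>W_R_depth m. sym_pairing m v p = 0)"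
proof
  assume dsh: "p \<in> dsh_polys m"
  have gens: "sym_pairing m g p = 0" if "g \<in> W_R_gens" for g
  proof -
    have "(\<exists>k l a. k \<ge> 1 \<and> l \<ge> 1 \<and> (g = star_gen k l a \<or> g = sh_gen k l a)) \<or>
        (\<exists>n. g = single (SymI [2 * n]) 1)"
      using that unfolding W_R_gens_def by blast
    then consider k l a where "k \<ge> 1" "l \<ge> 1" "g = star_gen k l a \<or> g = sh_gen k l a"
      | n where "g = single (SymI [2 * n]) 1" by blast
    then show ?thesis
    proof cases
      case (1 k l a)
      show ?thesis
      proof (cases "k + l = m")
        case True
        then have k: "k \<in> {1..m-1}" "k \<le> m" "l = m - k" using 1 by auto
        then have "star_zero m k (list_eval p)" "star_zero m k (\<lambda>c. list_eval p (tail_sums c))"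
          using dsh by (auto simp: dsh_polys_def)
        then show ?thesis
          using 1(3) sym_pairing_star_gen[OF p k(2)] sym_pairing_sh_gen[OF p k(2)] k(3) by auto
      next
        case False
        then show ?thesis
          by (intro sym_pairing_eq_0) (use 1(3) in \<open>auto elim!: keys_star_genE keys_sh_genE\<close>)
      qed
    next
      case 2
      then show ?thesis using m by (intro sym_pairing_eq_0) auto
    qed
  qed
  have "sym_pairing m v p = 0" if "v \<in> free_vs.span W_R_gens" for v
    using that
    by (induction rule: free_vs.span_induct_alt)
       (auto simp: sym_pairing_zero_left sym_pairing_add_left sym_pairing_pscale_left gens)
  then show "\<forall>v\<in>W_R_depth m. sym_pairing m v p = 0" by (auto simp: component_def W_R_eq_span)
next
  assume zero: "\<forall>v\<in>W_R_depth m. sym_pairing m v p = 0"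
  have "star_zero m l (list_eval p) \<and> star_zero m l (\<lambda>c. list_eval p (tail_sums c))"
      if l: "l \<in> {1..m-1}" for l
  proof -
    have lm: "l \<le> m" "l + (m - l) = m" "m - l \<ge> 1" "l \<ge> 1" using l by auto
    then have "star_gen l (m - l) a \<in> W_R_gens" "sh_gen l (m - l) a \<in> W_R_gens" for a
      unfolding W_R_gens_def by blast+
    then have "star_gen l (m - l) a \<in> W_R_depth m" "sh_gen l (m - l) a \<in> W_R_depth m" for a
      unfolding component_def W_R_eq_span
      using lm(2) by (auto intro: free_vs.span_base elim!: keys_star_genE keys_sh_genE)
    then show ?thesis
      using zero sym_pairing_star_gen[OF p lm(1)] sym_pairing_sh_gen[OF p lm(1)] by blast
  qed
  then show "p \<in> dsh_polys m" using p by (simp add: dsh_polys_def)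
qed

text \<open>Obtained by adjunction from the grading of \<open>W_R\<close>, whose generators are
  homogeneous, rather than from the operators \<open>T_star\<close> and \<open>T_sh\<close>.\<close>

lemma restrict_dsh_polys:
  fixes p :: "'k::field_char_0 mpoly"
  assumes p: "p \<in> dsh_polys m" and m: "m \<ge> 2"
  shows "restrict_keys (\<lambda>t. poly_weight m t = k) p \<in> dsh_polys m"
proof -
  have p': "p \<in> polys m" using p by (simp add: dsh_polys_def)
  then have r: "restrict_keys (\<lambda>t. poly_weight m t = k) p \<in> polys m"
    by (auto simp: polys_def keys_restrict_keys)
  show ?thesis
    unfolding dsh_polys_iff_W_R[OF r m] sym_pairing_restrict[OF p']
    using p restrict_W_R_depth unfolding dsh_polys_iff_W_R[OF p' m] by blast
qed

lemma subspace_polys: "free_vs.subspace (polys m :: 'k::field mpoly set)"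
proof -
  have "polys m = {p :: 'k mpoly. keys p \<subseteq> monomials m}" using polys_iff by blast
  then show ?thesis by (simp only: subspace_keys)
qed

lemma subspace_dsh_polys:
  assumes "m \<ge> 2"
  shows "free_vs.subspace (dsh_polys m :: 'k::field_char_0 mpoly set)"
proof -
  have "(dsh_polys m :: 'k mpoly set) = polys m \<inter> {p. \<forall>v\<in>W_R_depth m. sym_pairing m v p = 0}"
    using dsh_polys_iff_W_R[OF _ assms] by (auto simp: dsh_polys_def)
  moreover have "free_vs.subspace {p :: 'k mpoly. \<forall>v\<in>W_R_depth m. sym_pairing m v p = 0}"
    by (rule free_vs.subspaceI) (auto simp: sym_pairing_def)
  ultimately show ?thesis using free_vs.subspace_inter[OF subspace_polys] by simp
qed

section \<open>The annihilator of the double shuffle polynomials\<close>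

abbreviation W_of_depth :: "nat \<Rightarrow> (symb \<Rightarrow>\<^sub>0 'k::field) set" where
  "W_of_depth m \<equiv> component symb_depth m W_space"

lemma W_of_depth_iff: "m \<ge> 1 \<Longrightarrow> v \<in> W_of_depth m \<longleftrightarrow> keys v \<subseteq> sym_of m ` monomials m"
  unfolding range_sym_of by (fastforce simp: component_def W_space_def symbols_W_def)

lemma W_R_depth_subset: "W_R_depth m \<subseteq> W_of_depth m"
  using W_R_subset_W_space by (auto simp: component_def)

lemma linear_form_sum:
  fixes \<beta> :: "('a \<Rightarrow>\<^sub>0 'k::field) \<Rightarrow> 'k"
  assumes S: "free_vs.subspace S"
    and add: "\<And>u v. u \<in> S \<Longrightarrow> v \<in> S \<Longrightarrow> \<beta> (u + v) = \<beta> u + \<beta> v"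
    and scale: "\<And>c v. v \<in> S \<Longrightarrow> \<beta> (pscale c v) = c * \<beta> v"
    and f: "\<And>i. i \<in> A \<Longrightarrow> f i \<in> S"
  shows "\<beta> (\<Sum>i\<in>A. f i) = (\<Sum>i\<in>A. \<beta> (f i))"
  using f
proof (induction A rule: infinite_finite_induct)
  case (insert i A)
  then show ?case by (simp add: add free_vs.subspace_sum[OF S])
qed (use scale[of 0 0] free_vs.subspace_0[OF S] in auto)

text \<open>
  The annihilator of the annihilator: a form separating \<open>v\<close> from the relations may be taken to be
  supported in one weight, and is then the pairing with a polynomial.
\<close>

lemma W_R_depthI:
  fixes v :: "symb \<Rightarrow>\<^sub>0 'k::field_char_0"
  assumes v: "v \<in> W_of_depth m" and m: "m \<ge> 2"
    and zero: "\<And>p. p \<in> dsh_polys m \<Longrightarrow> sym_pairing m v p = 0"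
  shows "v \<in> W_R_depth m"
proof -
  let ?r = "\<lambda>k. restrict_keys (\<lambda>s. symb_weight s = k)"
  have m1: "m \<ge> 1" using m by simp
  have "?r k v \<in> W_R_depth m" for k
  proof (rule ccontr)
    assume "?r k v \<notin> W_R_depth m"
    then obtain \<beta> where \<beta>: "\<And>u w. \<beta> (u + w) = \<beta> u + \<beta> w" "\<And>c w. \<beta> (pscale c w) = c * \<beta> w"
      "\<And>u. u \<in> W_R_depth m \<Longrightarrow> \<beta> u = 0" "\<beta> (?r k v) = (1 :: 'k)"
      by (rule separating_form[OF subspace_W_R_depth]) (rule that)
    define A where "A = {t \<in> monomials m. poly_weight m t = k}"
    \<comment> \<open>The coefficient at \<open>t\<close> is the value of \<beta> on the dual
      symbol, so pairing with \<open>p\<close> is \<beta> after projection to weight k; finiteness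
      of \<open>A\<close> makes this a polynomial.\<close>
    define p where "p = (\<Sum>t\<in>A. single t (\<beta> (single (sym_of m t) 1)))"
    have fin: "finite A" unfolding A_def by (rule finite_monomials_weight)
    have pairing: "sym_pairing m w p = \<beta> (?r k w)" if w: "w \<in> W_of_depth m" for w
    proof -
      have "?r k w = (\<Sum>t\<in>A. pscale (lookup w (sym_of m t)) (single (sym_of m t) 1))"
      proof (rule poly_mapping_eqI)
        fix s
        have "lookup (\<Sum>t\<in>A. pscale (lookup w (sym_of m t)) (single (sym_of m t) 1)) s =
            (\<Sum>t\<in>A. if sym_of m t = s then lookup w s else 0)"
          unfolding lookup_sum by (rule sum.cong) (auto simp: lookup_single when_def)
        also have "\<dots> = (\<Sum>u\<in>sym_of m ` A. if u = s then lookup w s else 0)"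
          using inj_on_subset[OF inj_on_sym_of, of A m] by (subst sum.reindex) (auto simp: A_def)
        also have "\<dots> = (if s \<in> sym_of m ` A then lookup w s else 0)"
          using fin by (simp add: sum.delta)
        also have "\<dots> = lookup (?r k w) s"
        proof (cases "s \<in> sym_of m ` monomials m")
          case True
          then show ?thesis by (auto simp: A_def symb_weight_sym_of)
        next
          case False
          then have "lookup w s = 0" using w W_of_depth_iff[OF m1] by (metis in_keys_iff subsetD)
          then show ?thesis by simp
        qed
        finally show "lookup (?r k w) s =
            lookup (\<Sum>t\<in>A. pscale (lookup w (sym_of m t)) (single (sym_of m t) 1)) s" by simp
      qed
      then have "\<beta> (?r k w) = (\<Sum>t\<in>A. lookup w (sym_of m t) * \<beta> (single (sym_of m t) 1))"
        by (simp add: linear_form_sum[of UNIV \<beta>, OF free_vs.subspace_UNIV] \<beta>(1,2))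
      also have "\<dots> = sym_pairing m w p"
        unfolding p_def sym_pairing_def lin_form_sum by (simp add: mult.commute)
      finally show ?thesis by simp
    qed
    have "p \<in> polys m"
      unfolding p_def by (intro free_vs.subspace_sum subspace_polys) (auto simp: A_def polys_iff)
    moreover have "sym_pairing m w p = 0" if "w \<in> W_R_depth m" for w
      using pairing[of w] \<beta>(3)[OF restrict_W_R_depth[OF that]] that W_R_depth_subset by auto
    ultimately have "p \<in> dsh_polys m" using dsh_polys_iff_W_R[OF _ m] by blast
    then show False using zero pairing[OF v] \<beta>(4) by simp
  qed
  then have "(\<Sum>k\<in>symb_weight ` keys v. ?r k v) \<in> W_R_depth m"
    by (intro free_vs.subspace_sum subspace_W_R_depth)
  then show ?thesis using sum_restrict_keys[of "symb_weight ` keys v" symb_weight v] by simp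
qed

section \<open>Maps induced on quotients\<close>

text \<open>The structure on which cosets are formed; it covers subspaces of free spaces as well as
  graded duals, whose addition is that of functions.\<close>

definition graded_module :: "('k::field, 'v::ab_group_add) gspace \<Rightarrow> bool" where
  "graded_module A \<longleftrightarrow>
     gplus A = (+) \<and> 0 \<in> gcarrier A \<and>
     (\<forall>u\<in>gcarrier A. \<forall>v\<in>gcarrier A. u + v \<in> gcarrier A) \<and>
     (\<forall>c. \<forall>v\<in>gcarrier A. gscale A c v \<in> gcarrier A) \<and>
     (\<forall>c u v. gscale A c (u + v) = gscale A c u + gscale A c v) \<and>
     (\<forall>v. gscale A (-1) v = - v) \<and> (\<forall>k. gpart A k \<subseteq> gcarrier A)"

definition submodule :: "('k::field, 'v::ab_group_add) gspace \<Rightarrow> 'v set \<Rightarrow> bool" where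
  "submodule A U \<longleftrightarrow> U \<subseteq> gcarrier A \<and> 0 \<in> U \<and> (\<forall>u\<in>U. \<forall>v\<in>U. u + v \<in> U) \<and>
     (\<forall>c. \<forall>u\<in>U. gscale A c u \<in> U)"

lemma graded_module_closed:
  assumes "graded_module A"
  shows "u \<in> gcarrier A \<Longrightarrow> v \<in> gcarrier A \<Longrightarrow> u + v \<in> gcarrier A"
    and "v \<in> gcarrier A \<Longrightarrow> gscale A c v \<in> gcarrier A"
    and "v \<in> gpart A k \<Longrightarrow> v \<in> gcarrier A" and "0 \<in> gcarrier A"
  using assms by (auto simp: graded_module_def)

lemma graded_module_diff_closed:
  assumes "graded_module A" "u \<in> gcarrier A" "v \<in> gcarrier A"
  shows "u - v \<in> gcarrier A"
  using assms unfolding graded_module_def by (metis add_uminus_conv_diff)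

context
  fixes A :: "('k::field, 'v::ab_group_add) gspace" and U :: "'v set"
  assumes A: "graded_module A" and U: "submodule A U"
begin

lemma submodule_uminus: "u \<in> U \<Longrightarrow> - u \<in> U"
  using A U unfolding graded_module_def submodule_def by metis

lemma submodule_diff: "u \<in> U \<Longrightarrow> v \<in> U \<Longrightarrow> u - v \<in> U"
  using submodule_uminus[of v] U unfolding submodule_def by (metis add_uminus_conv_diff)

lemma in_coset_iff: "w \<in> coset A U v \<longleftrightarrow> w - v \<in> U"
proof -
  have plus: "gplus A = (+)" using A by (simp add: graded_module_def)
  have "w \<in> (+) v ` U" if "w - v \<in> U"
    by (rule image_eqI[OF _ that]) simp
  then show ?thesis unfolding coset_def plus by auto
qed

lemma coset_eq_iff: "coset A U v = coset A U w \<longleftrightarrow> v - w \<in> U"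
proof
  assume "coset A U v = coset A U w"
  moreover have "v \<in> coset A U v" using U by (simp add: in_coset_iff submodule_def)
  ultimately show "v - w \<in> U" by (simp add: in_coset_iff)
next
  assume vw: "v - w \<in> U"
  have "a - v \<in> U \<longleftrightarrow> a - w \<in> U" for a
  proof
    assume "a - v \<in> U"
    then have "(a - v) + (v - w) \<in> U" using U vw by (simp only: submodule_def)
    then show "a - w \<in> U" by simp
  next
    assume "a - w \<in> U"
    then have "(a - w) - (v - w) \<in> U" using vw by (rule submodule_diff)
    then show "a - v \<in> U" by simp
  qed
  then show "coset A U v = coset A U w" by (auto simp: in_coset_iff)
qed

lemma quotient_plus: "gplus (quotient_graded A U) (coset A U v) (coset A U w) = coset A U (v + w)"
proof -
  have plus: "gplus A = (+)" using A by (simp add: graded_module_def)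
  have "a \<in> {a + b |a b. a - v \<in> U \<and> b - w \<in> U} \<longleftrightarrow> a - (v + w) \<in> U" for a
  proof
    assume "a \<in> {a + b |a b. a - v \<in> U \<and> b - w \<in> U}"
    then obtain b c where "a = b + c" "b - v \<in> U" "c - w \<in> U" by blast
    moreover from this have "(b - v) + (c - w) \<in> U" using U by (simp only: submodule_def)
    ultimately show "a - (v + w) \<in> U" by (simp add: algebra_simps)
  next
    assume "a - (v + w) \<in> U"
    moreover have "v - v \<in> U" using U by (simp add: submodule_def)
    moreover have "a = v + (a - v)" by simp
    ultimately show "a \<in> {a + b |a b. a - v \<in> U \<and> b - w \<in> U}"
      by (intro CollectI exI[of _ v] exI[of _ "a - v"]) (simp add: algebra_simps)
  qed
  then show ?thesis by (auto simp: quotient_graded_def plus in_coset_iff)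
qed

lemma quotient_scale: "gscale (quotient_graded A U) c (coset A U v) = coset A U (gscale A c v)"
proof -
  have plus: "gplus A = (+)" and scale: "gscale A c (u + w) = gscale A c u + gscale A c w" for u w
    using A by (simp_all add: graded_module_def)
  have "a \<in> {gscale A c b + u |b u. b - v \<in> U \<and> u \<in> U} \<longleftrightarrow> a - gscale A c v \<in> U" for a
  proof
    assume "a \<in> {gscale A c b + u |b u. b - v \<in> U \<and> u \<in> U}"
    then obtain b u where bu: "a = gscale A c b + u" "b - v \<in> U" "u \<in> U" by blast
    have "gscale A c b = gscale A c (b - v) + gscale A c v" using scale[of "b - v" v] by simp
    then have eq: "a - gscale A c v = gscale A c (b - v) + u" using bu(1) by simp
    have "gscale A c (b - v) \<in> U" using U bu(2) by (simp add: submodule_def)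
    then show "a - gscale A c v \<in> U" unfolding eq using U bu(3) by (simp add: submodule_def)
  next
    assume "a - gscale A c v \<in> U"
    moreover have "v - v \<in> U" using U by (simp add: submodule_def)
    moreover have "a = gscale A c v + (a - gscale A c v)" by simp
    ultimately show "a \<in> {gscale A c b + u |b u. b - v \<in> U \<and> u \<in> U}" by blast
  qed
  then show ?thesis by (auto simp: quotient_graded_def plus in_coset_iff)
qed

text \<open>The hypothesis makes the cosets the fibres of \<open>F\<close>, so \<open>F\<close> has
  a single value on each and \<open>the_elem\<close> is meaningful.\<close>

lemma descend_coset:
  assumes F: "\<And>u v. u \<in> gcarrier A \<Longrightarrow> v \<in> gcarrier A \<Longrightarrow> F u = F v \<longleftrightarrow> u - v \<in> U"
    and v: "v \<in> gcarrier A"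
  shows "descend F (coset A U v) = F v"
proof -
  have "F w = F v" if "w \<in> coset A U v" for w
  proof -
    have wv: "w - v \<in> U" using that by (simp add: in_coset_iff)
    then have "w - v \<in> gcarrier A" using U by (auto simp: submodule_def)
    then have "(w - v) + v \<in> gcarrier A" using v by (rule graded_module_closed(1)[OF A])
    then have "w \<in> gcarrier A" by simp
    then show ?thesis using wv by (intro iffD2[OF F[OF _ v]])
  qed
  then have "F ` coset A U v = (\<lambda>_. F v) ` coset A U v" by (rule image_cong[OF refl])
  also have "\<dots> = {F v}"
    by (rule image_constant[of v]) (use U in \<open>simp add: in_coset_iff submodule_def\<close>)
  finally show ?thesis by (simp add: descend_def)
qed

text \<open>The homomorphism theorem; surjectivity is required in every weight so that the induced
  map matches the gradings.\<close>

lemma graded_iso_descend: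
  fixes C :: "('k, 'w) gspace"
  assumes add: "\<And>u v. u \<in> gcarrier A \<Longrightarrow> v \<in> gcarrier A \<Longrightarrow> F (u + v) = gplus C (F u) (F v)"
    and scale: "\<And>c v. v \<in> gcarrier A \<Longrightarrow> F (gscale A c v) = gscale C c (F v)"
    and ker: "\<And>u v. u \<in> gcarrier A \<Longrightarrow> v \<in> gcarrier A \<Longrightarrow> F u = F v \<longleftrightarrow> u - v \<in> U"
    and onto: "F ` gcarrier A = gcarrier C" "\<And>k. F ` gpart A k = gpart C k"
  shows "graded_iso (quotient_graded A U) C (descend F)"
proof -
  have desc: "descend F (coset A U v) = F v" if "v \<in> gcarrier A" for v
    by (rule descend_coset[where F = F, OF _ that]) (rule ker)
  have carrier: "gcarrier (quotient_graded A U) = coset A U ` gcarrier A"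
    "\<And>k. gpart (quotient_graded A U) k = coset A U ` gpart A k"
    by (simp_all add: quotient_graded_def)
  have part: "gpart A k \<subseteq> gcarrier A" for k using A by (simp add: graded_module_def)
  have "inj_on (descend F) (coset A U ` gcarrier A)"
  proof (rule inj_onI)
    fix X Y assume "X \<in> coset A U ` gcarrier A" "Y \<in> coset A U ` gcarrier A" "descend F X =
        descend F Y"
    moreover from this obtain u v where uv: "X = coset A U u" "Y = coset A U v"
      and carrier: "u \<in> gcarrier A" "v \<in> gcarrier A"
      by blast
    ultimately have "F u = F v" unfolding uv desc[OF carrier(1)] desc[OF carrier(2)] by simp
    then have "u - v \<in> U" using ker[OF carrier] by blast
    then show "X = Y" unfolding uv by (simp only: coset_eq_iff)
  qed
  moreover have image: "descend F ` coset A U ` B = F ` B" if "B \<subseteq> gcarrier A" for B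
    unfolding image_image using that desc by (intro image_cong) auto
  ultimately have "bij_betw (descend F) (gcarrier (quotient_graded A U)) (gcarrier C)"
    unfolding bij_betw_def carrier using onto(1) by simp
  moreover have "descend F (gplus (quotient_graded A U) (coset A U u) (coset A U v)) =
      gplus C (descend F (coset A U u)) (descend F (coset A U v))"
    if "u \<in> gcarrier A" "v \<in> gcarrier A" for u v
    using that graded_module_closed(1)[OF A] by (simp add: quotient_plus desc add)
  moreover have "descend F (gscale (quotient_graded A U) c (coset A U v)) =
      gscale C c (descend F (coset A U v))"
    if "v \<in> gcarrier A" for c v
    using that graded_module_closed(2)[OF A] by (simp add: quotient_scale desc scale)
  moreover have "descend F ` gpart (quotient_graded A U) k = gpart C k" for k
    unfolding carrier image[OF part] by (rule onto(2))
  ultimately show ?thesis unfolding graded_iso_def by (auto simp: carrier)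
qed

end

text \<open>Surjectivity is asked only modulo \<open>U'\<close>, because the inclusion of W into V
  becomes onto only after dividing by F.\<close>

lemma graded_iso_induced_map:
  fixes A :: "('k::field, 'v::ab_group_add) gspace" and B :: "('k, 'w::ab_group_add) gspace"
  assumes A: "graded_module A" "submodule A U" and B: "graded_module B" "submodule B U'"
    and into: "\<And>v. v \<in> gcarrier A \<Longrightarrow> f v \<in> gcarrier B" "\<And>k. f ` gpart A k \<subseteq> gpart B k"
    and add: "\<And>u v. u \<in> gcarrier A \<Longrightarrow> v \<in> gcarrier A \<Longrightarrow> f (u + v) = f u + f v"
    and scale: "\<And>c v. v \<in> gcarrier A \<Longrightarrow> f (gscale A c v) = gscale B c (f v)"
    and ker: "\<And>v. v \<in> gcarrier A \<Longrightarrow> f v \<in> U' \<longleftrightarrow> v \<in> U"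
    and onto: "\<And>b. b \<in> gcarrier B \<Longrightarrow> \<exists>a\<in>gcarrier A. b - f a \<in> U'"
      "\<And>k b. b \<in> gpart B k \<Longrightarrow> \<exists>a\<in>gpart A k. b - f a \<in> U'"
  shows "graded_iso (quotient_graded A U) (quotient_graded B U') (induced_map B U' f)"
    and "v \<in> gcarrier A \<Longrightarrow> induced_map B U' f (coset A U v) = coset B U' (f v)"
proof -
  let ?F = "\<lambda>v. coset B U' (f v)"
  note diff_closed = graded_module_diff_closed[OF A(1)]
  have diff: "f (u - v) = f u - f v" if "u \<in> gcarrier A" "v \<in> gcarrier A" for u v
    using add[OF diff_closed[OF that] that(2)] by simp
  have kerF: "?F u = ?F v \<longleftrightarrow> u - v \<in> U" if "u \<in> gcarrier A" "v \<in> gcarrier A" for u v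
    using ker[OF diff_closed[OF that]] by (simp add: coset_eq_iff[OF B] diff[OF that])
  show "v \<in> gcarrier A \<Longrightarrow> induced_map B U' f (coset A U v) = coset B U' (f v)"
    unfolding induced_map_def by (rule descend_coset[OF A, where F = ?F]) (rule kerF)
  have parts: "gpart A k \<subseteq> gcarrier A" for k using A(1) by (simp add: graded_module_def)
  have *: "?F ` X = coset B U' ` Y" if X: "f ` X \<subseteq> Y" and Y: "\<And>b. b \<in> Y \<Longrightarrow>
      \<exists>a\<in>X. b - f a \<in> U'" for X Y
  proof (intro equalityI subsetI)
    fix C assume "C \<in> coset B U' ` Y"
    then obtain b where b: "b \<in> Y" "C = coset B U' b" by blast
    then obtain a where "a \<in> X" "b - f a \<in> U'" using Y by blast
    then show "C \<in> ?F ` X" using b(2) coset_eq_iff[OF B] by blast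
  qed (use X in blast)
  show "graded_iso (quotient_graded A U) (quotient_graded B U') (induced_map B U' f)"
    unfolding induced_map_def
  proof (rule graded_iso_descend[OF A])
    show "?F ` gcarrier A = gcarrier (quotient_graded B U')"
      using *[of "gcarrier A" "gcarrier B"] into(1) onto(1) by (auto simp: quotient_graded_def)
    show "?F ` gpart A k = gpart (quotient_graded B U') k" for k
      using *[of "gpart A k" "gpart B k"] into(2) onto(2) by (auto simp: quotient_graded_def)
  qed (simp_all add: add scale kerF quotient_plus[OF B] quotient_scale[OF B])
qed

section \<open>Graded duals\<close>

definition dual_forms :: "('a \<Rightarrow> nat) \<Rightarrow> ('a \<Rightarrow>\<^sub>0 'k::field) set \<Rightarrow> (('a \<Rightarrow>\<^sub>0 'k) \<Rightarrow> 'k) set" where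
  "dual_forms d S = gcarrier (graded_dual (subspace_graded d S))"

definition dual_forms_part :: "('a \<Rightarrow> nat) \<Rightarrow> ('a \<Rightarrow>\<^sub>0 'k::field) set \<Rightarrow> nat \<Rightarrow> (('a \<Rightarrow>\<^sub>0 'k) \<Rightarrow> 'k) set"
    where
  "dual_forms_part d S k = gpart (graded_dual (subspace_graded d S)) k"

lemma dual_forms_iff:
  "\<alpha> \<in> dual_forms d S \<longleftrightarrow>
     (\<forall>u\<in>S. \<forall>v\<in>S. \<alpha> (u + v) = \<alpha> u + \<alpha> v) \<and> (\<forall>c. \<forall>v\<in>S. \<alpha> (pscale c v) = c * \<alpha> v) \<and>
     (\<forall>v. v \<notin> S \<longrightarrow> \<alpha> v = 0) \<and> finite {k. \<exists>v\<in>component d k S. \<alpha> v \<noteq> 0}"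
  by (simp add: dual_forms_def graded_dual_def graded_dual_carrier_def subspace_graded_def)

lemma dual_forms_part_iff:
  "\<alpha> \<in> dual_forms_part d S k \<longleftrightarrow> \<alpha> \<in> dual_forms d S \<and> (\<forall>j. j \<noteq> k \<longrightarrow> (\<forall>v\<in>component d j S. \<alpha> v = 0))"
  by (simp add: dual_forms_def dual_forms_part_def graded_dual_def subspace_graded_def)

lemma graded_module_dual:
  fixes S :: "('a \<Rightarrow>\<^sub>0 'b::field) set"
  shows "graded_module (graded_dual (subspace_graded d S))"
proof -
  have "\<alpha> + \<beta> \<in> dual_forms d S" if "\<alpha> \<in> dual_forms d S" "\<beta> \<in> dual_forms d S"
    for \<alpha> \<beta> :: "('a \<Rightarrow>\<^sub>0 'b) \<Rightarrow> 'b"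
  proof -
    have "{k. \<exists>v\<in>component d k S. \<alpha> v + \<beta> v \<noteq> 0} \<subseteq>
        {k. \<exists>v\<in>component d k S. \<alpha> v \<noteq> 0} \<union> {k. \<exists>v\<in>component d k S. \<beta> v \<noteq> 0}" by auto
    then have "finite {k. \<exists>v\<in>component d k S. \<alpha> v + \<beta> v \<noteq> 0}"
      using that by (auto simp: dual_forms_iff elim: finite_subset)
    then show ?thesis using that by (auto simp: dual_forms_iff algebra_simps)
  qed
  moreover have "(\<lambda>v. c * \<alpha> v) \<in> dual_forms d S" if "\<alpha> \<in> dual_forms d S"
    for c and \<alpha> :: "('a \<Rightarrow>\<^sub>0 'b) \<Rightarrow> 'b"
  proof -
    have "{k. \<exists>v\<in>component d k S. c * \<alpha> v \<noteq> 0} \<subseteq> {k. \<exists>v\<in>component d k S. \<alpha> v \<noteq> 0}" by auto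
    then have "finite {k. \<exists>v\<in>component d k S. c * \<alpha> v \<noteq> 0}"
      using that by (auto simp: dual_forms_iff elim: finite_subset)
    then show ?thesis using that by (auto simp: dual_forms_iff algebra_simps)
  qed
  moreover have "0 \<in> dual_forms d S" by (simp add: dual_forms_iff)
  moreover have "gpart (graded_dual (subspace_graded d S)) k \<subseteq> dual_forms d S" for k
    using dual_forms_part_iff unfolding dual_forms_part_def by blast
  ultimately show ?thesis
    unfolding graded_module_def dual_forms_def
    by (simp add: graded_dual_def fun_eq_iff algebra_simps)
qed

lemma dual_forms_closed:
  "0 \<in> dual_forms d S"
  "\<alpha> \<in> dual_forms d S \<Longrightarrow> \<beta> \<in> dual_forms d S \<Longrightarrow> \<alpha> + \<beta> \<in> dual_forms d S"
  "\<alpha> \<in> dual_forms d S \<Longrightarrow> \<beta> \<in> dual_forms d S \<Longrightarrow> \<alpha> - \<beta> \<in> dual_forms d S"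
  "\<alpha> \<in> dual_forms d S \<Longrightarrow> (\<lambda>v. c * \<alpha> v) \<in> dual_forms d S"
proof -
  show "(\<lambda>v. c * \<alpha> v) \<in> dual_forms d S" if "\<alpha> \<in> dual_forms d S"
  proof -
    have "gscale (graded_dual (subspace_graded d S)) c \<alpha> \<in> dual_forms d S"
      using that unfolding dual_forms_def by (rule graded_module_closed(2)[OF graded_module_dual])
    then show ?thesis by (simp add: graded_dual_def)
  qed
qed (simp_all only: dual_forms_def graded_module_closed[OF graded_module_dual]
    graded_module_diff_closed[OF graded_module_dual])

lemma graded_module_subspace: "free_vs.subspace S \<Longrightarrow> graded_module (subspace_graded d S)"
  by (auto simp: graded_module_def subspace_graded_def component_def free_vs.subspace_0
      free_vs.subspace_add free_vs.subspace_scale free_vs.scale_right_distrib)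

lemma restr0_dual_forms:
  assumes ST: "S \<subseteq> T" and S: "free_vs.subspace S" and \<alpha>: "\<alpha> \<in> dual_forms d T"
  shows "restr0 S \<alpha> \<in> dual_forms d S"
proof -
  have "{k. \<exists>v\<in>component d k S. restr0 S \<alpha> v \<noteq> 0} \<subseteq> {k. \<exists>v\<in>component d k T. \<alpha> v \<noteq> 0}"
    using ST by (auto simp: component_def restr0_def)
  then have "finite {k. \<exists>v\<in>component d k S. restr0 S \<alpha> v \<noteq> 0}"
    using \<alpha> by (auto simp: dual_forms_iff elim: finite_subset)
  then show ?thesis
    using \<alpha> ST S
    by (auto simp: dual_forms_iff restr0_def free_vs.subspace_add free_vs.subspace_scale subset_iff)
qed

lemma restr0_dual_forms_part:
  assumes ST: "S \<subseteq> T" and S: "free_vs.subspace S" and \<alpha>: "\<alpha> \<in> dual_forms_part d T k"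
  shows "restr0 S \<alpha> \<in> dual_forms_part d S k"
  using restr0_dual_forms[OF ST S, of \<alpha> d] \<alpha> ST
  by (auto simp: dual_forms_part_iff restr0_def component_def)

text \<open>An arbitrary linear extension may be nonzero in infinitely many weights and so leave the
  graded dual; it is therefore cut down to the finitely many weights in which \<alpha> is
  nonzero.\<close>

lemma extend_dual_form:
  assumes ST: "S \<subseteq> T" and S: "graded_subspace d S" and T: "free_vs.subspace T"
    and \<alpha>: "\<alpha> \<in> dual_forms d S"
  obtains \<phi> where "\<phi> \<in> dual_forms d T" "restr0 S \<phi> = \<alpha>"
    "\<And>k. \<alpha> \<in> dual_forms_part d S k \<Longrightarrow> \<phi> \<in> dual_forms_part d T k"
proof -
  define K where "K = {k. \<exists>v\<in>component d k S. \<alpha> v \<noteq> 0}"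
  let ?r = "\<lambda>k. restrict_keys (\<lambda>a. d a = k)"
  have fin: "finite K" and sub: "free_vs.subspace S" and r: "v \<in> S \<Longrightarrow> ?r k v \<in> S" for k v
    using \<alpha> S by (auto simp: K_def dual_forms_iff graded_subspace_def)
  have add: "\<alpha> (u + v) = \<alpha> u + \<alpha> v" and scale: "\<alpha> (pscale c v) = c * \<alpha> v"
      if "u \<in> S" "v \<in> S" for c u v
    using \<alpha> that by (auto simp: dual_forms_iff)
  obtain \<beta> where \<beta>: "\<And>u v. \<beta> (u + v) = \<beta> u + \<beta> v" "\<And>c v. \<beta> (pscale c v) = c * \<beta> v"
    "\<And>v. v \<in> S \<Longrightarrow> \<beta> v = \<alpha> v"
    by (rule extend_linear_form[OF sub add scale]) (auto intro: that)
  define \<phi> where "\<phi> = restr0 T (\<lambda>v. \<Sum>k\<in>K. \<beta> (?r k v))"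
  have zero: "\<beta> 0 = 0" using \<beta>(2)[of 0 0] by simp
  have outside: "\<phi> v = 0" if "v \<in> component d j T" "j \<notin> K" for v j
  proof -
    have "?r k v = 0" if "k \<in> K" for k
    proof (rule poly_mapping_eqI)
      fix a
      have "d a = j" if "a \<in> keys v" using \<open>v \<in> component d j T\<close> that by (auto simp: component_def)
      then show "lookup (?r k v) a = lookup 0 a"
        using \<open>j \<notin> K\<close> \<open>k \<in> K\<close> by (auto simp: in_keys_iff)
    qed
    then show ?thesis by (simp add: \<phi>_def restr0_def zero)
  qed
  have "\<phi> \<in> dual_forms d T"
  proof -
    have "{k. \<exists>v\<in>component d k T. \<phi> v \<noteq> 0} \<subseteq> K" using outside by blast
    then have "finite {k. \<exists>v\<in>component d k T. \<phi> v \<noteq> 0}" using fin by (rule finite_subset)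
    then show ?thesis
      using T by (auto simp: dual_forms_iff \<phi>_def restr0_def restrict_keys_add restrict_keys_pscale
          \<beta>(1,2)
          sum.distrib sum_distrib_left free_vs.subspace_add free_vs.subspace_scale)
  qed
  moreover have "restr0 S \<phi> = \<alpha>"
  proof
    fix v
    show "restr0 S \<phi> v = \<alpha> v"
    proof (cases "v \<in> S")
      case True
      \<comment> \<open>Adding the weights of \<open>v\<close> decomposes \<open>v\<close>
        completely; the components in the added weights contribute zero.\<close>
      let ?K = "K \<union> d ` keys v"
      have "\<alpha> v = \<alpha> (\<Sum>k\<in>?K. ?r k v)" using fin by (subst sum_restrict_keys) auto
      also have "\<dots> = (\<Sum>k\<in>?K. \<alpha> (?r k v))"
        by (rule linear_form_sum[OF sub]) (use add scale r True in auto)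
      also have "\<dots> = (\<Sum>k\<in>K. \<alpha> (?r k v))"
      proof (rule sum.mono_neutral_right)
        show "\<forall>k\<in>?K - K. \<alpha> (?r k v) = 0"
        proof
          fix k assume "k \<in> ?K - K"
          moreover have "?r k v \<in> component d k S"
            using r[OF True] by (auto simp: component_def keys_restrict_keys)
          ultimately show "\<alpha> (?r k v) = 0" by (auto simp: K_def)
        qed
      qed (use fin in auto)
      also have "\<dots> = \<phi> v" using True ST r[OF True] by (auto simp: \<phi>_def restr0_def \<beta>(3))
      finally show ?thesis using True by (simp add: restr0_def)
    next
      case False
      then show ?thesis using \<alpha> by (simp add: restr0_def dual_forms_iff)
    qed
  qed
  moreover have "\<phi> \<in> dual_forms_part d T k" if "\<alpha> \<in> dual_forms_part d S k" for k
  proof -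
    have "K \<subseteq> {k}" using that by (auto simp: K_def dual_forms_part_iff)
    then show ?thesis using \<open>\<phi> \<in> dual_forms d T\<close> outside by (auto simp: dual_forms_part_iff)
  qed
  ultimately show ?thesis by (rule that)
qed

lemma dual_map_dual_forms:
  assumes f: "graded_iso (subspace_graded d S) (subspace_graded e T) f"
    and S: "free_vs.subspace S"
  shows "\<alpha> \<in> dual_forms e T \<Longrightarrow> dual_map (subspace_graded d S) f \<alpha> \<in> dual_forms d S"
    and "\<alpha> \<in> dual_forms_part e T k \<Longrightarrow> dual_map (subspace_graded d S) f \<alpha> \<in> dual_forms_part d S k"
proof -
  have bij: "f v \<in> T" if "v \<in> S" for v
    using f that by (auto simp: graded_iso_def subspace_graded_def bij_betw_def)
  have lin: "f (u + v) = f u + f v" "f (pscale c v) = pscale c (f v)" if "u \<in> S" "v \<in> S" for u v c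
    using f that by (auto simp: graded_iso_def subspace_graded_def)
  have "f ` component d k S = component e k T" for k
    using f by (simp add: graded_iso_def subspace_graded_def)
  then have part: "f v \<in> component e k T" if "v \<in> component d k S" for v k
    using that by blast
  show *: "dual_map (subspace_graded d S) f \<alpha> \<in> dual_forms d S" if \<alpha>: "\<alpha> \<in> dual_forms e T" for \<alpha>
  proof -
    have "{k. \<exists>v\<in>component d k S. dual_map (subspace_graded d S) f \<alpha> v \<noteq> 0} \<subseteq>
        {k. \<exists>v\<in>component e k T. \<alpha> v \<noteq> 0}"
      using part by (auto simp: dual_map_def restr0_def split: if_splits)
    then have "finite {k. \<exists>v\<in>component d k S. dual_map (subspace_graded d S) f \<alpha> v \<noteq> 0}"
      using \<alpha> by (auto simp: dual_forms_iff elim: finite_subset)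
    then show ?thesis
      using \<alpha> bij S lin
      by (auto simp: dual_forms_iff dual_map_def restr0_def subspace_graded_def free_vs.subspace_add
          free_vs.subspace_scale)
  qed
  show "\<alpha> \<in> dual_forms_part e T k \<Longrightarrow> dual_map (subspace_graded d S) f \<alpha> \<in> dual_forms_part d S k"
    using * part by (auto simp: dual_forms_part_iff dual_map_def restr0_def)
qed

lemma graded_iso_inv_into:
  assumes f: "graded_iso (subspace_graded d S) (subspace_graded e T) f" and S: "free_vs.subspace S"
  shows "graded_iso (subspace_graded e T) (subspace_graded d S) (inv_into S f)"
proof -
  have bij: "bij_betw f S T" using f by (simp add: graded_iso_def subspace_graded_def)
  then have inj: "inj_on f S" and T: "T = f ` S" by (auto simp: bij_betw_def)
  have lin: "f (u + v) = f u + f v" "f (pscale c v) = pscale c (f v)" if "u \<in> S" "v \<in> S" for u v c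
    using f that by (auto simp: graded_iso_def subspace_graded_def)
  have part: "f ` component d k S = component e k T" for k
    using f by (simp add: graded_iso_def subspace_graded_def)
  have inv: "inv_into S f (f v) = v" if "v \<in> S" for v using inj that by simp
  have "inv_into S f (f u + f v) = u + v" "inv_into S f (pscale c (f v)) = pscale c v"
      if "u \<in> S" "v \<in> S" for u v c
    using inv[of "u + v"] inv[of "pscale c v"] lin[OF that] S that
    by (simp_all add: free_vs.subspace_add free_vs.subspace_scale)
  moreover have "inv_into S f ` component e k T = component d k S" for k
  proof -
    have "component d k S \<subseteq> S" by (auto simp: component_def)
    then show ?thesis unfolding part[symmetric] using inv_into_image_cancel[OF inj] by blast
  qed
  ultimately show ?thesis
    using bij_betw_inv_into[OF bij] by (auto simp: graded_iso_def subspace_graded_def T inv)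
qed

text \<open>The dual map of \<open>inv_into S f\<close> is a two-sided inverse that respects
  weights.\<close>

lemma graded_iso_dual_map:
  assumes f: "graded_iso (subspace_graded d S) (subspace_graded e T) f"
    and S: "free_vs.subspace S" and T: "free_vs.subspace T"
  shows "graded_iso (graded_dual (subspace_graded e T)) (graded_dual (subspace_graded d S))
    (dual_map (subspace_graded d S) f)"
proof -
  let ?D = "dual_map (subspace_graded d S) f" and ?E =
      "dual_map (subspace_graded e T) (inv_into S f)"
  have bij: "bij_betw f S T" using f by (simp add: graded_iso_def subspace_graded_def)
  note D = dual_map_dual_forms[OF f S] and E = dual_map_dual_forms[OF graded_iso_inv_into[OF f S] T]
  have ED: "?E (?D \<alpha>) = \<alpha>" if "\<alpha> \<in> dual_forms e T" for \<alpha>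
    using that bij_betw_inv_into_right[OF bij] bij_betwE[OF bij_betw_inv_into[OF bij]]
    by (auto simp: dual_forms_iff dual_map_def restr0_def subspace_graded_def fun_eq_iff)
  have DE: "?D (?E \<beta>) = \<beta>" if "\<beta> \<in> dual_forms d S" for \<beta>
    using that bij_betw_inv_into_left[OF bij] bij_betwE[OF bij]
    by (auto simp: dual_forms_iff dual_map_def restr0_def subspace_graded_def fun_eq_iff)
  have "bij_betw ?D (dual_forms e T) (dual_forms d S)"
    by (rule bij_betw_byWitness[where f' = ?E]) (use D(1) E(1) ED DE in auto)
  moreover have "?D ` dual_forms_part e T k = dual_forms_part d S k" for k
  proof (intro equalityI subsetI)
    fix \<beta> assume "\<beta> \<in> dual_forms_part d S k"
    moreover from this have "\<beta> = ?D (?E \<beta>)" using DE by (simp add: dual_forms_part_iff)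
    ultimately show "\<beta> \<in> ?D ` dual_forms_part e T k" using E(2) by blast
  qed (use D(2) in blast)
  ultimately show ?thesis
    unfolding graded_iso_def dual_forms_def[symmetric] dual_forms_part_def[symmetric]
    by (auto simp: graded_dual_def dual_map_def restr0_def fun_eq_iff)
qed

section \<open>The maps of the diagram\<close>

lemma primitive_zero: "primitive 0"
  by (simp add: primitive_def coproduct_eq tensor_def one_list lin_ext_def)

lemma primitive_add: "primitive (u + v)" if "primitive u" "primitive v"
proof -
  have "tensor 1 (u + v) = tensor 1 u + tensor 1 v" "tensor (u + v) 1 = tensor u 1 + tensor v 1"
    by (simp_all add: tensor_def one_list lin_ext_single lin_ext_add)
  then show ?thesis using that by (simp add: primitive_def coproduct_eq lin_ext_add algebra_simps)
qed

lemma primitive_pscale: "primitive (pscale c v)" if "primitive v"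
proof -
  have "tensor 1 (pscale c v) = pscale c (tensor 1 v)" "tensor (pscale c v) 1 =
      pscale c (tensor v 1)"
    by (simp_all add: tensor_def one_list lin_ext_single lin_ext_pscale)
  then show ?thesis
    using that by (simp add: primitive_def coproduct_eq lin_ext_pscale free_vs.scale_right_distrib)
qed

lemma subspace_ls_depth: "free_vs.subspace (component depth m (ls :: 'k::field xz_algebra set))"
proof (rule component_subspace, rule free_vs.subspaceI)
  show "0 \<in> (ls :: 'k xz_algebra set)" by (simp add: ls_def proj_Y_def lin_ext_def primitive_zero)
  show "u + v \<in> ls" if "u \<in> ls" "v \<in> ls" for u v :: "'k xz_algebra"
    using that keys_add[of u v] by (auto simp: ls_def proj_Y_def lin_ext_add primitive_add)
  show "pscale c v \<in> ls" if "v \<in> ls" for c and v :: "'k xz_algebra"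
    using that keys_pscale[of c v] by (auto simp: ls_def proj_Y_def lin_ext_pscale primitive_pscale)
qed

lemma monomial_as_product:
  assumes "length ns = m"
  shows "(\<Prod>i=1..m. var i ^ (ns ! (m - i) - 1)) = single (exponent (rev (map (\<lambda>n. n - 1) ns))) 1"
proof -
  have "(\<Prod>i=1..m. var i ^ (ns ! (m - i) - 1)) =
      (\<Prod>i=1..m. var i ^ (rev (map (\<lambda>n. n - 1) ns) ! (i - 1)))"
    using assms by (intro prod.cong) (auto simp: rev_nth)
  then show ?thesis using assms by (simp only: prod_var_power length_rev length_map)
qed

text \<open>The form is nonzero in finitely many weights, each with finitely many monomials, so the
  sum defining \<open>h_map\<close> is finite and its coefficients can be read off.\<close>

lemma lookup_h_map:
  assumes \<phi>: "\<phi> \<in> dual_forms (poly_weight m) (polys m)"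
  shows "t \<in> monomials m \<Longrightarrow> lookup (h_map m \<phi>) (sym_of m t) = \<phi> (single t 1)"
    and "keys (h_map m \<phi>) \<subseteq> sym_of m ` monomials m"
proof -
  let ?P = "\<lambda>ns. length ns = m \<and> (\<forall>n\<in>set ns. n \<ge> 1)"
  let ?c = "\<lambda>ns. \<phi> (\<Prod>i=1..m. var i ^ (ns ! (m - i) - 1))"
  define K where "K = {k. \<exists>v\<in>component (poly_weight m) k (polys m). \<phi> v \<noteq> 0}"
  have K: "finite K" using \<phi> by (simp add: dual_forms_iff K_def)
  have sym: "\<exists>t\<in>monomials m. SymI ns = sym_of m t \<and> ?c ns = \<phi> (single t 1)" if "?P ns" for ns
  proof -
    let ?ks = "rev (map (\<lambda>n. n - 1) ns)"
    have "sym_of m (exponent ?ks) = SymI ns"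
      using that map_Suc_pred[of ns] by (subst sym_of_exponent) auto
    moreover have "exponent ?ks \<in> monomials m" using that by (intro exponent_in_monomials) simp
    moreover have "?c ns = \<phi> (single (exponent ?ks) 1)"
      by (simp only: monomial_as_product[OF conjunct1[OF that]])
    ultimately show ?thesis by (intro bexI[of _ "exponent ?ks"] conjI) simp_all
  qed
  have "{ns. ?P ns \<and> ?c ns \<noteq> 0} \<subseteq> SymI -` (\<Union>k\<in>K. sym_of m ` {t \<in> monomials m. poly_weight m t = k})"
  proof
    fix ns assume ns: "ns \<in> {ns. ?P ns \<and> ?c ns \<noteq> 0}"
    then obtain t where t: "t \<in> monomials m" "SymI ns = sym_of m t" "\<phi> (single t 1) \<noteq> 0"
        using sym by force
    have "single t 1 \<in> component (poly_weight m) (poly_weight m t) (polys m)"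
      using t(1) by (simp add: component_def polys_iff)
    then have "poly_weight m t \<in> K" using t(3) by (auto simp: K_def)
    then show "ns \<in> SymI -` (\<Union>k\<in>K. sym_of m ` {t \<in> monomials m. poly_weight m t = k})"
        using t by auto
  qed
  moreover have "finite (SymI -` (\<Union>k\<in>K. sym_of m ` {t \<in> monomials m. poly_weight m t = k}))"
    using K finite_monomials_weight by (intro finite_vimageI) (auto simp: inj_def)
  ultimately have fin: "finite {ns. ?P ns \<and> ?c ns \<noteq> 0}" by (rule finite_subset)
  have lookup: "lookup (h_map m \<phi>) s = (case s of SymI ns \<Rightarrow> ?c ns when ?P ns | SymI' _ \<Rightarrow> 0)" for s
    unfolding h_map_def by (rule lookup_Sum_any_SymI[OF fin])
  show "keys (h_map m \<phi>) \<subseteq> sym_of m ` monomials m"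
  proof
    fix s assume "s \<in> keys (h_map m \<phi>)"
    then have "(case s of SymI ns \<Rightarrow> ?c ns when ?P ns | SymI' _ \<Rightarrow> 0) \<noteq> 0"
      unfolding in_keys_iff lookup .
    then obtain ns where "s = SymI ns" "?P ns" by (cases s) auto
    then show "s \<in> sym_of m ` monomials m" unfolding range_sym_of by blast
  qed
  show "lookup (h_map m \<phi>) (sym_of m t) = \<phi> (single t 1)" if t: "t \<in> monomials m"
  proof -
    obtain ns where ns: "sym_of m t = SymI ns" "?P ns" by (auto simp: sym_of_def)
    then obtain t' where t': "t' \<in> monomials m" "SymI ns = sym_of m t'" "?c ns = \<phi> (single t' 1)"
      using sym by blast
    have "t' = t" using ns(1) t'(1,2) t by (intro inj_onD[OF inj_on_sym_of]) simp_all
    then have "?c ns = \<phi> (single t 1)" using t'(3) by (simp only:)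
    then show ?thesis unfolding lookup ns(1) using ns(2) by simp
  qed
qed

text \<open>Both sides are linear in \<open>p\<close> and agree on monomials:
  \<open>h_map m \<phi>\<close> is the combination of symbols that represents \<phi>.\<close>

lemma sym_pairing_h_map:
  assumes \<phi>: "\<phi> \<in> dual_forms (poly_weight m) (polys m)" and p: "p \<in> polys m"
  shows "sym_pairing m (h_map m \<phi>) p = \<phi> p"
proof -
  have mono: "single t c \<in> polys m" if "t \<in> monomials m" for t c using that by (simp add: polys_iff)
  have t: "t \<in> monomials m" if "t \<in> keys p" for t using p that by (auto simp: polys_iff)
  have add: "\<phi> (u + v) = \<phi> u + \<phi> v" if "u \<in> polys m" "v \<in> polys m" for u v
    using \<phi> that by (simp add: dual_forms_iff)
  have scale: "\<phi> (pscale c v) = c * \<phi> v" if "v \<in> polys m" for c v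
    using \<phi> that by (simp add: dual_forms_iff)
  have "\<phi> p = \<phi> (\<Sum>t\<in>keys p. single t (lookup p t))" by (simp add: sum_single_lookup)
  also have "\<dots> = (\<Sum>t\<in>keys p. \<phi> (single t (lookup p t)))"
    by (rule linear_form_sum[OF subspace_polys add scale mono[OF t]])
  also have "\<dots> = (\<Sum>t\<in>keys p. lookup p t * \<phi> (single t 1))"
  proof (rule sum.cong[OF refl])
    fix s assume "s \<in> keys p"
    moreover have "single s (lookup p s) = pscale (lookup p s) (single s 1)"
      by (rule poly_mapping_eqI) (simp add: lookup_single when_def)
    ultimately show "\<phi> (single s (lookup p s)) = lookup p s * \<phi> (single s 1)"
      using scale[OF mono] t by simp
  qed
  also have "\<dots> = sym_pairing m (h_map m \<phi>) p"
    unfolding sym_pairing_def lin_form_def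
        using t by (intro sum.cong) (simp_all add: lookup_h_map(1)[OF \<phi>])
  finally show ?thesis by simp
qed

lemma h_map_eqI:
  assumes \<phi>: "\<phi> \<in> dual_forms (poly_weight m) (polys m)"
    and w: "keys w \<subseteq> sym_of m ` monomials m"
    and eq: "\<And>t. t \<in> monomials m \<Longrightarrow> \<phi> (single t 1) = lookup w (sym_of m t)"
  shows "h_map m \<phi> = w"
proof (rule poly_mapping_eqI)
  fix s
  show "lookup (h_map m \<phi>) s = lookup w s"
  proof (cases "s \<in> sym_of m ` monomials m")
    case True
    then show ?thesis using lookup_h_map(1)[OF \<phi>] eq by auto
  next
    case False
    then show ?thesis using lookup_h_map(2)[OF \<phi>] w by (metis in_keys_iff subsetD)
  qed
qed

text \<open>The inverse of \<open>h_map\<close>, set to zero off \<open>polys m\<close> as the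
  representation of forms requires.\<close>

definition pairing_form :: "nat \<Rightarrow> (symb \<Rightarrow>\<^sub>0 'k) \<Rightarrow> 'k::field mpoly \<Rightarrow> 'k" where
  "pairing_form m w = restr0 (polys m) (sym_pairing m w)"

lemma pairing_form_dual:
  "pairing_form m w \<in> dual_forms (poly_weight m) (polys m)"
  "(\<And>s. s \<in> keys w \<Longrightarrow> symb_weight s = k) \<Longrightarrow>
      pairing_form m w \<in> dual_forms_part (poly_weight m) (polys m) k"
proof -
  have zero: "pairing_form m w p = 0"
    if p: "p \<in> component (poly_weight m) j (polys m)" and j: "\<And>s. s \<in> keys w \<Longrightarrow>
        symb_weight s \<noteq> j" for p j
  proof -
    have "sym_pairing m w p = lin_form (\<lambda>_. 0) p"
      unfolding sym_pairing_def
    proof (rule lin_form_cong)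
      fix t assume "t \<in> keys p"
      then have "t \<in> monomials m" "poly_weight m t = j"
          using p by (auto simp: component_def polys_iff)
      then have "sym_of m t \<notin> keys w" using j[of "sym_of m t"] by (auto simp: symb_weight_sym_of)
      then show "lookup w (sym_of m t) = 0" by (simp add: in_keys_iff)
    qed
    then show ?thesis by (simp add: pairing_form_def restr0_def)
  qed
  have "{k. \<exists>v\<in>component (poly_weight m) k (polys m). pairing_form m w v \<noteq> 0} \<subseteq>
      symb_weight ` keys w"
    using zero by blast
  then have "finite {k. \<exists>v\<in>component (poly_weight m) k (polys m). pairing_form m w v \<noteq> 0}"
    by (rule finite_subset) simp
  then show *: "pairing_form m w \<in> dual_forms (poly_weight m) (polys m)"
    by (simp add: dual_forms_iff pairing_form_def restr0_def
        free_vs.subspace_add[OF subspace_polys] free_vs.subspace_scale[OF subspace_polys])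
  show "pairing_form m w \<in> dual_forms_part (poly_weight m) (polys m) k"
    if "\<And>s. s \<in> keys w \<Longrightarrow> symb_weight s = k"
    using * zero that by (auto simp: dual_forms_part_iff)
qed

lemma h_map_pairing_form:
  assumes "keys w \<subseteq> sym_of m ` monomials m"
  shows "h_map m (pairing_form m w) = w"
  by (rule h_map_eqI[OF pairing_form_dual(1) assms])
     (simp add: pairing_form_def restr0_def polys_iff sym_pairing_def)

abbreviation polys_dual :: "nat \<Rightarrow> ('k::field, 'k mpoly \<Rightarrow> 'k) gspace" where
  "polys_dual m \<equiv> graded_dual (poly_ring m)"

context
  fixes m :: nat
  assumes m: "m \<ge> 2"
begin

lemma polys_dual_simps:
  "gcarrier (polys_dual m) = dual_forms (poly_weight m) (polys m)"
  "gpart (polys_dual m) k = dual_forms_part (poly_weight m) (polys m) k"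
  "gscale (polys_dual m) c \<phi> = (\<lambda>v. c * \<phi> v)"
  by (simp_all add: dual_forms_def dual_forms_part_def poly_ring_eq graded_dual_def)

lemma Dsh_dual_simps:
  "gcarrier (graded_dual (Dsh m)) = dual_forms (poly_weight m) (dsh_polys m)"
  "gpart (graded_dual (Dsh m)) k = dual_forms_part (poly_weight m) (dsh_polys m) k"
  by (simp_all add: dual_forms_def dual_forms_part_def Dsh_eq)

lemma dsh_polys_subset: "dsh_polys m \<subseteq> polys m"
  by (auto simp: dsh_polys_def)

lemma graded_module_polys_dual: "graded_module (polys_dual m)"
  unfolding poly_ring_eq by (rule graded_module_dual)

lemma Dsh_ann_iff:
  fixes \<phi> :: "'k::field_char_0 mpoly \<Rightarrow> 'k"
  shows "\<phi> \<in> Dsh_ann m \<longleftrightarrow> \<phi> \<in> dual_forms (poly_weight m) (polys m) \<and> (\<forall>p\<in>dsh_polys m. \<phi> p = 0)"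
  by (simp add: Dsh_ann_def polys_dual_simps Dsh_eq subspace_graded_def)

lemma submodule_Dsh_ann: "submodule (polys_dual m) (Dsh_ann m :: ('k::field_char_0 mpoly \<Rightarrow> 'k) set)"
  by (auto simp: submodule_def polys_dual_simps Dsh_ann_iff dual_forms_closed)

lemma restr0_eq_iff:
  assumes "\<phi> \<in> dual_forms (poly_weight m) (polys m)" "\<theta> \<in> dual_forms (poly_weight m) (polys m)"
  shows "restr0 (dsh_polys m) \<phi> = restr0 (dsh_polys m) \<theta> \<longleftrightarrow>
      \<phi> - \<theta> \<in> (Dsh_ann m :: ('k::field_char_0 mpoly \<Rightarrow> 'k) set)"
  by (auto simp: Dsh_ann_iff restr0_def fun_eq_iff dual_forms_closed(3)[OF assms])

lemma graded_subspace_dsh_polys: "graded_subspace (poly_weight m) (dsh_polys m)"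
  by (simp add: graded_subspace_def subspace_dsh_polys[OF m] restrict_dsh_polys[OF _ m])

lemma restr0_image:
  "restr0 (dsh_polys m) ` dual_forms (poly_weight m) (polys m) =
      dual_forms (poly_weight m) (dsh_polys m :: 'k::field_char_0 mpoly set)"
  "restr0 (dsh_polys m) ` dual_forms_part (poly_weight m) (polys m) k =
      dual_forms_part (poly_weight m) (dsh_polys m :: 'k mpoly set) k"
proof -
  note ext = extend_dual_form[OF dsh_polys_subset graded_subspace_dsh_polys subspace_polys]
  note restr = restr0_dual_forms[OF dsh_polys_subset subspace_dsh_polys[OF m]]
    restr0_dual_forms_part[OF dsh_polys_subset subspace_dsh_polys[OF m]]
  show "restr0 (dsh_polys m) ` dual_forms (poly_weight m) (polys m) =
      dual_forms (poly_weight m) (dsh_polys m :: 'k mpoly set)"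
  proof (intro equalityI subsetI)
    fix \<alpha> assume "\<alpha> \<in> dual_forms (poly_weight m) (dsh_polys m :: 'k mpoly set)"
    then obtain \<phi> where "\<phi> \<in> dual_forms (poly_weight m) (polys m)" "restr0 (dsh_polys m) \<phi> = \<alpha>"
      by (rule ext)
    then show "\<alpha> \<in> restr0 (dsh_polys m) ` dual_forms (poly_weight m) (polys m)" by blast
  qed (use restr in blast)
  show "restr0 (dsh_polys m) ` dual_forms_part (poly_weight m) (polys m) k =
      dual_forms_part (poly_weight m) (dsh_polys m :: 'k mpoly set) k"
  proof (intro equalityI subsetI)
    fix \<alpha> assume \<alpha>: "\<alpha> \<in> dual_forms_part (poly_weight m) (dsh_polys m :: 'k mpoly set) k"
    then have "\<alpha> \<in> dual_forms (poly_weight m) (dsh_polys m)" by (simp add: dual_forms_part_iff)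
    then obtain \<phi> where "restr0 (dsh_polys m) \<phi> =
        \<alpha>" "\<phi> \<in> dual_forms_part (poly_weight m) (polys m) k"
      by (rule ext) (use \<alpha> in blast)
    then show "\<alpha> \<in> restr0 (dsh_polys m) ` dual_forms_part (poly_weight m) (polys m) k" by blast
  qed (use restr in blast)
qed

lemma g_map_eq: "g_map m = descend (restr0 (dsh_polys m))"
  by (simp add: g_map_def Dsh_eq subspace_graded_def)

lemma graded_iso_g_map:
  "graded_iso (poly_dual_mod_Dsh_ann m) (graded_dual (Dsh m :: ('k::field_char_0,
      'k mpoly) gspace)) (g_map m)"
  unfolding poly_dual_mod_Dsh_ann_def g_map_eq
proof (rule graded_iso_descend[OF graded_module_polys_dual submodule_Dsh_ann])
  show "restr0 (dsh_polys m) ` gcarrier (polys_dual m) =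
      gcarrier (graded_dual (Dsh m :: ('k, 'k mpoly) gspace))"
    unfolding polys_dual_simps Dsh_dual_simps by (rule restr0_image)
  show "restr0 (dsh_polys m) ` gpart (polys_dual m) k =
      gpart (graded_dual (Dsh m :: ('k, 'k mpoly) gspace)) k" for k
    unfolding polys_dual_simps Dsh_dual_simps by (rule restr0_image)
qed (simp_all add: polys_dual_simps restr0_eq_iff,
    simp_all add: graded_dual_def restr0_def fun_eq_iff)

lemma g_map_coset:
  fixes \<phi> :: "'k::field_char_0 mpoly \<Rightarrow> 'k"
  assumes "\<phi> \<in> dual_forms (poly_weight m) (polys m)"
  shows "g_map m (coset (polys_dual m) (Dsh_ann m) \<phi>) = restr0 (dsh_polys m) \<phi>"
  unfolding g_map_eq
  by (rule descend_coset[OF graded_module_polys_dual submodule_Dsh_ann])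
     (use assms in \<open>simp_all add: polys_dual_simps restr0_eq_iff\<close>)

lemma m_pos: "m \<ge> 1"
  using m by simp

lemma subspace_W_of_depth: "free_vs.subspace (W_of_depth m)"
  unfolding W_space_def by (rule component_subspace[OF subspace_keys])

lemma h_map_in_W_of_depth:
  assumes "\<phi> \<in> dual_forms (poly_weight m) (polys m)"
  shows "h_map m \<phi> \<in> W_of_depth m"
  using lookup_h_map(2)[OF assms] by (simp add: W_of_depth_iff[OF m_pos])

text \<open>\<open>h_map m \<phi>\<close> pairs with polynomials as \<phi> does; one direction is
  then \<open>dsh_polys_iff_W_R\<close>, the other the double annihilator
  \<open>W_R_depthI\<close>.\<close>

lemma h_map_in_W_R_iff:
  fixes \<phi> :: "'k::field_char_0 mpoly \<Rightarrow> 'k"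
  assumes \<phi>: "\<phi> \<in> dual_forms (poly_weight m) (polys m)"
  shows "h_map m \<phi> \<in> W_R_depth m \<longleftrightarrow> \<phi> \<in> Dsh_ann m"
proof
  assume h: "h_map m \<phi> \<in> W_R_depth m"
  have "\<phi> p = 0" if "p \<in> dsh_polys m" for p
  proof -
    have p: "p \<in> polys m" using that dsh_polys_subset by blast
    then have "sym_pairing m (h_map m \<phi>) p = 0" using dsh_polys_iff_W_R[OF p m] that h by blast
    then show ?thesis by (simp add: sym_pairing_h_map[OF \<phi> p])
  qed
  then show "\<phi> \<in> Dsh_ann m" using \<phi> by (simp add: Dsh_ann_iff)
next
  assume "\<phi> \<in> Dsh_ann m"
  then have "sym_pairing m (h_map m \<phi>) p = 0" if "p \<in> dsh_polys m" for p
    using sym_pairing_h_map[OF \<phi>, of p] that dsh_polys_subset by (auto simp: Dsh_ann_iff)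
  then show "h_map m \<phi> \<in> W_R_depth m" by (intro W_R_depthI[OF h_map_in_W_of_depth[OF \<phi>] m])
qed

lemma graded_module_W_depth: "graded_module (W_depth m)"
  unfolding W_depth_def by (intro graded_module_subspace subspace_W_of_depth)

lemma submodule_W_R_depth: "submodule (W_depth m) (W_R_depth m)"
  by (simp add: submodule_def W_depth_def subspace_graded_def W_R_depth_subset
      free_vs.subspace_0[OF subspace_W_R_depth] free_vs.subspace_add[OF subspace_W_R_depth]
      free_vs.subspace_scale[OF subspace_W_R_depth])

lemma h_map_part:
  assumes "\<phi> \<in> dual_forms_part (poly_weight m) (polys m) k"
  shows "h_map m \<phi> \<in> gpart (W_depth m) k"
proof -
  have \<phi>: "\<phi> \<in> dual_forms (poly_weight m) (polys m)" using assms by (simp add: dual_forms_part_iff)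
  have "symb_weight s = k" if s: "s \<in> keys (h_map m \<phi>)" for s
  proof (rule ccontr)
    assume neq: "symb_weight s \<noteq> k"
    obtain t where t: "t \<in> monomials m" "s = sym_of m t" using lookup_h_map(2)[OF \<phi>] s by blast
    then have "single t 1 \<in> component (poly_weight m) (poly_weight m t) (polys m)"
      by (simp add: component_def polys_iff)
    then have "\<phi> (single t 1) = 0"
        using assms neq t symb_weight_sym_of[OF t(1)] by (auto simp: dual_forms_part_iff)
    then show False using s t lookup_h_map(1)[OF \<phi> t(1)] by (simp add: in_keys_iff)
  qed
  then show ?thesis
    using h_map_in_W_of_depth[OF \<phi>] by (simp add: W_depth_def subspace_graded_def component_def)
qed

lemma h_map_surj:
  fixes w :: "symb \<Rightarrow>\<^sub>0 'k::field"
  assumes "w \<in> W_of_depth m"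
  shows "h_map m (pairing_form m w) = w"
  using assms W_of_depth_iff[OF m_pos] by (intro h_map_pairing_form) blast

lemma W_depth_simps:
  "gcarrier (W_depth m) = W_of_depth m" "gpart (W_depth m) k =
      component symb_weight k (W_of_depth m)"
  "gscale (W_depth m) = pscale"
  by (simp_all add: W_depth_def subspace_graded_def)

lemma h_bar:
  shows "graded_iso (poly_dual_mod_Dsh_ann m) (W_mod_WR m :: ('k::field_char_0,
      (symb \<Rightarrow>\<^sub>0 'k) set) gspace) (h_bar m)"
    and "\<phi> \<in> dual_forms (poly_weight m) (polys m) \<Longrightarrow>
      h_bar m (coset (polys_dual m) (Dsh_ann m) \<phi>) =
          coset (W_depth m) (W_R_depth m :: (symb \<Rightarrow>\<^sub>0 'k) set) (h_map m \<phi>)"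
proof -
  note mods = graded_module_polys_dual submodule_Dsh_ann graded_module_W_depth submodule_W_R_depth
  have add: "h_map m (\<phi> + \<theta>) = h_map m \<phi> + h_map m \<theta>"
    if "\<phi> \<in> gcarrier (polys_dual m)" "\<theta> \<in> gcarrier (polys_dual m)" for \<phi> \<theta> :: "'k mpoly \<Rightarrow> 'k"
  proof -
    have dual: "\<phi> \<in> dual_forms (poly_weight m) (polys m)" "\<theta> \<in> dual_forms (poly_weight m) (polys m)"
      using that by (simp_all add: polys_dual_simps)
    show ?thesis
    proof (rule h_map_eqI[OF dual_forms_closed(2)[OF dual]])
      show "keys (h_map m \<phi> + h_map m \<theta>) \<subseteq> sym_of m ` monomials m"
        by (rule order_trans[OF keys_add]) (intro Un_least lookup_h_map(2) dual)
    qed (simp add: lookup_add lookup_h_map(1)[OF dual(1)] lookup_h_map(1)[OF dual(2)])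
  qed
  have scale: "h_map m (gscale (polys_dual m) c \<phi>) = gscale (W_depth m) c (h_map m \<phi>)"
    if "\<phi> \<in> gcarrier (polys_dual m)" for c and \<phi> :: "'k mpoly \<Rightarrow> 'k"
  proof -
    have dual: "\<phi> \<in> dual_forms (poly_weight m) (polys m)" using that by (simp add: polys_dual_simps)
    show ?thesis
      unfolding W_depth_simps polys_dual_simps
    proof (rule h_map_eqI[OF dual_forms_closed(4)[OF dual]])
      show "keys (pscale c (h_map m \<phi>)) \<subseteq> sym_of m ` monomials m"
        using keys_pscale lookup_h_map(2)[OF dual] by (rule order_trans)
    qed (simp add: lookup_h_map(1)[OF dual])
  qed
  have into: "h_map m \<phi> \<in> gcarrier (W_depth m)"
      if "\<phi> \<in> gcarrier (polys_dual m)" for \<phi> :: "'k mpoly \<Rightarrow> 'k"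
    using h_map_in_W_of_depth that by (simp add: polys_dual_simps W_depth_simps)
  have part: "h_map m ` gpart (polys_dual m) k \<subseteq> gpart (W_depth m) k" for k
    using h_map_part by (auto simp: polys_dual_simps)
  have ker: "h_map m \<phi> \<in> W_R_depth m \<longleftrightarrow>
      \<phi> \<in> Dsh_ann m" if "\<phi> \<in> gcarrier (polys_dual m)" for \<phi> :: "'k mpoly \<Rightarrow> 'k"
    using h_map_in_W_R_iff that by (simp add: polys_dual_simps)
  have zero: "0 \<in> (W_R_depth m :: (symb \<Rightarrow>\<^sub>0 'k) set)"
      using subspace_W_R_depth by (rule free_vs.subspace_0)
  have onto: "\<exists>\<phi>\<in>gcarrier (polys_dual m). w - h_map m \<phi> \<in> W_R_depth m"
      if "w \<in> gcarrier (W_depth m)" for w :: "symb \<Rightarrow>\<^sub>0 'k"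
    using that h_map_surj[of w] pairing_form_dual(1)[of m w] zero
    by (intro bexI[of _ "pairing_form m w"]) (simp_all add: polys_dual_simps W_depth_simps)
  have onto_part: "\<exists>\<phi>\<in>gpart (polys_dual m) k. w - h_map m \<phi> \<in> W_R_depth m"
      if "w \<in> gpart (W_depth m) k" for k and w :: "symb \<Rightarrow>\<^sub>0 'k"
  proof
    have w: "w \<in> W_of_depth m" "\<And>s. s \<in> keys w \<Longrightarrow> symb_weight s = k"
      using that by (auto simp: W_depth_simps component_def)
    show "pairing_form m w \<in> gpart (polys_dual m) k"
      unfolding polys_dual_simps by (rule pairing_form_dual(2)[OF w(2)])
    show "w - h_map m (pairing_form m w) \<in> W_R_depth m" using h_map_surj[OF w(1)] zero by simp
  qed
  show "graded_iso (poly_dual_mod_Dsh_ann m) (W_mod_WR m :: ('k,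
      (symb \<Rightarrow>\<^sub>0 'k) set) gspace) (h_bar m)"
    unfolding poly_dual_mod_Dsh_ann_def W_mod_WR_def h_bar_def
    by (rule graded_iso_induced_map(1)[OF mods, where f =
        "h_map m"]) (fact into part add scale ker onto onto_part)+
  show "h_bar m (coset (polys_dual m) (Dsh_ann m) \<phi>) =
      coset (W_depth m) (W_R_depth m :: (symb \<Rightarrow>\<^sub>0 'k) set) (h_map m \<phi>)"
    if "\<phi> \<in> dual_forms (poly_weight m) (polys m)" for \<phi> :: "'k mpoly \<Rightarrow> 'k"
  proof -
    have carrier: "\<phi> \<in> gcarrier (polys_dual m)" using that by (simp add: polys_dual_simps)
    show ?thesis
      unfolding h_bar_def
      by (rule graded_iso_induced_map(2)[OF mods, where f = "h_map m", OF _ _ _ _ _ _ _ carrier])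
         (fact into part add scale ker onto onto_part)+
  qed
qed

end

section \<open>The quotients by \<open>W\<^sub>R\<close> and \<open>F\<close>\<close>

lemma graded_isoD:
  assumes "graded_iso A B f"
  shows "inj_on f (gcarrier A)" and "f ` gcarrier A = gcarrier B" and "f ` gpart A k = gpart B k"
  using assms by (auto simp: graded_iso_def bij_betw_def)

lemma V_space_iff: "v \<in> V_space \<longleftrightarrow> keys v \<subseteq> symbols_W \<union> symbols_U"
proof
  assume "v \<in> V_space"
  then show "keys v \<subseteq> symbols_W \<union> symbols_U"
    unfolding V_space_def W_space_def U_space_def using keys_add by fast
next
  assume v: "keys v \<subseteq> symbols_W \<union> symbols_U"
  have "v = restrict_keys (\<lambda>s. s \<in> symbols_W) v + restrict_keys (\<lambda>s. s \<notin> symbols_W) v"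
    by (rule poly_mapping_eqI) (simp add: lookup_add)
  moreover have "restrict_keys (\<lambda>s. s \<in> symbols_W) v \<in> W_space" "restrict_keys (\<lambda>s. s \<notin> symbols_W) v
      \<in> U_space"
    using v by (auto simp: W_space_def U_space_def keys_restrict_keys)
  ultimately show "v \<in> V_space" unfolding V_space_def by blast
qed

text \<open>On \<open>V_space\<close> this is the projection onto W along U.\<close>

definition W_part :: "(symb \<Rightarrow>\<^sub>0 'k::field) \<Rightarrow> (symb \<Rightarrow>\<^sub>0 'k)" where
  "W_part = restrict_keys (\<lambda>s. s \<in> symbols_W)"

lemma keys_W_part: "keys (W_part v) = keys v \<inter> symbols_W"
  by (auto simp: W_part_def keys_restrict_keys)

lemma W_part_add: "W_part (u + v) = W_part u + W_part v"
  by (simp add: W_part_def restrict_keys_add)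

lemma W_part_pscale: "W_part (pscale c v) = pscale c (W_part v)"
  by (simp add: W_part_def restrict_keys_pscale)

lemma W_part_diff: "W_part (u - v) = W_part u - W_part v"
  by (rule poly_mapping_eqI) (simp add: W_part_def lookup_minus)

lemma symbols_disjoint: "symbols_W \<inter> symbols_U = {}"
  by (auto simp: symbols_W_def symbols_U_def)

lemma W_part_W: "w \<in> W_space \<Longrightarrow> W_part w = w"
  by (rule poly_mapping_eqI) (auto simp: W_part_def W_space_def in_keys_iff subset_iff)

lemma W_part_U: "u \<in> U_space \<Longrightarrow> W_part u = 0"
  using symbols_disjoint
  by (intro poly_mapping_eqI) (auto simp: W_part_def U_space_def in_keys_iff subset_iff)

lemma diff_W_part: "v \<in> V_space \<Longrightarrow> v - W_part v \<in> U_space"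
proof -
  assume "v \<in> V_space"
  moreover have "v - W_part v = restrict_keys (\<lambda>s. s \<notin> symbols_W) v"
    by (rule poly_mapping_eqI) (simp add: lookup_minus W_part_def)
  ultimately show ?thesis by (auto simp: V_space_iff U_space_def keys_restrict_keys)
qed

abbreviation V_of_depth :: "nat \<Rightarrow> (symb \<Rightarrow>\<^sub>0 'k::field) set" where
  "V_of_depth m \<equiv> component symb_depth m V_space"

abbreviation F_of_depth :: "nat \<Rightarrow> (symb \<Rightarrow>\<^sub>0 'k::field) set" where
  "F_of_depth m \<equiv> component symb_depth m F_space"

lemma W_part_of_depth:
  assumes "v \<in> V_of_depth m"
  shows "W_part v \<in> W_of_depth m"
    "v \<in> component symb_weight k (V_of_depth m) \<Longrightarrow> W_part v \<in> component symb_weight k (W_of_depth m)"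
  using assms by (auto simp: component_def W_space_def keys_W_part)

lemma W_of_depth_subset: "W_of_depth m \<subseteq> V_of_depth m"
  by (auto simp: component_def W_space_def V_space_iff)

text \<open>The symbols of W and U are disjoint, so the W-component of \<open>w + u\<close> is
  \<open>w\<close>; this exhibits F as the preimage of \<open>W_R\<close>.\<close>

lemma F_of_depth_iff: "v \<in> F_of_depth m \<longleftrightarrow> v \<in> V_of_depth m \<and> W_part v \<in> W_R_depth m"
proof
  assume v: "v \<in> F_of_depth m"
  then obtain w u where wu: "v = w + u" "w \<in> W_R" "u \<in> U_space" unfolding component_def F_space_def
      by blast
  then have "w \<in> W_space" using W_R_subset_W_space by blast
  then have "W_part v = w" "v \<in> V_space"
      using wu by (auto simp: W_part_add W_part_W W_part_U V_space_def)
  then show "v \<in> V_of_depth m \<and> W_part v \<in> W_R_depth m"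
    using v wu(2) keys_W_part[of v] by (auto simp: component_def)
next
  assume v: "v \<in> V_of_depth m \<and> W_part v \<in> W_R_depth m"
  then have "v = W_part v + (v - W_part v)" "v - W_part v \<in> U_space" "W_part v \<in> W_R"
    using diff_W_part by (auto simp: component_def)
  then have "v \<in> F_space" unfolding F_space_def by blast
  then show "v \<in> F_of_depth m" using v by (simp add: component_def)
qed

lemma subspace_V_of_depth: "free_vs.subspace (V_of_depth m :: (symb \<Rightarrow>\<^sub>0 'k::field) set)"
proof (rule component_subspace)
  have eq: "(V_space :: (symb \<Rightarrow>\<^sub>0 'k) set) = {v. keys v \<subseteq> symbols_W \<union> symbols_U}"
    using V_space_iff by blast
  show "free_vs.subspace (V_space :: (symb \<Rightarrow>\<^sub>0 'k) set)"
    unfolding eq by (rule subspace_keys)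
qed

lemma W_part_zero: "W_part 0 = 0"
  by (rule poly_mapping_eqI) (simp add: W_part_def)

lemma graded_module_V_depth: "graded_module (V_depth m)"
  unfolding V_depth_def by (rule graded_module_subspace[OF subspace_V_of_depth])

lemma V_depth_simps:
  "gcarrier (V_depth m) = V_of_depth m" "gpart (V_depth m) k =
      component symb_weight k (V_of_depth m)"
  "gscale (V_depth m) = pscale"
  by (simp_all add: V_depth_def subspace_graded_def)

lemma submodule_F_of_depth: "submodule (V_depth m) (F_of_depth m)"
  by (auto simp: submodule_def V_depth_simps F_of_depth_iff W_part_zero W_part_add W_part_pscale
      free_vs.subspace_0[OF subspace_V_of_depth] free_vs.subspace_add[OF subspace_V_of_depth]
      free_vs.subspace_scale[OF subspace_V_of_depth] free_vs.subspace_0[OF subspace_W_R_depth]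
      free_vs.subspace_add[OF subspace_W_R_depth] free_vs.subspace_scale[OF subspace_W_R_depth])

text \<open>A vector of V differs from its W-component by an element of U, which lies in F, so the
  inclusion is onto modulo F; and F meets W exactly in \<open>W_R\<close>.\<close>

lemma i_bar:
  assumes m: "m \<ge> 2"
  shows "graded_iso (W_mod_WR m) (V_mod_F m :: ('k::field, (symb \<Rightarrow>\<^sub>0 'k) set) gspace) (i_bar m)"
    and "w \<in> W_of_depth m \<Longrightarrow>
      i_bar m (coset (W_depth m) (W_R_depth m) w) =
          coset (V_depth m) (F_of_depth m) (w :: symb \<Rightarrow>\<^sub>0 'k)"
proof -
  note mods =
      graded_module_W_depth[OF m] submodule_W_R_depth[OF m] graded_module_V_depth
          submodule_F_of_depth
  have into: "v \<in> gcarrier (V_depth m)" if "v \<in> gcarrier (W_depth m)" for v :: "symb \<Rightarrow>\<^sub>0 'k"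
    using that W_of_depth_subset by (auto simp: V_depth_simps W_depth_simps[OF m])
  have part: "(\<lambda>v. v) ` gpart (W_depth m) k \<subseteq> (gpart (V_depth m) k :: (symb \<Rightarrow>\<^sub>0 'k) set)" for k
    using W_of_depth_subset by (auto simp: V_depth_simps W_depth_simps[OF m] component_def)
  have ker: "v \<in> F_of_depth m \<longleftrightarrow>
      v \<in> W_R_depth m" if "v \<in> gcarrier (W_depth m)" for v :: "symb \<Rightarrow>\<^sub>0 'k"
  proof -
    have W: "v \<in> W_of_depth m" using that by (simp add: W_depth_simps[OF m])
    then have "v \<in> V_of_depth m" "W_part v = v"
        using W_of_depth_subset by (auto simp: component_def W_part_W)
    then show ?thesis unfolding F_of_depth_iff by simp
  qed
  have diff: "v - W_part v \<in> F_of_depth m" if "v \<in> V_of_depth m" for v :: "symb \<Rightarrow>\<^sub>0 'k"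
  proof -
    have W: "W_part v \<in> W_of_depth m" using W_part_of_depth(1)[OF that] .
    then have "W_part (v - W_part v) = 0" by (simp add: W_part_diff W_part_W component_def)
    moreover have "v - W_part v \<in> V_of_depth m"
      using W W_of_depth_subset that by (intro free_vs.subspace_diff[OF subspace_V_of_depth]) blast+
    ultimately show ?thesis by (simp add: F_of_depth_iff free_vs.subspace_0[OF subspace_W_R_depth])
  qed
  have onto: "\<exists>a\<in>gcarrier (W_depth m). b - a \<in> F_of_depth m"
      if "b \<in> gcarrier (V_depth m)" for b :: "symb \<Rightarrow>\<^sub>0 'k"
    using that diff[of b] W_part_of_depth(1)[of b m]
        by (auto simp: V_depth_simps W_depth_simps[OF m])
  have onto_part: "\<exists>a\<in>gpart (W_depth m) k. b - a \<in> F_of_depth m"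
      if "b \<in> gpart (V_depth m) k" for k and b :: "symb \<Rightarrow>\<^sub>0 'k"
  proof -
    have b: "b \<in> component symb_weight k (V_of_depth m)" "b \<in> V_of_depth m"
      using that by (auto simp: V_depth_simps component_def)
    show ?thesis
      using diff[OF b(2)] W_part_of_depth(2)[OF b(2,1)] by (auto simp: W_depth_simps[OF m])
  qed
  have scale: "gscale (W_depth m) c v = gscale (V_depth m) c v"
      if "v \<in> gcarrier (W_depth m)" for c and v :: "symb \<Rightarrow>\<^sub>0 'k"
    by (simp add: V_depth_simps W_depth_simps[OF m])
  have add: "u + v = u + v"
      if "u \<in> gcarrier (W_depth m)" "v \<in> gcarrier (W_depth m)" for u v :: "symb \<Rightarrow>\<^sub>0 'k"
    by (rule refl)
  show "graded_iso (W_mod_WR m) (V_mod_F m :: ('k, (symb \<Rightarrow>\<^sub>0 'k) set) gspace) (i_bar m)"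
    unfolding W_mod_WR_def V_mod_F_def i_bar_def
    by (rule graded_iso_induced_map(1)[OF mods, where f = "\<lambda>v. v"])
       (fact into part add scale ker onto onto_part)+
  show "i_bar m (coset (W_depth m) (W_R_depth m) w) = coset (V_depth m) (F_of_depth m) w"
    if "w \<in> W_of_depth m" for w :: "symb \<Rightarrow>\<^sub>0 'k"
  proof -
    have carrier: "w \<in> gcarrier (W_depth m)" using that by (simp add: W_depth_simps[OF m])
    show ?thesis
      unfolding i_bar_def
      by (rule graded_iso_induced_map(2)[OF mods, where f = "\<lambda>v. v", OF _ _ _ _ _ _ _ carrier])
         (fact into part add scale ker onto onto_part)+
  qed
qed

section \<open>The pairing of \<open>phi\<close> with \<open>ls\<close>\<close>

lemma lookup_phi:
  assumes w: "w \<in> W_of_depth m" and m: "m \<ge> 1" and ks: "length ks = m"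
  shows "lookup (phi w) (block_word ks k) =
      (if k = 0 then lookup w (sym_of m (exponent ks)) else 0)"
proof -
  have block_inj: "block_word ks k = block_word ks' k' \<longleftrightarrow> ks = ks' \<and> k = k'" for ks ks' k k'
    by (metis exponents_block_word prod.inject)
  have "lookup (phi w) (block_word ks k) = lin_form (\<lambda>s. lookup (phi_symb s) (block_word ks k)) w"
    unfolding phi_def by (rule lookup_lin_ext)
  also have "\<dots> =
      lin_form (\<lambda>s. (if k = 0 then 1 else 0) * (if s = sym_of m (exponent ks) then 1 else 0)) w"
  proof (rule lin_form_cong)
    fix s assume "s \<in> keys w"
    then have "s \<in> sym_of m ` monomials m" using w W_of_depth_iff[OF m] by blast
    then obtain ks' where ks': "length ks' = m" "s = SymI (map Suc (rev ks'))"
      unfolding monomials_eq by (auto simp: sym_of_exponent)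
    have "phi_symb s = single (block_word ks' 0) (1 :: 'a)" by (simp add: ks'(2) rev_map o_def)
    moreover have "s = sym_of m (exponent ks) \<longleftrightarrow> ks' = ks"
      unfolding ks'(2) sym_of_exponent[OF ks] by (simp add: inj_map_eq_map)
    ultimately show "lookup (phi_symb s) (block_word ks k) =
        (if k = 0 then 1 else 0) * (if s = sym_of m (exponent ks) then 1 else (0 :: 'a))"
      by (auto simp: lookup_single block_inj)
  qed
  also have "\<dots> = (if k = 0 then lookup w (sym_of m (exponent ks)) else 0)"
    by (simp add: lin_form_mult_coeff lookup_eq_lin_form)
  finally show ?thesis .
qed

text \<open>On W, \<open>phi\<close> produces only words ending in z, the words that
  \<open>f_map\<close> retains; the reversals in \<open>phi_symb\<close> and \<open>sym_of\<close>
  cancel, so both sides compare the same exponents.\<close>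

lemma pairing_phi_W:
  assumes w: "w \<in> W_of_depth m" and m: "m \<ge> 1" and \<psi>: "\<psi> \<in> component depth m S"
  shows "pairing (phi w) \<psi> = sym_pairing m w (f_map m \<psi>)"
proof -
  have "sym_pairing m w (f_map m \<psi>) = lin_form (\<lambda>v. lin_form (\<lambda>t. lookup w (sym_of m t))
      (case exponents v of (ns, k) \<Rightarrow> if k = 0 then \<Prod>i=1..m. var i ^ (ns ! (i - 1)) else 0)) \<psi>"
    unfolding sym_pairing_def f_map_def by (rule lin_form_lin_ext)
  also have "\<dots> = lin_form (lookup (phi w)) \<psi>"
  proof (rule lin_form_cong)
    fix v assume v: "v \<in> keys \<psi>"
    obtain ns k where e: "exponents v = (ns, k)" by (cases "exponents v")
    have len: "length ns = m" using \<psi> v length_exponents[of v] by (simp add: component_def e)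
    have "v = block_word ns k" using block_word_exponents[of v] by (simp add: e)
    then have "lookup (phi w) v = (if k = 0 then lookup w (sym_of m (exponent ns)) else 0)"
      using lookup_phi[OF w m len] by simp
    then show "lin_form (\<lambda>t. lookup w (sym_of m t))
        (case exponents v of (ns, k) \<Rightarrow> if k = 0 then \<Prod>i=1..m. var i ^ (ns ! (i - 1)) else 0) =
        lookup (phi w) v"
      unfolding e by (simp add: prod_var_power[OF len, simplified])
  qed
  finally show ?thesis by (simp add: pairing_eq_lin_form2)
qed

text \<open>In positive depth the image of U is spanned by shuffle products with x.\<close>

lemma pairing_phi_U:
  assumes u: "u \<in> U_space" "\<And>s. s \<in> keys u \<Longrightarrow> symb_depth s = m" and m: "m \<ge> 1" and \<psi>: "primitive \<psi>"
  shows "pairing (phi u) \<psi> = 0"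
proof -
  have "pairing (phi u) \<psi> = lin_form (\<lambda>s. lin_form (lookup \<psi>) (phi_symb s)) u"
    unfolding pairing_eq_lin_form phi_def by (rule lin_form_lin_ext)
  also have "\<dots> = lin_form (\<lambda>_. 0) u"
  proof (rule lin_form_cong)
    fix s assume s: "s \<in> keys u"
    then have "s \<in> symbols_U" "symb_depth s = m" using u by (auto simp: U_space_def)
    \<comment> \<open>Positive depth excludes all one-entry symbols, including I'(0), so the first
      shuffle factor contains z and is nonempty.\<close>
    then obtain ns where ns: "s = SymI' ns" "length ns \<ge> 2" using m by (auto simp: symbols_U_def)
    let ?v = "block_word (map (\<lambda>n. n - 1) (rev (tl ns))) (hd ns - 1)"
    have "depth ?v = length ns - 1" by (simp add: depth_block_word)
    then have "?v \<noteq> []" using ns(2) by (auto simp: depth_def)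
    then have "pairing (shuffle (single ?v 1) (single [letter.x] 1)) \<psi> = 0"
      by (rule pairing_shuffle_primitive[OF \<psi>]) simp
    moreover have "ns \<noteq> [0]" using ns(2) by auto
    ultimately show "lin_form (lookup \<psi>) (phi_symb s) = 0" by (simp add: ns(1) pairing_eq_lin_form)
  qed
  finally show ?thesis by simp
qed

lemma pairing_add_left: "pairing (u + v) \<psi> = pairing u \<psi> + pairing v \<psi>"
  by (simp add: pairing_eq_lin_form)

lemma pairing_phi_V:
  assumes v: "v \<in> V_of_depth m" and m: "m \<ge> 1" and \<psi>: "\<psi> \<in> component depth m ls"
  shows "pairing (phi v) \<psi> = sym_pairing m (W_part v) (f_map m \<psi>)"
proof -
  have prim: "primitive \<psi>" using \<psi> by (simp add: component_def ls_def)
  have "keys (v - W_part v) \<subseteq> keys v" using keys_diff[of v "W_part v"] by (auto simp: keys_W_part)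
  then have "pairing (phi (v - W_part v)) \<psi> = 0"
    using v diff_W_part[of v] by (intro pairing_phi_U[OF _ _ m prim]) (auto simp: component_def)
  moreover have "phi v = phi (W_part v) + phi (v - W_part v)"
    using lin_ext_add[of phi_symb "W_part v" "v - W_part v"] by (simp add: phi_def)
  ultimately show ?thesis
    using pairing_phi_W[OF W_part_of_depth(1)[OF v] m \<psi>] by (simp add: pairing_add_left)
qed

lemma sym_pairing_diff_left: "sym_pairing m (v - w) p = sym_pairing m v p - sym_pairing m w p"
  using sym_pairing_add_left[of m "v - w" w p] by simp

section \<open>The isomorphism \<open>eps\<close> and the commutativity of the diagram\<close>

context
  fixes m :: nat
  assumes m: "m \<ge> 2"
begin

text \<open>The form on \<open>dsh_polys m\<close> that corresponds to \<open>w\<close>: the inverse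
  of \<open>h_map\<close> followed by restriction.\<close>

definition Dsh_form :: "(symb \<Rightarrow>\<^sub>0 'k) \<Rightarrow> 'k::field_char_0 mpoly \<Rightarrow> 'k" where
  "Dsh_form w = restr0 (dsh_polys m) (pairing_form m w)"

text \<open>The kernel consists of the vectors orthogonal to \<open>dsh_polys m\<close>, which is
  \<open>W_R_depth m\<close> by the double annihilator.\<close>

lemma Dsh_form_eq_iff:
  fixes w w' :: "symb \<Rightarrow>\<^sub>0 'k::field_char_0"
  assumes "w \<in> W_of_depth m" "w' \<in> W_of_depth m"
  shows "Dsh_form w = Dsh_form w' \<longleftrightarrow> w - w' \<in> W_R_depth m"
proof -
  have diff: "w - w' \<in> W_of_depth m"
    using assms by (rule free_vs.subspace_diff[OF subspace_W_of_depth[OF m]])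
  have "Dsh_form w = Dsh_form w' \<longleftrightarrow> (\<forall>p\<in>dsh_polys m. sym_pairing m (w - w') p = 0)"
    using dsh_polys_subset[OF m]
    by (auto simp: Dsh_form_def pairing_form_def restr0_def fun_eq_iff sym_pairing_diff_left
        subset_iff)
  also have "\<dots> \<longleftrightarrow> w - w' \<in> W_R_depth m"
  proof
    assume "w - w' \<in> W_R_depth m"
    then show "\<forall>p\<in>dsh_polys m. sym_pairing m (w - w') p = 0"
      using dsh_polys_iff_W_R[OF _ m] dsh_polys_subset[OF m] by blast
  qed (use W_R_depthI[OF diff m] in blast)
  finally show ?thesis .
qed

lemma pairing_form_h_map:
  assumes "\<phi> \<in> dual_forms (poly_weight m) (polys m)"
  shows "pairing_form m (h_map m \<phi>) = \<phi>"
  using assms sym_pairing_h_map[OF assms]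
      by (auto simp: pairing_form_def restr0_def dual_forms_iff fun_eq_iff)

lemma Dsh_form_image:
  "Dsh_form ` W_of_depth m = dual_forms (poly_weight m) (dsh_polys m :: 'k::field_char_0 mpoly set)"
  "Dsh_form ` component symb_weight k (W_of_depth m) =
      dual_forms_part (poly_weight m) (dsh_polys m :: 'k mpoly set) k"
proof -
  have "pairing_form m ` W_of_depth m = dual_forms (poly_weight m) (polys m :: 'k mpoly set)"
  proof (intro equalityI subsetI)
    fix \<phi> assume \<phi>: "\<phi> \<in> dual_forms (poly_weight m) (polys m :: 'k mpoly set)"
    show "\<phi> \<in> pairing_form m ` W_of_depth m"
      using pairing_form_h_map[OF \<phi>] h_map_in_W_of_depth[OF m \<phi>] by (metis image_eqI)
  qed (use pairing_form_dual(1) in blast)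
  then show "Dsh_form ` W_of_depth m = dual_forms (poly_weight m) (dsh_polys m :: 'k mpoly set)"
    unfolding Dsh_form_def[abs_def] restr0_image(1)[OF m, symmetric]
        by (auto simp: image_image[symmetric])
  have "pairing_form m ` component symb_weight k (W_of_depth m) =
      dual_forms_part (poly_weight m) (polys m :: 'k mpoly set) k"
  proof (intro equalityI subsetI)
    fix \<phi> assume \<phi>: "\<phi> \<in> dual_forms_part (poly_weight m) (polys m :: 'k mpoly set) k"
    then have "\<phi> = pairing_form m (h_map m \<phi>)" by (simp add: pairing_form_h_map dual_forms_part_iff)
    then show "\<phi> \<in> pairing_form m ` component symb_weight k (W_of_depth m)"
      using h_map_part[OF m \<phi>] unfolding W_depth_simps[OF m] by (rule image_eqI)
  next
    fix \<phi> :: "'k mpoly \<Rightarrow> 'k" assume "\<phi> \<in> pairing_form m ` component symb_weight k (W_of_depth m)"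
    then obtain w where "\<phi> = pairing_form m w" "\<And>s. s \<in> keys w \<Longrightarrow>
        symb_weight s = k" by (auto simp: component_def)
    then show "\<phi> \<in> dual_forms_part (poly_weight m) (polys m) k"
        using pairing_form_dual(2)[of w k m] by simp
  qed
  then show "Dsh_form ` component symb_weight k (W_of_depth m) =
      dual_forms_part (poly_weight m) (dsh_polys m :: 'k mpoly set) k"
    unfolding Dsh_form_def[abs_def] restr0_image(2)[OF m, symmetric]
        by (auto simp: image_image[symmetric])
qed

lemma W_part_image:
  "W_part ` V_of_depth m = W_of_depth m"
  "W_part ` component symb_weight k (V_of_depth m) = component symb_weight k (W_of_depth m)"
proof -
  have W: "W_part w = w"
      if "w \<in> W_of_depth m" for w using that by (simp add: component_def W_part_W)
  show "W_part ` V_of_depth m = W_of_depth m"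
  proof (intro equalityI subsetI)
    fix w assume "w \<in> W_of_depth m"
    then show "w \<in> W_part ` V_of_depth m"
        using W[of w] W_of_depth_subset by (metis image_eqI subsetD)
  qed (use W_part_of_depth(1) in blast)
  show "W_part ` component symb_weight k (V_of_depth m) = component symb_weight k (W_of_depth m)"
  proof (intro equalityI subsetI)
    fix w assume w: "w \<in> component symb_weight k (W_of_depth m)"
    then have "w \<in> component symb_weight k (V_of_depth m)" "w \<in> W_of_depth m"
      using W_of_depth_subset by (auto simp: component_def)
    then show "w \<in> W_part ` component symb_weight k (V_of_depth m)"
        using W[of w] by (metis image_eqI)
  next
    fix w assume "w \<in> W_part ` component symb_weight k (V_of_depth m)"
    then obtain v where "w = W_part v" "v \<in> component symb_weight k (V_of_depth m)" by blast
    moreover from this have "v \<in> V_of_depth m" by (simp add: component_def)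
    ultimately show "w \<in> component symb_weight k (W_of_depth m)" using W_part_of_depth(2) by blast
  qed
qed

definition eps_form :: "(symb \<Rightarrow>\<^sub>0 'k::field) \<Rightarrow> 'k xz_algebra \<Rightarrow> 'k" where
  "eps_form v = restr0 (component depth m ls) (pairing (phi v))"

lemma eps_eq: "eps m = descend eps_form"
  by (simp add: eps_def eps_form_def[abs_def] ls_depth_def subspace_graded_def)

text \<open>The diagram in embryo: \<open>eps_form\<close> factors as projection to W, passage to a
  form on \<open>Dsh\<close>, and the dual of \<open>f_map\<close>. Its kernel and image are read
  off from these three maps.\<close>

lemma eps_form_eq:
  fixes v :: "symb \<Rightarrow>\<^sub>0 'k::field_char_0"
  assumes v: "v \<in> V_of_depth m"
  shows "eps_form v = dual_map (ls_depth m) (f_map m) (Dsh_form (W_part v))"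
proof
  fix \<psi> :: "'k xz_algebra"
  have m1: "m \<ge> 1" using m by simp
  show "eps_form v \<psi> = dual_map (ls_depth m) (f_map m) (Dsh_form (W_part v)) \<psi>"
  proof (cases "\<psi> \<in> component depth m ls")
    case True
    then have "f_map m \<psi> \<in> dsh_polys m" "f_map m \<psi> \<in> polys m"
      using f_map_in_dsh_polys[OF _ m1] f_map_in_polys by blast+
    then show ?thesis
      using True pairing_phi_V[OF v m1 True]
      by (simp add: eps_form_def dual_map_def restr0_def Dsh_form_def pairing_form_def ls_depth_def
          subspace_graded_def)
  qed (simp add: eps_form_def dual_map_def restr0_def ls_depth_def subspace_graded_def)
qed

lemma graded_iso_f_map_dual:
  "graded_iso (graded_dual (Dsh m)) (graded_dual (ls_depth m :: ('k::field_char_0,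
      'k xz_algebra) gspace))
     (dual_map (ls_depth m) (f_map m))"
  using graded_iso_f_map[OF m] unfolding Dsh_eq ls_depth_def
  by (rule graded_iso_dual_map[OF _ subspace_ls_depth subspace_dsh_polys[OF m]])

lemma eps_form_add: "eps_form (u + v) = (\<lambda>\<psi>. eps_form u \<psi> + eps_form v \<psi>)"
  by (simp add: eps_form_def restr0_def fun_eq_iff phi_def lin_ext_add pairing_add_left)

lemma eps_form_pscale: "eps_form (pscale c v) = (\<lambda>\<psi>. c * eps_form v \<psi>)"
  by (simp add: eps_form_def restr0_def fun_eq_iff phi_def lin_ext_pscale pairing_eq_lin_form)

lemma eps_form_eq_iff:
  fixes u v :: "symb \<Rightarrow>\<^sub>0 'k::field_char_0"
  assumes "u \<in> V_of_depth m" "v \<in> V_of_depth m"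
  shows "eps_form u = eps_form v \<longleftrightarrow> u - v \<in> F_of_depth m"
proof -
  let ?D = "dual_map (ls_depth m) (f_map m) :: ('k mpoly \<Rightarrow> 'k) \<Rightarrow> _"
  note W = W_part_of_depth(1)[OF assms(1)] W_part_of_depth(1)[OF assms(2)]
  have "inj_on ?D (dual_forms (poly_weight m) (dsh_polys m))"
    by (rule graded_isoD(1)[OF graded_iso_f_map_dual, unfolded Dsh_dual_simps[OF m]])
  moreover have "Dsh_form (W_part u) \<in> dual_forms (poly_weight m) (dsh_polys m)"
    "Dsh_form (W_part v) \<in> dual_forms (poly_weight m) (dsh_polys m)"
    using Dsh_form_image(1) W by blast+
  ultimately have "eps_form u = eps_form v \<longleftrightarrow> Dsh_form (W_part u) = Dsh_form (W_part v)"
    unfolding eps_form_eq[OF assms(1)] eps_form_eq[OF assms(2)] by (rule inj_on_eq_iff)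
  also have "\<dots> \<longleftrightarrow> W_part (u - v) \<in> W_R_depth m"
    unfolding Dsh_form_eq_iff[OF W] W_part_diff ..
  also have "\<dots> \<longleftrightarrow> u - v \<in> F_of_depth m"
    using free_vs.subspace_diff[OF subspace_V_of_depth assms] by (simp add: F_of_depth_iff)
  finally show ?thesis .
qed

lemma eps:
  shows "graded_iso (V_mod_F m) (graded_dual (ls_depth m :: ('k::field_char_0,
      'k xz_algebra) gspace)) (eps m)"
    and "v \<in> V_of_depth m \<Longrightarrow>
        eps m (coset (V_depth m) (F_of_depth m) v) = eps_form (v :: symb \<Rightarrow>\<^sub>0 'k)"
proof -
  let ?D = "dual_map (ls_depth m) (f_map m) :: ('k mpoly \<Rightarrow> 'k) \<Rightarrow> _"
  have D: "?D ` dual_forms (poly_weight m) (dsh_polys m) = gcarrier (graded_dual (ls_depth m))"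
    "?D ` dual_forms_part (poly_weight m) (dsh_polys m) k =
        gpart (graded_dual (ls_depth m)) k" for k
    by (rule graded_isoD(2,3)[OF graded_iso_f_map_dual, unfolded Dsh_dual_simps[OF m]])+
  have image: "eps_form ` X = ?D ` Dsh_form ` W_part ` X" if "X \<subseteq> V_of_depth m" for X
    unfolding image_image using that eps_form_eq by (intro image_cong) auto
  show "graded_iso (V_mod_F m) (graded_dual (ls_depth m :: ('k, 'k xz_algebra) gspace)) (eps m)"
    unfolding V_mod_F_def eps_eq
  proof (rule graded_iso_descend[OF graded_module_V_depth submodule_F_of_depth])
    show "eps_form ` gcarrier (V_depth m) =
        gcarrier (graded_dual (ls_depth m :: ('k, 'k xz_algebra) gspace))"
      unfolding V_depth_simps image[OF order_refl] W_part_image Dsh_form_image D ..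
    show "eps_form ` gpart (V_depth m) k =
        gpart (graded_dual (ls_depth m :: ('k, 'k xz_algebra) gspace)) k" for k
    proof -
      have sub: "component symb_weight k (V_of_depth m) \<subseteq> V_of_depth m"
          by (auto simp: component_def)
      show ?thesis unfolding V_depth_simps image[OF sub] W_part_image Dsh_form_image D ..
    qed
    show "eps_form u = eps_form v \<longleftrightarrow> u - v \<in> F_of_depth m"
      if "u \<in> gcarrier (V_depth m)" "v \<in> gcarrier (V_depth m)" for u v :: "symb \<Rightarrow>\<^sub>0 'k"
      using that unfolding V_depth_simps by (rule eps_form_eq_iff)
  qed (simp_all add: V_depth_simps eps_form_add eps_form_pscale graded_dual_def)
  show "eps m (coset (V_depth m) (F_of_depth m) v) = eps_form v"
      if "v \<in> V_of_depth m" for v :: "symb \<Rightarrow>\<^sub>0 'k"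
    unfolding eps_eq
  proof (rule descend_coset[OF graded_module_V_depth submodule_F_of_depth, where F = eps_form])
    show "v \<in> gcarrier (V_depth m)" using that by (simp add: V_depth_simps)
    show "eps_form u = eps_form v \<longleftrightarrow> u - v \<in> F_of_depth m"
      if "u \<in> gcarrier (V_depth m)" "v \<in> gcarrier (V_depth m)" for u v :: "symb \<Rightarrow>\<^sub>0 'k"
      using that unfolding V_depth_simps by (rule eps_form_eq_iff)
  qed
qed

text \<open>Every \<alpha> is the restriction of a form \<phi> on all polynomials. Along the diagram
  its class goes to that of \<open>h_map m \<phi>\<close>, and \<open>eps_form_eq\<close> gives back
  the restriction of \<phi> composed with \<open>f_map\<close>.\<close>

lemma diagram_commutes:
  fixes \<alpha> :: "'k::field_char_0 mpoly \<Rightarrow> 'k"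
  assumes \<alpha>: "\<alpha> \<in> gcarrier (graded_dual (Dsh m))"
  shows "eps m (i_bar m (h_bar m (inv_into (gcarrier (poly_dual_mod_Dsh_ann m)) (g_map m) \<alpha>))) =
    dual_map (ls_depth m) (f_map m) \<alpha>"
proof -
  let ?C = "inv_into (gcarrier (poly_dual_mod_Dsh_ann m)) (g_map m) \<alpha>"
  have image: "g_map m ` gcarrier (poly_dual_mod_Dsh_ann m) =
      gcarrier (graded_dual (Dsh m :: ('k, 'k mpoly) gspace))"
    by (rule graded_isoD(2)[OF graded_iso_g_map[OF m]])
  have "?C \<in> gcarrier (poly_dual_mod_Dsh_ann m)" and g: "g_map m ?C = \<alpha>"
    using \<alpha> by (simp_all add: image[symmetric] inv_into_into f_inv_into_f)
  then obtain \<phi> where \<phi>: "\<phi> \<in> dual_forms (poly_weight m) (polys m)"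
    and C: "?C = coset (polys_dual m) (Dsh_ann m) \<phi>"
    by (auto simp: poly_dual_mod_Dsh_ann_def quotient_graded_def polys_dual_simps[OF m])
  note W = h_map_in_W_of_depth[OF m \<phi>]
  then have V: "h_map m \<phi> \<in> V_of_depth m" using W_of_depth_subset by blast
  have "eps m (i_bar m (h_bar m ?C)) = eps_form (h_map m \<phi>)"
    unfolding C h_bar(2)[OF m \<phi>] i_bar(2)[OF m W] eps(2)[OF V] ..
  also have "\<dots> = dual_map (ls_depth m) (f_map m) (restr0 (dsh_polys m) \<phi>)"
    using W by (simp add: eps_form_eq[OF V] Dsh_form_def W_part_W component_def
        pairing_form_h_map[OF \<phi>])
  also have "restr0 (dsh_polys m) \<phi> = \<alpha>" using g unfolding C g_map_coset[OF m \<phi>] .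
  finally show ?thesis .
qed

end

theorem proposition7p6:
  fixes m :: nat
  assumes "m \<ge> 2"
  shows
    "graded_iso (ls_depth m :: ('k::field_char_0, 'k xz_algebra) gspace) (Dsh m) (f_map m) \<and>
     graded_iso (poly_dual_mod_Dsh_ann m) (graded_dual (Dsh m :: ('k, 'k mpoly) gspace)) (g_map m) \<and>
     graded_iso (poly_dual_mod_Dsh_ann m) (W_mod_WR m :: ('k, (symb \<Rightarrow>\<^sub>0 'k) set) gspace) (h_bar m) \<and>
     graded_iso (W_mod_WR m) (V_mod_F m :: ('k, (symb \<Rightarrow>\<^sub>0 'k) set) gspace) (i_bar m) \<and>
     graded_iso (V_mod_F m) (graded_dual (ls_depth m :: ('k, 'k xz_algebra) gspace)) (eps m) \<and>
     graded_iso (graded_dual (Dsh m)) (graded_dual (ls_depth m :: ('k, 'k xz_algebra) gspace))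
       (dual_map (ls_depth m) (f_map m)) \<and>
     (\<forall>\<alpha> \<in> gcarrier (graded_dual (Dsh m :: ('k, 'k mpoly) gspace)).
        ((eps m \<circ> i_bar m) \<circ>
           (h_bar m \<circ> inv_into (gcarrier (poly_dual_mod_Dsh_ann m)) (g_map m))) \<alpha>
        = dual_map (ls_depth m) (f_map m) \<alpha>)"
  unfolding o_apply
  by (intro conjI ballI graded_iso_f_map graded_iso_g_map h_bar(1) i_bar(1) eps(1)
      graded_iso_f_map_dual diagram_commutes assms)

end
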